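(* Let $\mathcal{G}\rightrightarrows M$ be an étale Lie groupoid whose orbit map $\pi:M\to M/\mathcal{G}$ is diffeologically étale. Then every $0$-metric on $\mathcal{G}$ induces a Riemannian metric (a definite weak Riemannian metric) on $M/\mathcal{G}$. Conversely, every weak Riemannian metric $g$ on $M/\mathcal{G}$ that is definite with respect to $\pi$ pulls back to a $0$-metric $\pi^*g$ on $\mathcal{G}$, which defines a Riemannian metric on the stack $[M/\!/\mathcal{G}]$ presented by $\mathcal{G}$ that induces $g$.
   Context: Diffeology. A diffeological space is a set $X$ with, for each open subset $U$ of each $\mathbb{R}^n$ ($n\ge 0$), a set of maps $U\to X$ called plots, such that constant maps are plots, plots are closed under precomposition with $C^\infty$ maps between open subsets of Euclidean spaces, and a map that is locally a plot is a plot. A map is smooth if it sends plots to plots by composition. A manifold is a diffeological space whose plots are the $C^\infty$ maps. A quotient $X/R$ has as plots the maps that locally lift to plots of $X$. A family of plots (or smooth maps from manifolds) of $X$ is generating if the maps are jointly surjective and every plot of $X$ locally factors through a member of the family by a $C^\infty$ map. A smooth map $\pi:X\to Y$ of diffeological spaces is diffeologically étale if for every plot $p:U\to Y$ and every $r\in U$, $x\in X$ with $p(r)=\pi(x)$, there is a plot $q$ of $X$ defined on an open neighbourhood of $r$ in $U$ with $\pi\circ q=p$ there and $q(r)=x$, and the germ at $r$ of such a lift is unique. The functor $T_2$. $T_2X$ is the quotient of $\coprod_{p:U\to X \text{ plot},\,U\subseteq\mathbb{R}^n} U\times\mathbb{R}^n\times\mathbb{R}^n$ by the equivalence relation generated by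 $(p;r,v,w)\sim(q;f(r),D_rf(v),D_rf(w))$ whenever $q\circ f=p$ with $f$ a $C^\infty$ map, with the quotient diffeology; write $T_2p(r,v,w)$ for the class. A smooth $h:X\to Y$ induces $T_2h(T_2p(r,v,w))=T_2(h\circ p)(r,v,w)$. For a manifold, $T_2M=TM\times_M TM$. A weak Riemannian metric on $X$ is a smooth map $g:T_2X\to\mathbb{R}$ such that for each plot $p:U\to X$, $p^*g:=g\circ T_2p$ is a symmetric and positive (i.e. positive semi-definite) covariant $2$-tensor on $U$. It is definite if there is a generating family such that $p^*g$ is a Riemannian metric on the domain of $p$ for each $p$ in the family; it is definite with respect to $\pi:M\to M/\mathcal{G}$ if $\pi^*g:=g\circ T_2\pi$ is a Riemannian metric on $M$. Lie groupoids. Manifolds are Hausdorff and second-countable. A Lie groupoid $\mathcal{G}\rightrightarrows M$ has base a manifold $M$ and arrow space $\mathcal{G}$ a not-necessarily Hausdorff nor second-countable manifold, smooth structure maps, source $s$ and target $t$ submersions, with Hausdorff source and target fibres. $M/\mathcal{G}$ is the set of orbits $t(s^{-1}(x))$ with the quotient diffeology. $\mathcal{G}$ is étale if $\dim\mathcal{G}=\dim M$ (so $s$ and $t$ are local diffeomorphisms). Metrics. An étale groupoid acts on $TM$ by $h\cdot v=T(t\circ\sigma_h)(v)$ for $v \in T_{s(h)}M$, where $\sigma_h$ is the local section of $s$ with $\sigma_h(s(h))=h$. A $0$-metric on an étale $\mathcal{G}$ is a Riemannian metric $\eta$ on $M$ invariant under this (diagonal) action on $T_2M$. A $0$-metric $\eta$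 induces a weak Riemannian metric $\overline{\eta}$ on $M/\mathcal{G}$ if $\overline{\eta}\circ T_2\pi=\eta$ as maps $T_2M\to\mathbb{R}$. A Riemannian metric on the stack $[M/\!/\mathcal{G}]$ presented by $\mathcal{G}$ is an equivalence class of $2$-metrics on $\mathcal{G}$; a $2$-metric is a Riemannian metric on $\mathcal{G}^{(2)}=\{(h,k):s(h)=t(k)\}$ invariant under the $S_3$-action permuting the vertices of the commutative triangle $(h,k,hk)$ and transverse to $\mathrm{pr}_1:\mathcal{G}^{(2)}\to\mathcal{G}$ (for étale $\mathcal{G}$: $\mathrm{pr}_1$ pushes it forward to a well-defined metric on $\mathcal{G}$), and it induces the $0$-metric $s_*(\mathrm{pr}_1)_*\eta^2$. For étale $\mathcal{G}$ two $2$-metrics are equivalent iff their induced $0$-metrics coincide, and a $0$-metric $\eta$ defines the Riemannian metric on the stack represented by $\mathrm{pr}_1^*s^*\eta$, whose induced $0$-metric is $\eta$. A Riemannian metric on the stack induces $\overline{\eta}$ if its $0$-metric does. *)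

theory Defs
  imports "HOL-Analysis.Analysis" "HOL-Analysis.Finite_Function_Topology"
begin

section \<open>Smooth maps between open subsets of Euclidean spaces\<close>

text \<open>
  All spaces \<open>R^n\<close>, for \<open>n \<ge> 0\<close>, live in the single normed space of finitely supported real
  sequences: \<open>R^n\<close> is the subspace of the sequences supported in \<open>{0, \<dots>, n - 1}\<close>.  Its
  norm is the l1 norm.  A function that represents a map defined on \<open>U \<subseteq> R^n\<close> may take any
  values outside \<open>U\<close>; no definition below depends on them.
\<close>

type_synonym rvec = "nat \<Rightarrow>\<^sub>0 real"

definition euclid :: "nat \<Rightarrow> rvec set" where
  "euclid n = {x. Poly_Mapping.keys x \<subseteq> {..<n}}"

definition eopen :: "nat \<Rightarrow> rvec set \<Rightarrow> bool" where
  "eopen n U \<longleftrightarrow> openin (top_of_set (euclid n)) U"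

text \<open>
  \<open>f' x\<close> is a bounded linear map on all finitely supported sequences, but for \<open>U\<close> open in
  \<open>R^n\<close> only its restriction to \<open>R^n\<close> is determined by \<open>f\<close>
  (lemma \<open>derivative_unique_euclid\<close>), and only that restriction is ever used.
\<close>

primrec C_k :: "nat \<Rightarrow> nat \<Rightarrow> rvec set \<Rightarrow> (rvec \<Rightarrow> 'b::real_normed_vector) \<Rightarrow> bool" where
  "C_k 0 n U f = continuous_on U f"
| "C_k (Suc k) n U f =
    (\<exists>f'. (\<forall>x\<in>U. (f has_derivative f' x) (at x within U)) \<and>
          (\<forall>v\<in>euclid n. C_k k n U (\<lambda>x. f' x v)))"

definition C_inf :: "nat \<Rightarrow> rvec set \<Rightarrow> (rvec \<Rightarrow> 'b::real_normed_vector) \<Rightarrow> bool" where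
  "C_inf n U f \<longleftrightarrow> (\<forall>k. C_k k n U f)"

definition Der :: "rvec set \<Rightarrow> (rvec \<Rightarrow> 'b::real_normed_vector) \<Rightarrow> rvec \<Rightarrow> rvec \<Rightarrow> 'b" where
  "Der U f r = frechet_derivative f (at r within U)"

lemma derivative_unique_euclid:
  fixes f :: "rvec \<Rightarrow> 'b::real_normed_vector"
  assumes U: "eopen n U" and r: "r \<in> U" and v: "v \<in> euclid n"
    and f': "(f has_derivative f') (at r within U)"
    and f'': "(f has_derivative f'') (at r within U)"
  shows "f' v = f'' v"
proof -
  obtain T where T: "open T" "U = euclid n \<inter> T"
    using U unfolding eopen_def by (auto simp: openin_open)
  have keys: "r + t *\<^sub>R v \<in> euclid n" for t
  proof -
    have "Poly_Mapping.keys (t *\<^sub>R v) \<subseteq> Poly_Mapping.keys v"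
      by (auto simp: scaleR_poly_mapping_def in_keys_iff)
    moreover have "Poly_Mapping.keys (r + t *\<^sub>R v) \<subseteq>
        Poly_Mapping.keys r \<union> Poly_Mapping.keys (t *\<^sub>R v)"
      by (rule Poly_Mapping.keys_add)
    ultimately show ?thesis
      using r v T(2) unfolding euclid_def by blast
  qed
  define S where "S = (\<lambda>t::real. r + t *\<^sub>R v) -` T"
  have S: "open S" "0 \<in> S"
    unfolding S_def using T r by (auto intro!: open_vimage continuous_intros)
  have sub: "(\<lambda>t. r + t *\<^sub>R v) ` S \<subseteq> U"
    using keys T(2) by (auto simp: S_def)
  have "((\<lambda>t. f (r + t *\<^sub>R v)) has_derivative (\<lambda>t. h (t *\<^sub>R v))) (at 0)"
    if "(f has_derivative h) (at r within U)" for h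
  proof -
    define l where "l = (\<lambda>t::real. r + t *\<^sub>R v)"
    have "(f has_derivative h) (at (l 0) within l ` S)"
      using has_derivative_subset[OF that sub] by (simp add: l_def)
    moreover have "(l has_derivative (\<lambda>t. t *\<^sub>R v)) (at 0 within S)"
      unfolding l_def
      by (rule has_derivative_eq_rhs[OF has_derivative_add[OF has_derivative_const
            has_derivative_scaleR_left[OF has_derivative_ident]]]) simp
    ultimately have "((\<lambda>t. f (l t)) has_derivative (\<lambda>t. h (t *\<^sub>R v))) (at 0 within S)"
      using has_derivative_in_compose by blast
    then show ?thesis
      unfolding l_def at_within_open[OF S(2,1)] .
  qed
  from has_derivative_unique[OF this[OF f'] this[OF f'']]
  have "f' (1 *\<^sub>R v) = f'' (1 *\<^sub>R v)"
    by (rule fun_cong)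
  then show ?thesis by simp
qed

section \<open>Diffeological spaces\<close>

text \<open>The triple \<open>(n, U, p)\<close> stands for the plot \<open>p : U \<rightarrow> X\<close>, where \<open>U\<close> is open in \<open>R^n\<close>.\<close>

type_synonym 'a param = "nat \<times> rvec set \<times> (rvec \<Rightarrow> 'a)"

record 'a dspace =
  points :: "'a set"
  plots :: "'a param set"

definition diffeological :: "'a dspace \<Rightarrow> bool" where
  "diffeological X \<longleftrightarrow>
     (\<forall>n U p. (n, U, p) \<in> plots X \<longrightarrow> eopen n U \<and> p ` U \<subseteq> points X) \<and>
     (\<forall>n U p p'. (n, U, p) \<in> plots X \<and> (\<forall>r\<in>U. p' r = p r) \<longrightarrow> (n, U, p') \<in> plots X) \<and>
     (\<forall>n U x. eopen n U \<and> x \<in> points X \<longrightarrow> (n, U, \<lambda>_. x) \<in> plots X) \<and>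
     (\<forall>n U p m W f. (n, U, p) \<in> plots X \<and> eopen m W \<and> C_inf m W f \<and> f ` W \<subseteq> U \<longrightarrow>
        (m, W, p \<circ> f) \<in> plots X) \<and>
     (\<forall>n U p. eopen n U \<and>
        (\<forall>r\<in>U. \<exists>V. eopen n V \<and> r \<in> V \<and> V \<subseteq> U \<and> (n, V, p) \<in> plots X) \<longrightarrow>
        (n, U, p) \<in> plots X)"

definition dsmooth :: "'a dspace \<Rightarrow> 'b dspace \<Rightarrow> ('a \<Rightarrow> 'b) \<Rightarrow> bool" where
  "dsmooth X Y f \<longleftrightarrow>
     f ` points X \<subseteq> points Y \<and> (\<forall>(n, U, p) \<in> plots X. (n, U, f \<circ> p) \<in> plots Y)"

definition real_line :: "real dspace" where
  "real_line = \<lparr>points = UNIV, plots = {(n, U, p). eopen n U \<and> C_inf n U p}\<rparr>"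

definition sub_dspace :: "'a dspace \<Rightarrow> 'a set \<Rightarrow> 'a dspace" where
  "sub_dspace X A =
     \<lparr>points = points X \<inter> A, plots = {(n, U, p). (n, U, p) \<in> plots X \<and> p ` U \<subseteq> A}\<rparr>"

definition product :: "'a dspace \<Rightarrow> 'b dspace \<Rightarrow> ('a \<times> 'b) dspace" where
  "product X Y =
     \<lparr>points = points X \<times> points Y,
      plots = {(n, U, p). (n, U, fst \<circ> p) \<in> plots X \<and> (n, U, snd \<circ> p) \<in> plots Y}\<rparr>"

text \<open>The quotient of \<open>X\<close> by the equivalence relation \<open>f x = f y\<close>, realised on the image of \<open>f\<close>.\<close>

definition quotient_by :: "'a dspace \<Rightarrow> ('a \<Rightarrow> 'b) \<Rightarrow> 'b dspace" where
  "quotient_by X f =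
     \<lparr>points = f ` points X,
      plots = {(n, U, p). eopen n U \<and>
        (\<forall>r\<in>U. \<exists>V q. eopen n V \<and> r \<in> V \<and> V \<subseteq> U \<and> (n, V, q) \<in> plots X \<and>
           (\<forall>z\<in>V. p z = f (q z)))}\<rparr>"

definition generating :: "'a dspace \<Rightarrow> 'a param set \<Rightarrow> bool" where
  "generating X F \<longleftrightarrow>
     F \<subseteq> plots X \<and>
     (\<forall>x\<in>points X. \<exists>(n, U, p)\<in>F. x \<in> p ` U) \<and>
     (\<forall>(n, U, p)\<in>plots X. \<forall>r\<in>U. \<exists>V. eopen n V \<and> r \<in> V \<and> V \<subseteq> U \<and>
        (\<exists>(m, W, q)\<in>F. \<exists>f. C_inf n V f \<and> f ` V \<subseteq> W \<and> (\<forall>z\<in>V. p z = q (f z))))"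

definition diff_etale :: "'a dspace \<Rightarrow> 'b dspace \<Rightarrow> ('a \<Rightarrow> 'b) \<Rightarrow> bool" where
  "diff_etale X Y f \<longleftrightarrow>
     dsmooth X Y f \<and>
     (\<forall>n U p r x. (n, U, p) \<in> plots Y \<and> r \<in> U \<and> x \<in> points X \<and> p r = f x \<longrightarrow>
        (let lift = (\<lambda>V q. eopen n V \<and> r \<in> V \<and> V \<subseteq> U \<and> (n, V, q) \<in> plots X \<and>
                            (\<forall>z\<in>V. f (q z) = p z) \<and> q r = x)
         in (\<exists>V q. lift V q) \<and>
            (\<forall>V q V' q'. lift V q \<and> lift V' q' \<longrightarrow>
               (\<exists>W. eopen n W \<and> r \<in> W \<and> W \<subseteq> V \<inter> V' \<and> (\<forall>z\<in>W. q z = q' z)))))"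

section \<open>Manifolds\<close>

text \<open>
  The D-topology: the finest topology for which all plots are continuous.  On a manifold it is
  the manifold topology.
\<close>

definition dopen :: "'a dspace \<Rightarrow> 'a set \<Rightarrow> bool" where
  "dopen X A \<longleftrightarrow> A \<subseteq> points X \<and> (\<forall>(n, U, p)\<in>plots X. eopen n {r \<in> U. p r \<in> A})"

definition dtopology :: "'a dspace \<Rightarrow> 'a topology" where
  "dtopology X = topology (dopen X)"

lemma openin_dtopology: "openin (dtopology X) A \<longleftrightarrow> dopen X A"
proof -
  have "istopology (dopen X)"
    unfolding istopology_def
  proof (intro conjI allI impI)
    fix S T assume "dopen X S" "dopen X T"
    moreover have "{r \<in> U. p r \<in> S \<inter> T} = {r \<in> U. p r \<in> S} \<inter> {r \<in> U. p r \<in> T}"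
      for U :: "rvec set" and p :: "rvec \<Rightarrow> 'a"
      by auto
    ultimately show "dopen X (S \<inter> T)"
      by (fastforce simp: dopen_def eopen_def intro: openin_Int)
  next
    fix K assume K: "\<forall>S\<in>K. dopen X S"
    have "{r \<in> U. p r \<in> \<Union>K} = (\<Union>S\<in>K. {r \<in> U. p r \<in> S})" for U :: "rvec set" and p :: "rvec \<Rightarrow> 'a"
      by auto
    moreover have "eopen n (\<Union>S\<in>K. {r \<in> U. p r \<in> S})" if "(n, U, p) \<in> plots X" for n U p
      unfolding eopen_def using K that
      by (intro openin_Union) (fastforce simp: dopen_def eopen_def)
    ultimately show "dopen X (\<Union>K)"
      using K by (fastforce simp: dopen_def)
  qed
  then show ?thesis
    by (simp add: dtopology_def topology_inverse')
qed

text \<open>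
  A chart is given by its inverse \<open>\<phi> : V \<rightarrow> X\<close>: a diffeomorphism of an open \<open>V \<subseteq> R^n\<close> onto an
  open subset of \<open>X\<close>.  Charts have smooth transition maps (\<open>chart_transition\<close>), and the plots of a
  manifold are exactly the maps that are \<open>C^\<infinity>\<close> in charts (\<open>manifold_plots\<close>).
\<close>

definition chart :: "nat \<Rightarrow> 'a dspace \<Rightarrow> rvec set \<Rightarrow> (rvec \<Rightarrow> 'a) \<Rightarrow> bool" where
  "chart n X V \<phi> \<longleftrightarrow>
     (n, V, \<phi>) \<in> plots X \<and> inj_on \<phi> V \<and> dopen X (\<phi> ` V) \<and>
     (\<forall>(m, W, p)\<in>plots X. p ` W \<subseteq> \<phi> ` V \<longrightarrow> C_inf m W (inv_into V \<phi> \<circ> p))"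

definition manifold :: "nat \<Rightarrow> 'a dspace \<Rightarrow> bool" where
  "manifold n X \<longleftrightarrow> diffeological X \<and> (\<forall>x\<in>points X. \<exists>V \<phi>. chart n X V \<phi> \<and> x \<in> \<phi> ` V)"

lemma C_k_const: "C_k k n U (\<lambda>_. c)"
proof (induction k arbitrary: c)
  case (Suc k)
  show ?case
    unfolding C_k.simps by (intro exI[of _ "\<lambda>_ _. 0"]) (simp add: Suc)
qed simp

lemma C_k_id: "C_k k n U (\<lambda>x. x)"
proof (cases k)
  case (Suc j)
  show ?thesis
    unfolding Suc C_k.simps by (intro exI[of _ "\<lambda>_ v. v"]) (simp add: C_k_const)
qed simp

lemma plot_domain:
  assumes "diffeological X" "(n, U, p) \<in> plots X"
  shows "eopen n U" "p ` U \<subseteq> points X"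
  using assms(1)[unfolded diffeological_def, THEN conjunct1, rule_format, OF assms(2)] by iprover+

lemma plot_cong:
  assumes "diffeological X" "(n, U, p) \<in> plots X" "\<And>r. r \<in> U \<Longrightarrow> p' r = p r"
  shows "(n, U, p') \<in> plots X"
  by (rule assms(1)[unfolded diffeological_def, THEN conjunct2, THEN conjunct1, rule_format,
        of n U p p']) (intro conjI ballI assms(2,3))

lemma plot_compose:
  assumes "diffeological X" "(n, U, p) \<in> plots X" "eopen m W" "C_inf m W f" "f ` W \<subseteq> U"
  shows "(m, W, p \<circ> f) \<in> plots X"
  using assms(1)[unfolded diffeological_def, THEN conjunct2, THEN conjunct2, THEN conjunct2,
      THEN conjunct1, rule_format, of n U p m W f] assms(2-) by iprover

lemma plot_local:
  assumes "diffeological X" "eopen n U"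
    and "\<And>r. r \<in> U \<Longrightarrow> \<exists>V. eopen n V \<and> r \<in> V \<and> V \<subseteq> U \<and> (n, V, p) \<in> plots X"
  shows "(n, U, p) \<in> plots X"
  by (rule assms(1)[unfolded diffeological_def, THEN conjunct2, THEN conjunct2,
        THEN conjunct2, THEN conjunct2, rule_format])
    (intro conjI ballI assms(2,3))

lemma plot_restrict:
  assumes "diffeological X" "(n, U, p) \<in> plots X" "eopen n V" "V \<subseteq> U"
  shows "(n, V, p) \<in> plots X"
proof -
  have "(n, V, p \<circ> (\<lambda>x. x)) \<in> plots X"
    using assms by (intro plot_compose[of X n U]) (auto simp: C_inf_def C_k_id)
  then show ?thesis by (simp add: comp_def)
qed

lemma chart_preimage:
  assumes "diffeological X" "chart n X V \<phi>" "(m, U, p) \<in> plots X"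
  shows "eopen m {r \<in> U. p r \<in> \<phi> ` V}" "C_inf m {r \<in> U. p r \<in> \<phi> ` V} (inv_into V \<phi> \<circ> p)"
proof -
  have "dopen X (\<phi> ` V)"
    using assms(2) by (simp add: chart_def)
  from bspec[OF this[unfolded dopen_def, THEN conjunct2] assms(3), unfolded prod.case]
  show *: "eopen m {r \<in> U. p r \<in> \<phi> ` V}" .
  have "(m, {r \<in> U. p r \<in> \<phi> ` V}, p) \<in> plots X"
    by (rule plot_restrict[OF assms(1,3) *]) blast
  from bspec[OF assms(2)[unfolded chart_def, THEN conjunct2, THEN conjunct2, THEN conjunct2] this,
      unfolded prod.case]
  show "C_inf m {r \<in> U. p r \<in> \<phi> ` V} (inv_into V \<phi> \<circ> p)"
    by (rule mp) blast
qed

lemma chart_transition: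
  assumes "diffeological X" "chart n X V \<phi>" "chart m X W \<psi>"
  shows "eopen n {r \<in> V. \<phi> r \<in> \<psi> ` W}"
    and "C_inf n {r \<in> V. \<phi> r \<in> \<psi> ` W} (inv_into W \<psi> \<circ> \<phi>)"
  by (rule chart_preimage[OF assms(1,3) assms(2)[unfolded chart_def, THEN conjunct1]])+

lemma manifold_plots:
  assumes "manifold n X" "eopen m U"
  shows "(m, U, p) \<in> plots X \<longleftrightarrow>
    (\<forall>r\<in>U. \<exists>U' V \<phi> f. eopen m U' \<and> r \<in> U' \<and> U' \<subseteq> U \<and> chart n X V \<phi> \<and>
       C_inf m U' f \<and> f ` U' \<subseteq> V \<and> (\<forall>z\<in>U'. p z = \<phi> (f z)))" (is "?P \<longleftrightarrow> ?Q")
proof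
  have X: "diffeological X" using assms by (simp add: manifold_def)
  show ?Q if ?P
  proof
    fix r assume r: "r \<in> U"
    have "p r \<in> points X"
      using plot_domain(2)[OF X \<open>?P\<close>] r by (rule subsetD[OF _ imageI])
    then obtain V \<phi> where c: "chart n X V \<phi>" "p r \<in> \<phi> ` V"
      using assms(1)[unfolded manifold_def, THEN conjunct2] by meson
    let ?U' = "{z \<in> U. p z \<in> \<phi> ` V}"
    show "\<exists>U' V \<phi> f. eopen m U' \<and> r \<in> U' \<and> U' \<subseteq> U \<and> chart n X V \<phi> \<and>
        C_inf m U' f \<and> f ` U' \<subseteq> V \<and> (\<forall>z\<in>U'. p z = \<phi> (f z))"
    proof (intro exI conjI)
      show "eopen m ?U'" "C_inf m ?U' (inv_into V \<phi> \<circ> p)"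
        by (rule chart_preimage[OF X c(1) \<open>?P\<close>])+
      show "(inv_into V \<phi> \<circ> p) ` ?U' \<subseteq> V"
        by (auto intro: inv_into_into)
      show "\<forall>z\<in>?U'. p z = \<phi> ((inv_into V \<phi> \<circ> p) z)"
        by (simp add: f_inv_into_f)
    qed (use r c in auto)
  qed
  show ?P if Q: ?Q
  proof (rule plot_local[OF X assms(2)])
    fix r assume "r \<in> U"
    with Q obtain U' V \<phi> f where *: "eopen m U'" "r \<in> U'" "U' \<subseteq> U" "chart n X V \<phi>"
      "C_inf m U' f" "f ` U' \<subseteq> V" "\<forall>z\<in>U'. p z = \<phi> (f z)"
      by meson
    have "(m, U', \<phi> \<circ> f) \<in> plots X"
      using *(4)[unfolded chart_def, THEN conjunct1] *(1,5,6) by (rule plot_compose[OF X])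
    then have "(m, U', p) \<in> plots X"
      by (rule plot_cong[OF X]) (simp add: *(7))
    then show "\<exists>V. eopen m V \<and> r \<in> V \<and> V \<subseteq> U \<and> (m, V, p) \<in> plots X"
      using * by blast
  qed
qed

text \<open>Surjectivity of the differential, read in charts of manifolds of dimensions \<open>a\<close> and \<open>b\<close>.\<close>

definition submersion :: "nat \<Rightarrow> 'a dspace \<Rightarrow> nat \<Rightarrow> 'b dspace \<Rightarrow> ('a \<Rightarrow> 'b) \<Rightarrow> bool" where
  "submersion a X b Y f \<longleftrightarrow>
     dsmooth X Y f \<and>
     (\<forall>V \<phi> W \<psi>. chart a X V \<phi> \<and> chart b Y W \<psi> \<longrightarrow>
        (\<forall>r\<in>V. f (\<phi> r) \<in> \<psi> ` W \<longrightarrow>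
           Der {z \<in> V. f (\<phi> z) \<in> \<psi> ` W} (inv_into W \<psi> \<circ> f \<circ> \<phi>) r ` euclid a = euclid b))"

section \<open>The functor \<open>T\<^sub>2\<close>\<close>

text \<open>The coproduct of the \<open>U \<times> R^n \<times> R^n\<close> over all plots \<open>p : U \<rightarrow> X\<close>, with elements \<open>(p; r, v, w)\<close>.\<close>

type_synonym 'a T2pre = "'a param \<times> rvec \<times> rvec \<times> rvec"

definition T2_coproduct :: "'a dspace \<Rightarrow> 'a T2pre dspace" where
  "T2_coproduct X =
    \<lparr>points = {((n, U, p), r, v, w) | n U p r v w.
        (n, U, p) \<in> plots X \<and> r \<in> U \<and> v \<in> euclid n \<and> w \<in> euclid n},
     plots = {(m, W, c). eopen m W \<and>
        (\<forall>z\<in>W. \<exists>W' n U p f a b. eopen m W' \<and> z \<in> W' \<and> W' \<subseteq> W \<and> (n, U, p) \<in> plots X \<and>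
           C_inf m W' f \<and> C_inf m W' a \<and> C_inf m W' b \<and>
           f ` W' \<subseteq> U \<and> a ` W' \<subseteq> euclid n \<and> b ` W' \<subseteq> euclid n \<and>
           (\<forall>y\<in>W'. c y = ((n, U, p), f y, a y, b y)))}\<rparr>"

inductive T2_step :: "'a dspace \<Rightarrow> 'a T2pre \<Rightarrow> 'a T2pre \<Rightarrow> bool" for X where
  "(n, U, p) \<in> plots X \<Longrightarrow> (m, W, q) \<in> plots X \<Longrightarrow>
   C_inf n U f \<Longrightarrow> f ` U \<subseteq> W \<Longrightarrow> (\<And>z. z \<in> U \<Longrightarrow> q (f z) = p z) \<Longrightarrow>
   r \<in> U \<Longrightarrow> v \<in> euclid n \<Longrightarrow> w \<in> euclid n \<Longrightarrow>
   T2_step X ((n, U, p), r, v, w) ((m, W, q), f r, Der U f r v, Der U f r w)"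

text \<open>\<open>T2_class X (n, U, p) r v w\<close> is the element \<open>T\<^sub>2p(r, v, w)\<close> of \<open>T\<^sub>2X\<close>.\<close>

definition T2_class :: "'a dspace \<Rightarrow> 'a param \<Rightarrow> rvec \<Rightarrow> rvec \<Rightarrow> rvec \<Rightarrow> 'a T2pre set" where
  "T2_class X P r v w = {e. equivclp (T2_step X) (P, r, v, w) e}"

definition T2 :: "'a dspace \<Rightarrow> 'a T2pre set dspace" where
  "T2 X = quotient_by (T2_coproduct X) (\<lambda>(P, r, v, w). T2_class X P r v w)"

text \<open>
  The map \<open>T\<^sub>2h : T\<^sub>2X \<rightarrow> T\<^sub>2Y\<close>; the union is over sets that all coincide (\<open>T2_map_class\<close>).
\<close>

definition T2_map :: "'b dspace \<Rightarrow> ('a \<Rightarrow> 'b) \<Rightarrow> 'a T2pre set \<Rightarrow> 'b T2pre set" where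
  "T2_map Y h c = (\<Union>((n, U, p), r, v, w)\<in>c. T2_class Y (n, U, h \<circ> p) r v w)"

lemma T2_class_eq_iff:
  "T2_class X P r v w = T2_class X P' r' v' w' \<longleftrightarrow>
     equivclp (T2_step X) (P, r, v, w) (P', r', v', w')"
proof
  assume "T2_class X P r v w = T2_class X P' r' v' w'"
  moreover have "(P', r', v', w') \<in> T2_class X P' r' v' w'"
    by (simp only: T2_class_def mem_Collect_eq equivclp_refl)
  ultimately have "(P', r', v', w') \<in> T2_class X P r v w"
    by (simp only:)
  then show "equivclp (T2_step X) (P, r, v, w) (P', r', v', w')"
    by (simp only: T2_class_def mem_Collect_eq)
next
  assume a: "equivclp (T2_step X) (P, r, v, w) (P', r', v', w')"
  have "equivclp (T2_step X) (P, r, v, w) e \<longleftrightarrow> equivclp (T2_step X) (P', r', v', w') e" for e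
    using equivclp_trans[OF a] equivclp_trans[OF equivclp_sym[OF a]] by iprover
  then show "T2_class X P r v w = T2_class X P' r' v' w'"
    by (simp only: T2_class_def)
qed

lemma T2_map_class:
  assumes h: "dsmooth X Y h"
  shows "T2_map Y h (T2_class X (n, U, p) r v w) = T2_class Y (n, U, h \<circ> p) r v w"
proof -
  define H where "H = (\<lambda>((n, U, p), r, v, w). ((n, U, h \<circ> p), r, v, w) :: 'b T2pre)"
  have plot: "(n, U, h \<circ> p) \<in> plots Y" if "(n, U, p) \<in> plots X" for n U p
    using h that by (auto simp: dsmooth_def)
  have step: "T2_step Y (H a) (H b)" if "T2_step X a b" for a b
    using that
  proof cases
    case (1 n U p m W q f r v w)
    show ?thesis
      unfolding 1 H_def prod.case using 1 by (intro T2_step.intros plot) auto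
  qed
  have eq: "equivclp (T2_step Y) (H a) (H b)" if "equivclp (T2_step X) a b" for a b
    using that
  proof (induction rule: equivclp_induct)
    case (step y z)
    from step.hyps(2) have "equivclp (T2_step Y) (H y) (H z)"
      using \<open>\<And>a b. T2_step X a b \<Longrightarrow> T2_step Y (H a) (H b)\<close>
        r_into_equivclp[of "T2_step Y"] converse_r_into_equivclp[of "T2_step Y"] by iprover
    with step.IH show ?case by (rule equivclp_trans)
  qed simp
  have "T2_class Y (n', U', h \<circ> p') r' v' w' = T2_class Y (n, U, h \<circ> p) r v w"
    if "((n', U', p'), r', v', w') \<in> T2_class X (n, U, p) r v w" for n' U' p' r' v' w'
  proof -
    have "equivclp (T2_step X) ((n, U, p), r, v, w) ((n', U', p'), r', v', w')"
      using that by (simp only: T2_class_def mem_Collect_eq)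
    from eq[OF this] show ?thesis
      unfolding T2_class_eq_iff H_def prod.case by (rule equivclp_sym)
  qed
  moreover have "((n, U, p), r, v, w) \<in> T2_class X (n, U, p) r v w"
    by (simp only: T2_class_def mem_Collect_eq equivclp_refl)
  ultimately show ?thesis
    unfolding T2_map_def by (intro UN_constant_eq) (simp, clarify)
qed

section \<open>Metrics on diffeological spaces and on manifolds\<close>

text \<open>
  A covariant 2-tensor field on an open \<open>U \<subseteq> R^n\<close> is a function on \<open>T\<^sub>2U = U \<times> R^n \<times> R^n\<close>,
  bilinear over each point and with smooth coefficients.
\<close>

definition tensor2 :: "nat \<Rightarrow> rvec set \<Rightarrow> (rvec \<Rightarrow> rvec \<Rightarrow> rvec \<Rightarrow> real) \<Rightarrow> bool" where
  "tensor2 n U \<tau> \<longleftrightarrow>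
     (\<forall>r\<in>U. \<forall>u\<in>euclid n. \<forall>v\<in>euclid n. \<forall>w\<in>euclid n. \<forall>a b.
        \<tau> r (a *\<^sub>R u + b *\<^sub>R v) w = a * \<tau> r u w + b * \<tau> r v w \<and>
        \<tau> r w (a *\<^sub>R u + b *\<^sub>R v) = a * \<tau> r w u + b * \<tau> r w v) \<and>
     (\<forall>v\<in>euclid n. \<forall>w\<in>euclid n. C_inf n U (\<lambda>r. \<tau> r v w))"

definition symmetric_tensor :: "nat \<Rightarrow> rvec set \<Rightarrow> (rvec \<Rightarrow> rvec \<Rightarrow> rvec \<Rightarrow> real) \<Rightarrow> bool" where
  "symmetric_tensor n U \<tau> \<longleftrightarrow>
     tensor2 n U \<tau> \<and> (\<forall>r\<in>U. \<forall>v\<in>euclid n. \<forall>w\<in>euclid n. \<tau> r v w = \<tau> r w v)"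

definition positive_tensor :: "nat \<Rightarrow> rvec set \<Rightarrow> (rvec \<Rightarrow> rvec \<Rightarrow> rvec \<Rightarrow> real) \<Rightarrow> bool" where
  "positive_tensor n U \<tau> \<longleftrightarrow> (\<forall>r\<in>U. \<forall>v\<in>euclid n. \<tau> r v v \<ge> 0)"

definition riemannian_on :: "nat \<Rightarrow> rvec set \<Rightarrow> (rvec \<Rightarrow> rvec \<Rightarrow> rvec \<Rightarrow> real) \<Rightarrow> bool" where
  "riemannian_on n U \<tau> \<longleftrightarrow>
     symmetric_tensor n U \<tau> \<and> (\<forall>r\<in>U. \<forall>v\<in>euclid n. v \<noteq> 0 \<longrightarrow> \<tau> r v v > 0)"

definition pull_plot ::
  "'a dspace \<Rightarrow> 'a param \<Rightarrow> ('a T2pre set \<Rightarrow> real) \<Rightarrow> rvec \<Rightarrow> rvec \<Rightarrow> rvec \<Rightarrow> real" where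
  "pull_plot X P g r v w = g (T2_class X P r v w)"

definition pull_map ::
  "'b dspace \<Rightarrow> ('a \<Rightarrow> 'b) \<Rightarrow> ('b T2pre set \<Rightarrow> real) \<Rightarrow> 'a T2pre set \<Rightarrow> real" where
  "pull_map Y h g = g \<circ> T2_map Y h"

definition weak_metric :: "'a dspace \<Rightarrow> ('a T2pre set \<Rightarrow> real) \<Rightarrow> bool" where
  "weak_metric X g \<longleftrightarrow>
     dsmooth (T2 X) real_line g \<and>
     (\<forall>(n, U, p)\<in>plots X.
        symmetric_tensor n U (pull_plot X (n, U, p) g) \<and>
        positive_tensor n U (pull_plot X (n, U, p) g))"

definition definite :: "'a dspace \<Rightarrow> ('a T2pre set \<Rightarrow> real) \<Rightarrow> bool" where
  "definite X g \<longleftrightarrow>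
     (\<exists>F. generating X F \<and> (\<forall>(n, U, p)\<in>F. riemannian_on n U (pull_plot X (n, U, p) g)))"

text \<open>
  For a manifold \<open>X\<close>, \<open>T\<^sub>2X = TX \<times>\<^sub>X TX\<close>, and for a chart \<open>\<phi> : V \<rightarrow> X\<close> the map
  \<open>(r, v, w) \<mapsto> T\<^sub>2\<phi>(r, v, w)\<close> is the corresponding local trivialisation; so
  \<open>riemannian_manifold\<close> is the usual notion of a Riemannian metric on a manifold, read in charts.
\<close>

definition riemannian_manifold :: "'a dspace \<Rightarrow> ('a T2pre set \<Rightarrow> real) \<Rightarrow> bool" where
  "riemannian_manifold X g \<longleftrightarrow>
     (\<exists>n. manifold n X) \<and>
     (\<forall>n V \<phi>. chart n X V \<phi> \<longrightarrow> riemannian_on n V (pull_plot X (n, V, \<phi>) g))"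

definition definite_wrt ::
  "'a dspace \<Rightarrow> 'b dspace \<Rightarrow> ('a \<Rightarrow> 'b) \<Rightarrow> ('b T2pre set \<Rightarrow> real) \<Rightarrow> bool" where
  "definite_wrt X Y f g \<longleftrightarrow> riemannian_manifold X (pull_map Y f g)"

section \<open>Lie groupoids\<close>

record ('g, 'm) groupoid =
  arrows :: "'g dspace"
  base :: "'m dspace"
  src :: "'g \<Rightarrow> 'm"
  tgt :: "'g \<Rightarrow> 'm"
  idn :: "'m \<Rightarrow> 'g"
  ginv :: "'g \<Rightarrow> 'g"
  gmult :: "'g \<Rightarrow> 'g \<Rightarrow> 'g"

definition composable :: "('g, 'm) groupoid \<Rightarrow> ('g \<times> 'g) dspace" where
  "composable G = sub_dspace (product (arrows G) (arrows G)) {(h, k). src G h = tgt G k}"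

definition groupoid_laws :: "('g, 'm) groupoid \<Rightarrow> bool" where
  "groupoid_laws G \<longleftrightarrow>
     (\<forall>h\<in>points (arrows G). src G h \<in> points (base G) \<and> tgt G h \<in> points (base G)) \<and>
     (\<forall>x\<in>points (base G). idn G x \<in> points (arrows G) \<and>
        src G (idn G x) = x \<and> tgt G (idn G x) = x) \<and>
     (\<forall>(h, k)\<in>points (composable G). gmult G h k \<in> points (arrows G) \<and>
        src G (gmult G h k) = src G k \<and> tgt G (gmult G h k) = tgt G h) \<and>
     (\<forall>h k l. (h, k) \<in> points (composable G) \<and> (k, l) \<in> points (composable G) \<longrightarrow>
        gmult G (gmult G h k) l = gmult G h (gmult G k l)) \<and>
     (\<forall>h\<in>points (arrows G).
        gmult G (idn G (tgt G h)) h = h \<and> gmult G h (idn G (src G h)) = h) \<and>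
     (\<forall>h\<in>points (arrows G). ginv G h \<in> points (arrows G) \<and>
        src G (ginv G h) = tgt G h \<and> tgt G (ginv G h) = src G h \<and>
        gmult G (ginv G h) h = idn G (src G h) \<and> gmult G h (ginv G h) = idn G (tgt G h))"

text \<open>Neither the Hausdorff property nor second countability is imposed on the arrow manifold.\<close>

definition lie_groupoid :: "nat \<Rightarrow> nat \<Rightarrow> ('g, 'm) groupoid \<Rightarrow> bool" where
  "lie_groupoid d m G \<longleftrightarrow>
     groupoid_laws G \<and>
     manifold m (base G) \<and>
     Hausdorff_space (dtopology (base G)) \<and> second_countable (dtopology (base G)) \<and>
     manifold d (arrows G) \<and>
     submersion d (arrows G) m (base G) (src G) \<and>
     submersion d (arrows G) m (base G) (tgt G) \<and>
     dsmooth (base G) (arrows G) (idn G) \<and>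
     dsmooth (arrows G) (arrows G) (ginv G) \<and>
     dsmooth (composable G) (arrows G) (\<lambda>(h, k). gmult G h k) \<and>
     (\<forall>x\<in>points (base G).
        Hausdorff_space (subtopology (dtopology (arrows G)) {h. src G h = x}) \<and>
        Hausdorff_space (subtopology (dtopology (arrows G)) {h. tgt G h = x}))"

definition etale_groupoid :: "('g, 'm) groupoid \<Rightarrow> bool" where
  "etale_groupoid G \<longleftrightarrow> (\<exists>d m. lie_groupoid d m G \<and> d = m)"

definition orbit_map :: "('g, 'm) groupoid \<Rightarrow> 'm \<Rightarrow> 'm set" where
  "orbit_map G x = tgt G ` {h \<in> points (arrows G). src G h = x}"

definition orbit_space :: "('g, 'm) groupoid \<Rightarrow> 'm set dspace" where
  "orbit_space G = quotient_by (base G) (orbit_map G)"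

section \<open>0-metrics\<close>

definition local_section ::
  "('g, 'm) groupoid \<Rightarrow> 'g \<Rightarrow> 'm set \<Rightarrow> ('m \<Rightarrow> 'g) \<Rightarrow> bool" where
  "local_section G h A \<sigma> \<longleftrightarrow>
     dopen (base G) A \<and> src G h \<in> A \<and> dsmooth (sub_dspace (base G) A) (arrows G) \<sigma> \<and>
     (\<forall>x\<in>A. src G (\<sigma> x) = x) \<and> \<sigma> (src G h) = h"

text \<open>
  \<open>arrow_act G h c d\<close> says \<open>d = h \<cdot> c\<close> for the diagonal action of \<open>h\<close> on the fibre of
  \<open>T\<^sub>2M\<close> over \<open>src G h\<close>, that is \<open>d = T\<^sub>2(t \<circ> \<sigma>)(c)\<close> for a local section \<open>\<sigma>\<close> through \<open>h\<close>.
  As \<open>t \<circ> \<sigma>\<close> is only defined on an open set \<open>A\<close>, \<open>c\<close> is represented by a plot with values in \<open>A\<close>.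
  For etale \<open>G\<close> the germ of \<open>\<sigma>\<close>, and hence \<open>d\<close>, is determined by \<open>h\<close> and \<open>c\<close>.
\<close>

inductive arrow_act ::
  "('g, 'm) groupoid \<Rightarrow> 'g \<Rightarrow> 'm T2pre set \<Rightarrow> 'm T2pre set \<Rightarrow> bool" for G where
  "h \<in> points (arrows G) \<Longrightarrow> local_section G h A \<sigma> \<Longrightarrow>
   (n, U, p) \<in> plots (sub_dspace (base G) A) \<Longrightarrow> r \<in> U \<Longrightarrow> p r = src G h \<Longrightarrow>
   v \<in> euclid n \<Longrightarrow> w \<in> euclid n \<Longrightarrow>
   arrow_act G h (T2_class (base G) (n, U, p) r v w)
     (T2_class (base G) (n, U, tgt G \<circ> \<sigma> \<circ> p) r v w)"

definition zero_metric :: "('g, 'm) groupoid \<Rightarrow> ('m T2pre set \<Rightarrow> real) \<Rightarrow> bool" where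
  "zero_metric G \<eta> \<longleftrightarrow>
     riemannian_manifold (base G) \<eta> \<and> (\<forall>h c d. arrow_act G h c d \<longrightarrow> \<eta> d = \<eta> c)"

definition induces ::
  "('g, 'm) groupoid \<Rightarrow> ('m T2pre set \<Rightarrow> real) \<Rightarrow> ('m set T2pre set \<Rightarrow> real) \<Rightarrow> bool" where
  "induces G \<eta> g \<longleftrightarrow>
     weak_metric (orbit_space G) g \<and>
     (\<forall>c\<in>points (T2 (base G)). pull_map (orbit_space G) (orbit_map G) g c = \<eta> c)"

section \<open>2-metrics and metrics on the stack presented by an etale groupoid\<close>

text \<open>
  The triangle of \<open>(h, k)\<close> has vertices \<open>x\<^sub>0 = tgt h\<close>, \<open>x\<^sub>1 = src h = tgt k\<close>,
  \<open>x\<^sub>2 = src k\<close>.  With \<open>leg i : x\<^sub>i \<rightarrow> x\<^sub>0\<close> given by \<open>1, h, hk\<close>, the arrow of the triangle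
  from \<open>x\<^sub>j\<close> to \<open>x\<^sub>i\<close> is \<open>(leg i)\<^sup>-\<^sup>1 (leg j)\<close>.  Relabelling the vertices by \<open>\<rho>\<close> gives the
  triangle of the pair of arrows \<open>x\<^bsub>\<rho> 1\<^esub> \<rightarrow> x\<^bsub>\<rho> 0\<^esub>\<close> and \<open>x\<^bsub>\<rho> 2\<^esub> \<rightarrow> x\<^bsub>\<rho> 1\<^esub>\<close>.
\<close>

definition leg :: "('g, 'm) groupoid \<Rightarrow> 'g \<times> 'g \<Rightarrow> nat \<Rightarrow> 'g" where
  "leg G = (\<lambda>(h, k) i.
     if i = 0 then idn G (tgt G h) else if i = 1 then h else gmult G h k)"

definition triangle_arrow :: "('g, 'm) groupoid \<Rightarrow> 'g \<times> 'g \<Rightarrow> nat \<Rightarrow> nat \<Rightarrow> 'g" where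
  "triangle_arrow G hk i j = gmult G (ginv G (leg G hk i)) (leg G hk j)"

definition S3_act :: "('g, 'm) groupoid \<Rightarrow> (nat \<Rightarrow> nat) \<Rightarrow> 'g \<times> 'g \<Rightarrow> 'g \<times> 'g" where
  "S3_act G \<rho> hk = (triangle_arrow G hk (\<rho> 0) (\<rho> 1), triangle_arrow G hk (\<rho> 1) (\<rho> 2))"

text \<open>
  The push-forward of a metric along a map with bijective differentials: \<open>g\<close> pushes forward to a
  well-defined metric \<open>g'\<close> iff the differentials of \<open>f\<close> carry \<open>g\<close> to \<open>g'\<close> at every point.
  Used only for the local diffeomorphisms \<open>pr\<^sub>1\<close> and \<open>src\<close> of an etale groupoid.
\<close>

definition pushes_forward ::
  "'a dspace \<Rightarrow> 'b dspace \<Rightarrow> ('a \<Rightarrow> 'b) \<Rightarrow> ('a T2pre set \<Rightarrow> real) \<Rightarrow> ('b T2pre set \<Rightarrow> real) \<Rightarrow> bool"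
where
  "pushes_forward X Y f g g' \<longleftrightarrow>
     riemannian_manifold Y g' \<and> (\<forall>c\<in>points (T2 X). g' (T2_map Y f c) = g c)"

definition two_metric :: "('g, 'm) groupoid \<Rightarrow> (('g \<times> 'g) T2pre set \<Rightarrow> real) \<Rightarrow> bool" where
  "two_metric G \<eta>2 \<longleftrightarrow>
     riemannian_manifold (composable G) \<eta>2 \<and>
     (\<forall>\<rho>. \<rho> permutes {0, 1, 2} \<longrightarrow>
        (\<forall>c\<in>points (T2 (composable G)). pull_map (composable G) (S3_act G \<rho>) \<eta>2 c = \<eta>2 c)) \<and>
     (\<exists>\<eta>1. pushes_forward (composable G) (arrows G) fst \<eta>2 \<eta>1)"

definition induced_zero_metric ::
  "('g, 'm) groupoid \<Rightarrow> (('g \<times> 'g) T2pre set \<Rightarrow> real) \<Rightarrow> ('m T2pre set \<Rightarrow> real) \<Rightarrow> bool" where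
  "induced_zero_metric G \<eta>2 \<eta> \<longleftrightarrow>
     (\<exists>\<eta>1. pushes_forward (composable G) (arrows G) fst \<eta>2 \<eta>1 \<and>
           pushes_forward (arrows G) (base G) (src G) \<eta>1 \<eta>)"

text \<open>
  Values of metrics outside \<open>T\<^sub>2M\<close> and \<open>T\<^sub>2G\<^sup>(\<^sup>2\<^sup>)\<close> are irrelevant: a common induced 0-metric
  \<open>\<eta>\<close> means that the two induced 0-metrics agree on \<open>T\<^sub>2M\<close>.
\<close>

definition two_metric_equiv ::
  "('g, 'm) groupoid \<Rightarrow>
    ((('g \<times> 'g) T2pre set \<Rightarrow> real) \<times> (('g \<times> 'g) T2pre set \<Rightarrow> real)) set" where
  "two_metric_equiv G =
     {(\<eta>2, \<eta>2'). two_metric G \<eta>2 \<and> two_metric G \<eta>2' \<and>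
        (\<exists>\<eta>. induced_zero_metric G \<eta>2 \<eta> \<and> induced_zero_metric G \<eta>2' \<eta>)}"

definition stack_metrics :: "('g, 'm) groupoid \<Rightarrow> (('g \<times> 'g) T2pre set \<Rightarrow> real) set set" where
  "stack_metrics G = {\<eta>2. two_metric G \<eta>2} // two_metric_equiv G"

definition stack_metric_of ::
  "('g, 'm) groupoid \<Rightarrow> ('m T2pre set \<Rightarrow> real) \<Rightarrow> (('g \<times> 'g) T2pre set \<Rightarrow> real) set" where
  "stack_metric_of G \<eta> =
     two_metric_equiv G `` {pull_map (arrows G) fst (pull_map (base G) (src G) \<eta>)}"

definition stack_zero_metric ::
  "('g, 'm) groupoid \<Rightarrow> (('g \<times> 'g) T2pre set \<Rightarrow> real) set \<Rightarrow> ('m T2pre set \<Rightarrow> real) \<Rightarrow> bool" where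
  "stack_zero_metric G Q \<eta> \<longleftrightarrow> Q \<in> stack_metrics G \<and> (\<forall>\<eta>2\<in>Q. induced_zero_metric G \<eta>2 \<eta>)"

definition stack_induces ::
  "('g, 'm) groupoid \<Rightarrow> (('g \<times> 'g) T2pre set \<Rightarrow> real) set \<Rightarrow> ('m set T2pre set \<Rightarrow> real) \<Rightarrow> bool" where
  "stack_induces G Q g \<longleftrightarrow> (\<exists>\<eta>. stack_zero_metric G Q \<eta> \<and> induces G \<eta> g)"

end

theory Submission
  imports Defs
begin

text \<open>
  The inverse function theorem makes \<open>src\<close>, \<open>tgt\<close> and \<open>fst : G\<^sup>(\<^sup>2\<^sup>) \<rightarrow> G\<close> local
  diffeomorphisms.  A 0-metric \<open>\<eta>\<close> is descended by lifting: the value at \<open>T\<^sub>2p(r, v, w)\<close> is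
  \<open>\<eta>(T\<^sub>2q(r, v, w))\<close> for a local lift \<open>q\<close> of \<open>p\<close> to \<open>M\<close>.  Two lifts have values \<open>q r\<close> and \<open>q' r\<close>
  joined by an arrow; pushing \<open>q\<close> along a local section through that arrow gives a lift with the
  value \<open>q' r\<close>, which has the same germ as \<open>q'\<close> because \<open>\<pi>\<close> is diffeologically etale, so invariance
  of \<open>\<eta>\<close> gives well-definedness.  Conversely \<open>\<pi> \<circ> tgt = \<pi> \<circ> src\<close> makes \<open>\<pi>\<^sup>*g\<close> invariant, and the
  pull-back of \<open>g\<close> to \<open>G\<^sup>(\<^sup>2\<^sup>)\<close> along \<open>\<pi> \<circ> src \<circ> fst\<close> is \<open>S\<^sub>3\<close>-invariant because all vertices of a
  triangle lie in one orbit.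
\<close>

section \<open>The spaces \<open>R^n\<close>\<close>

text \<open>Every R^n sits in one infinite-dimensional, incomplete space of finitely supported
  sequences, and a derivative is determined on R^n only. Linear algebra and the inverse function
  theorem are therefore developed relative to \<open>euclid n\<close>, and the coordinate projection
  \<open>trunc n\<close> turns facts about R^n into facts about globally defined maps.

  A second obstacle is that \<open>T2\<close> is a quotient by a generated equivalence, whose chains
  pass through arbitrary plots of the orbit space. The descended function is first defined on
  representatives, and invariance is checked on a single generator \<open>q \<circ> f = p\<close>: a
  lift of q composed with f is a lift of p, and the two values agree by the same generator on M.
  Local lifts come from the quotient diffeology; etaleness of \<pi> enters through the uniqueness of
  germs.

  Smoothness on \<open>T2\<close> comes for free once all tensors p^*g are smooth
  (\<open>weak_metricI\<close>), and definiteness on the orbit space is witnessed by the charts of M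
  followed by \<pi>.\<close>

abbreviation unit_vec :: "nat \<Rightarrow> rvec" where
  "unit_vec i \<equiv> Poly_Mapping.single i 1"

lemma lookup_scaleR: "Poly_Mapping.lookup (a *\<^sub>R x) i = a *\<^sub>R Poly_Mapping.lookup x i"
proof -
  have "finite {i. a *\<^sub>R Poly_Mapping.lookup x i \<noteq> 0}"
    by (rule finite_subset[OF _ finite_keys[of x]]) (auto simp: in_keys_iff)
  then show ?thesis
    by (simp add: scaleR_poly_mapping_def)
qed

lemma norm_rvec: "norm (x :: rvec) = (\<Sum>i\<in>Poly_Mapping.keys x. \<bar>Poly_Mapping.lookup x i\<bar>)"
  unfolding norm_poly_mapping_def dist_poly_mapping_def by simp

lemma euclid_iff: "x \<in> euclid n \<longleftrightarrow> (\<forall>i\<ge>n. Poly_Mapping.lookup x i = 0)"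
  unfolding euclid_def mem_Collect_eq subset_iff in_keys_iff lessThan_iff by (metis not_le)

lemma norm_euclid:
  assumes "x \<in> euclid n"
  shows "norm x = (\<Sum>i<n. \<bar>Poly_Mapping.lookup x i\<bar>)"
  unfolding norm_rvec using assms
  by (intro sum.mono_neutral_left) (auto simp: euclid_def in_keys_iff)

lemma subspace_euclid: "subspace (euclid n)"
  by (auto simp: subspace_def euclid_iff lookup_add lookup_scaleR)

lemmas euclid_add = subspace_add[OF subspace_euclid]
lemmas euclid_diff = subspace_diff[OF subspace_euclid]
lemmas euclid_scaleR = subspace_scale[OF subspace_euclid]
lemmas euclid_sum = subspace_sum[OF subspace_euclid]

lemma unit_vec_euclid [simp]: "i < n \<Longrightarrow> unit_vec i \<in> euclid n"
  by (auto simp: euclid_iff lookup_single)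

lemma bounded_linear_lookup: "bounded_linear (\<lambda>x::rvec. Poly_Mapping.lookup x i)"
proof (rule bounded_linear_intro[where K = 1])
  fix x :: rvec
  show "norm (Poly_Mapping.lookup x i) \<le> norm x * 1"
  proof (cases "i \<in> Poly_Mapping.keys x")
    case True
    then show ?thesis
      unfolding norm_rvec by (auto intro: member_le_sum)
  qed (simp add: in_keys_iff)
qed (auto simp: lookup_add lookup_scaleR)

text \<open>The coordinate projection onto R^n as a total map: composing with it makes a property
  known on \<open>euclid n\<close> hold on the whole sequence space without changing values on
  R^n.\<close>

definition trunc :: "nat \<Rightarrow> rvec \<Rightarrow> rvec" where
  "trunc n x = (\<Sum>i<n. Poly_Mapping.lookup x i *\<^sub>R unit_vec i)"

lemma lookup_trunc: "Poly_Mapping.lookup (trunc n x) i = (if i < n then Poly_Mapping.lookup x i else 0)"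
proof -
  have "Poly_Mapping.lookup (trunc n x) i =
      (\<Sum>j<n. if i = j then Poly_Mapping.lookup x j else 0)"
    unfolding trunc_def lookup_sum lookup_scaleR by (intro sum.cong) (auto simp: lookup_single when_def)
  then show ?thesis by simp
qed

lemma trunc_euclid [simp]: "trunc n x \<in> euclid n"
  by (simp add: euclid_iff lookup_trunc)

lemma trunc_id: "x \<in> euclid n \<Longrightarrow> trunc n x = x"
  by (rule poly_mapping_eqI) (auto simp: lookup_trunc euclid_iff)

lemma bounded_linear_trunc: "bounded_linear (trunc n)"
  unfolding trunc_def[abs_def]
  by (intro bounded_linear_sum bounded_linear_compose[OF bounded_linear_scaleR_left] bounded_linear_lookup)

lemma norm_trunc_le: "norm (trunc n x) \<le> norm x"
proof -
  have "norm (trunc n x) = (\<Sum>i\<in>{..<n} \<inter> Poly_Mapping.keys x. \<bar>Poly_Mapping.lookup x i\<bar>)"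
    unfolding norm_euclid[OF trunc_euclid]
    by (intro sum.mono_neutral_cong_right) (auto simp: lookup_trunc in_keys_iff)
  also have "\<dots> \<le> norm x"
    unfolding norm_rvec by (intro sum_mono2) auto
  finally show ?thesis .
qed

lemma linear_euclid_expand:
  assumes "linear L" "x \<in> euclid n"
  shows "L x = (\<Sum>i<n. Poly_Mapping.lookup x i *\<^sub>R L (unit_vec i))"
proof -
  have "L (trunc n x) = (\<Sum>i<n. Poly_Mapping.lookup x i *\<^sub>R L (unit_vec i))"
    unfolding trunc_def using assms(1) by (simp add: linear_sum linear_scale)
  then show ?thesis using assms(2) by (simp add: trunc_id)
qed

text \<open>For the l1 norm, the operator norm on R^n is the largest norm of a column.\<close>

lemma norm_linear_euclid_le:
  assumes "linear L" "x \<in> euclid n" "\<And>i. i < n \<Longrightarrow> norm (L (unit_vec i)) \<le> B"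
  shows "norm (L x) \<le> B * norm x"
proof -
  have "norm (L x) \<le> (\<Sum>i<n. \<bar>Poly_Mapping.lookup x i\<bar> * B)"
    unfolding linear_euclid_expand[OF assms(1,2)]
    by (rule sum_norm_le) (auto intro!: mult_left_mono assms(3))
  then show ?thesis
    by (simp add: norm_euclid[OF assms(2)] sum_distrib_right sum_distrib_left mult.commute)
qed

text \<open>A linear map on the infinite-dimensional space may be unbounded; after truncation only n
  coordinates matter.\<close>

lemma bounded_linear_comp_trunc:
  assumes "linear L"
  shows "bounded_linear (\<lambda>x. L (trunc n x))"
proof -
  have "(\<lambda>x. L (trunc n x)) = (\<lambda>x. \<Sum>i<n. Poly_Mapping.lookup x i *\<^sub>R L (unit_vec i))"
    using assms by (simp add: trunc_def linear_sum linear_scale)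
  then show ?thesis
    by (simp only:) (intro bounded_linear_sum bounded_linear_compose[OF bounded_linear_scaleR_left]
        bounded_linear_lookup)
qed

text \<open>The ambient space is not complete, so the fixed point argument needs completeness of R^n
  itself; it is obtained coordinatewise.\<close>

lemma complete_euclid: "complete (euclid n)"
  unfolding complete_def
proof (intro allI impI, elim conjE)
  fix X :: "nat \<Rightarrow> rvec"
  assume X: "\<forall>k. X k \<in> euclid n" and "Cauchy X"
  have "Cauchy (\<lambda>k. Poly_Mapping.lookup (X k) i)" for i
    using bounded_linear.Cauchy[OF bounded_linear_lookup \<open>Cauchy X\<close>] .
  then have "\<forall>i. \<exists>l. (\<lambda>k. Poly_Mapping.lookup (X k) i) \<longlonglongrightarrow> l"
    by (simp add: Cauchy_convergent_iff convergent_def)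
  then obtain l where "\<And>i. (\<lambda>k. Poly_Mapping.lookup (X k) i) \<longlonglongrightarrow> l i"
    by metis
  then have "(\<lambda>k. trunc n (X k)) \<longlonglongrightarrow> (\<Sum>i<n. l i *\<^sub>R unit_vec i)"
    unfolding trunc_def by (intro tendsto_intros)
  then have "X \<longlonglongrightarrow> (\<Sum>i<n. l i *\<^sub>R unit_vec i)"
    using X by (simp add: trunc_id)
  moreover have "(\<Sum>i<n. l i *\<^sub>R unit_vec i) \<in> euclid n"
    by (intro euclid_sum euclid_scaleR) auto
  ultimately show "\<exists>l\<in>euclid n. X \<longlonglongrightarrow> l" by blast
qed

section \<open>Open subsets of \<open>R^n\<close>\<close>

lemma eopen_subset: "eopen n U \<Longrightarrow> U \<subseteq> euclid n"
  by (simp add: eopen_def openin_imp_subset)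

lemma eopen_euclid [simp]: "eopen n (euclid n)"
  by (simp add: eopen_def)

lemma eopen_Int_open: "eopen n U \<Longrightarrow> open T \<Longrightarrow> eopen n (U \<inter> T)"
  unfolding eopen_def by (auto simp: openin_open Int_assoc)

lemma eopen_preimage:
  assumes "eopen n U" "continuous_on U f" "f ` U \<subseteq> euclid m" "eopen m W"
  shows "eopen n {r \<in> U. f r \<in> W}"
proof -
  have "openin (top_of_set U) (U \<inter> f -` W)"
    using assms by (intro continuous_openin_preimage[of _ _ "euclid m"]) (auto simp: eopen_def)
  then have "openin (top_of_set (euclid n)) (U \<inter> f -` W)"
    using assms(1) unfolding eopen_def by (rule openin_trans)
  moreover have "U \<inter> f -` W = {r \<in> U. f r \<in> W}" by auto
  ultimately show ?thesis by (simp add: eopen_def)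
qed

lemma eopen_preimage_open:
  assumes "eopen n U" "continuous_on U f" "open T"
  shows "eopen n {r \<in> U. f r \<in> T}"
proof -
  have "openin (top_of_set U) (U \<inter> f -` T)"
    by (rule continuous_openin_preimage_gen[OF assms(2,3)])
  then have "openin (top_of_set (euclid n)) (U \<inter> f -` T)"
    using assms(1) unfolding eopen_def by (rule openin_trans)
  moreover have "U \<inter> f -` T = {r \<in> U. f r \<in> T}" by auto
  ultimately show ?thesis by (simp add: eopen_def)
qed

lemma eopen_ball:
  assumes "eopen n U" "r \<in> U"
  obtains e where "e > 0" "euclid n \<inter> ball r e \<subseteq> U"
proof -
  obtain T where T: "open T" "U = euclid n \<inter> T"
    using assms(1) by (auto simp: eopen_def openin_open)
  then obtain e where "e > 0" "ball r e \<subseteq> T"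
    using assms(2) by (auto elim: openE)
  then show thesis using that T by blast
qed

text \<open>Open subsets of the same R^n look alike near a common point; hence \<open>Der\<close>
  does not change when the domain shrinks.\<close>

lemma at_within_eopen:
  assumes "eopen n U" "eopen n V" "V \<subseteq> U" "r \<in> V"
  shows "at r within V = at r within U"
proof -
  obtain T where T: "open T" "V = euclid n \<inter> T"
    using assms(2) by (auto simp: eopen_def openin_open)
  show ?thesis
    by (rule at_within_nhd[of r T]) (use T assms(1,3,4) eopen_subset in auto)
qed

section \<open>Calculus of \<open>C^k\<close> maps\<close>

lemma has_derivative_Der:
  assumes "(f has_derivative f') (at r within U)"
  shows "(f has_derivative Der U f r) (at r within U)"
  unfolding Der_def using assms differentiableI frechet_derivative_works by blast

lemma Der_eq:
  assumes "eopen n U" "r \<in> U" "v \<in> euclid n" "(f has_derivative f') (at r within U)"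
  shows "Der U f r v = f' v"
  by (rule derivative_unique_euclid[OF assms(1-3) has_derivative_Der[OF assms(4)] assms(4)])

lemma C_k_cong:
  "C_k k n U f \<Longrightarrow> (\<And>x. x \<in> U \<Longrightarrow> f x = g x) \<Longrightarrow> C_k k n U g"
proof (induction k arbitrary: f g)
  case 0
  then show ?case using continuous_on_cong[of U U f g] by simp
next
  case (Suc k)
  obtain f' where f': "\<And>x. x \<in> U \<Longrightarrow> (f has_derivative f' x) (at x within U)"
      "\<And>v. v \<in> euclid n \<Longrightarrow> C_k k n U (\<lambda>x. f' x v)"
    using Suc.prems(1) by auto
  have "(g has_derivative f' x) (at x within U)" if "x \<in> U" for x
    by (rule has_derivative_transform[OF that _ f'(1)[OF that]]) (simp add: Suc.prems(2))
  then show ?case using f'(2) by auto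
qed

lemma C_k_restrict: "C_k k n U f \<Longrightarrow> V \<subseteq> U \<Longrightarrow> C_k k n V f"
proof (induction k arbitrary: f)
  case 0
  then show ?case using continuous_on_subset by auto
next
  case (Suc k)
  obtain f' where f': "\<And>x. x \<in> U \<Longrightarrow> (f has_derivative f' x) (at x within U)"
      "\<And>v. v \<in> euclid n \<Longrightarrow> C_k k n U (\<lambda>x. f' x v)"
    using Suc.prems(1) by auto
  have "(f has_derivative f' x) (at x within V)" if "x \<in> V" for x
    using f'(1) Suc.prems(2) that by (blast intro: has_derivative_subset)
  then show ?case using f'(2) Suc.IH[OF _ Suc.prems(2)] by auto
qed

text \<open>On open sets the derivative is unique on R^n, so the existential witness in
  \<open>C_k\<close> can be replaced by the canonical \<open>Der\<close>. This is what allows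
  locally given derivatives to be glued.\<close>

lemma C_k_Suc:
  assumes "eopen n U"
  shows "C_k (Suc k) n U f \<longleftrightarrow>
    (\<forall>x\<in>U. (f has_derivative Der U f x) (at x within U)) \<and>
    (\<forall>v\<in>euclid n. C_k k n U (\<lambda>x. Der U f x v))" (is "?l \<longleftrightarrow> ?r")
proof
  assume ?l
  then obtain f' where f': "\<And>x. x \<in> U \<Longrightarrow> (f has_derivative f' x) (at x within U)"
      "\<And>v. v \<in> euclid n \<Longrightarrow> C_k k n U (\<lambda>x. f' x v)"
    by auto
  show ?r
    using has_derivative_Der[OF f'(1)]
    by (auto intro: C_k_cong[OF f'(2)] simp: Der_eq[OF assms _ _ f'(1)])
qed auto

lemma C_k_SucD: "C_k (Suc k) n U f \<Longrightarrow> C_k k n U f"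
proof (induction k arbitrary: f)
  case 0
  then show ?case
    by (auto simp: continuous_on_eq_continuous_within intro: has_derivative_continuous)
next
  case (Suc k)
  obtain f' where "\<forall>x\<in>U. (f has_derivative f' x) (at x within U)"
      "\<forall>v\<in>euclid n. C_k (Suc k) n U (\<lambda>x. f' x v)"
    using Suc.prems by (auto simp only: C_k.simps(2)[of "Suc k"])
  then show ?case
    using Suc.IH by (auto simp only: C_k.simps(2)[of k])
qed

lemma C_k_continuous_on: "C_k k n U f \<Longrightarrow> continuous_on U f"
  by (induction k) (auto dest: C_k_SucD simp del: C_k.simps(2))

lemma Der_restrict:
  assumes "eopen n U" "eopen n V" "V \<subseteq> U" "r \<in> V"
  shows "Der V f r = Der U f r"
  by (simp add: Der_def at_within_eopen[OF assms])

lemma C_k_local: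
  assumes "eopen n U" "\<And>r. r \<in> U \<Longrightarrow> \<exists>V. eopen n V \<and> r \<in> V \<and> V \<subseteq> U \<and> C_k k n V f"
  shows "C_k k n U f"
  using assms(2)
proof (induction k arbitrary: f)
  case 0
  have "continuous (at r within U) f" if "r \<in> U" for r
  proof -
    obtain V where V: "eopen n V" "r \<in> V" "V \<subseteq> U" "continuous_on V f"
      using 0[OF \<open>r \<in> U\<close>] by auto
    then show ?thesis
      using at_within_eopen[OF assms(1) V(1,3,2)]
      by (metis continuous_on_eq_continuous_within)
  qed
  then show ?case by (simp add: continuous_on_eq_continuous_within)
next
  case (Suc k)
  have "(f has_derivative Der U f r) (at r within U)" if r: "r \<in> U" for r
  proof -
    obtain V where V: "eopen n V" "r \<in> V" "V \<subseteq> U" "C_k (Suc k) n V f"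
      using Suc.prems[OF r] by blast
    then have "(f has_derivative Der V f r) (at r within V)"
      unfolding C_k_Suc[OF V(1)] by blast
    then show ?thesis
      using at_within_eopen[OF assms(1) V(1,3,2)] Der_restrict[OF assms(1) V(1,3,2)] by metis
  qed
  moreover have "C_k k n U (\<lambda>x. Der U f x v)" if "v \<in> euclid n" for v
  proof (rule Suc.IH)
    fix r assume "r \<in> U"
    then obtain V where V: "eopen n V" "r \<in> V" "V \<subseteq> U" "C_k (Suc k) n V f"
      using Suc.prems by blast
    then have "C_k k n V (\<lambda>x. Der V f x v)"
      using that unfolding C_k_Suc[OF V(1)] by blast
    then have "C_k k n V (\<lambda>x. Der U f x v)"
      by (rule C_k_cong) (simp add: Der_restrict[OF assms(1) V(1,3)])
    with V show "\<exists>V. eopen n V \<and> r \<in> V \<and> V \<subseteq> U \<and> C_k k n V (\<lambda>x. Der U f x v)" by blast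
  qed
  ultimately show ?case
    unfolding C_k_Suc[OF assms(1)] by simp
qed

section \<open>Sums, products and composites of C^k maps\<close>

lemma C_k_add: "C_k k n U f \<Longrightarrow> C_k k n U g \<Longrightarrow> C_k k n U (\<lambda>x. f x + g x)"
proof (induction k arbitrary: f g)
  case 0
  then show ?case by (simp add: continuous_on_add)
next
  case (Suc k)
  obtain f' g' where "\<forall>x\<in>U. (f has_derivative f' x) (at x within U)"
      "\<forall>v\<in>euclid n. C_k k n U (\<lambda>x. f' x v)" "\<forall>x\<in>U. (g has_derivative g' x) (at x within U)"
      "\<forall>v\<in>euclid n. C_k k n U (\<lambda>x. g' x v)"
    using Suc.prems by auto
  then show ?case
    using Suc.IH unfolding C_k.simps
    by (intro exI[of _ "\<lambda>x v. f' x v + g' x v"]) (auto intro: has_derivative_add)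
qed

lemma C_k_sum: "(\<And>i. i \<in> I \<Longrightarrow> C_k k n U (f i)) \<Longrightarrow> C_k k n U (\<lambda>x. \<Sum>i\<in>I. f i x)"
  by (induction I rule: infinite_finite_induct) (simp_all add: C_k_const C_k_add del: C_k.simps)

lemma C_k_bounded_linear:
  assumes "bounded_linear L"
  shows "C_k k n U f \<Longrightarrow> C_k k n U (\<lambda>x. L (f x))"
proof (induction k arbitrary: f)
  case 0
  then show ?case using bounded_linear.continuous_on[OF assms] by simp
next
  case (Suc k)
  obtain f' where f': "\<And>x. x \<in> U \<Longrightarrow> (f has_derivative f' x) (at x within U)"
      "\<And>v. v \<in> euclid n \<Longrightarrow> C_k k n U (\<lambda>x. f' x v)"
    using Suc.prems(1) by auto
  have "((\<lambda>x. L (f x)) has_derivative (\<lambda>v. L (f' x v))) (at x within U)" if "x \<in> U" for x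
    by (rule bounded_linear.has_derivative[OF assms f'(1)[OF that]])
  then show ?case
    using Suc.IH f'(2) unfolding C_k.simps by (intro exI[of _ "\<lambda>x v. L (f' x v)"]) blast
qed

lemma C_k_scaleR:
  fixes a :: "rvec \<Rightarrow> real"
  shows "C_k k n U a \<Longrightarrow> C_k k n U g \<Longrightarrow> C_k k n U (\<lambda>x. a x *\<^sub>R g x)"
proof (induction k arbitrary: a g)
  case 0
  then show ?case by (simp add: continuous_on_scaleR)
next
  case (Suc k)
  obtain a' g' where *: "\<forall>x\<in>U. (a has_derivative a' x) (at x within U)"
      "\<forall>v\<in>euclid n. C_k k n U (\<lambda>x. a' x v)" "\<forall>x\<in>U. (g has_derivative g' x) (at x within U)"
      "\<forall>v\<in>euclid n. C_k k n U (\<lambda>x. g' x v)"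
    using Suc.prems by auto
  have "C_k k n U a" "C_k k n U g"
    using Suc.prems by (auto intro: C_k_SucD simp del: C_k.simps)
  then show ?case
    using Suc.IH * unfolding C_k.simps
    by (intro exI[of _ "\<lambda>x v. a x *\<^sub>R g' x v + a' x v *\<^sub>R g x"])
      (auto intro!: has_derivative_scaleR C_k_add)
qed

text \<open>The coordinates of \<open>f\<close> from index m on are constantly 0, so by uniqueness
  their derivatives vanish on R^n.\<close>

lemma Der_euclid:
  assumes "eopen n U" "r \<in> U" "v \<in> euclid n" "f ` U \<subseteq> euclid m"
    and "(f has_derivative f') (at r within U)"
  shows "f' v \<in> euclid m"
  unfolding euclid_iff
proof (intro allI impI)
  fix i assume i: "m \<le> i"
  have "((\<lambda>x. Poly_Mapping.lookup (f x) i) has_derivative (\<lambda>v. Poly_Mapping.lookup (f' v) i))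
      (at r within U)"
    by (rule bounded_linear.has_derivative[OF bounded_linear_lookup assms(5)])
  then have "((\<lambda>x. 0) has_derivative (\<lambda>v. Poly_Mapping.lookup (f' v) i)) (at r within U)"
    by (rule has_derivative_transform[rotated 2]) (use assms(2,4) i in \<open>auto simp: euclid_iff\<close>)
  from derivative_unique_euclid[OF assms(1-3) this has_derivative_const]
  show "Poly_Mapping.lookup (f' v) i = 0" .
qed

lemma has_derivative_linear: "(f has_derivative f') F \<Longrightarrow> linear f'"
  using has_derivative_bounded_linear bounded_linear.linear by blast

lemma C_k_compose:
  assumes "eopen n U" "eopen m W" "f ` U \<subseteq> W"
  shows "C_k k n U f \<Longrightarrow> C_k k m W g \<Longrightarrow> C_k k n U (\<lambda>x. g (f x))"
proof (induction k arbitrary: g)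
  case 0
  then show ?case using assms(3) by (auto intro: continuous_on_compose2)
next
  case (Suc k)
  have fm: "f ` U \<subseteq> euclid m" using assms(2,3) eopen_subset by blast
  note f = Suc.prems(1)[unfolded C_k_Suc[OF assms(1)]]
  note g = Suc.prems(2)[unfolded C_k_Suc[OF assms(2)]]
  have "((\<lambda>x. g (f x)) has_derivative (\<lambda>v. Der W g (f x) (Der U f x v))) (at x within U)"
    if "x \<in> U" for x
    using f g that assms(3) has_derivative_in_compose2[of W g "\<lambda>y. Der W g y" f U x] by blast
  moreover have "C_k k n U (\<lambda>x. Der W g (f x) (Der U f x v))" if v: "v \<in> euclid n" for v
  proof -
    \<comment> \<open>The chain rule applies one varying linear map to a varying vector. In
      coordinates this is a finite sum of scalars times vectors, and the induction hypothesis covers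
      each factor.\<close>
    have "C_k k n U (\<lambda>x. \<Sum>i<m. Poly_Mapping.lookup (Der U f x v) i *\<^sub>R Der W g (f x) (unit_vec i))"
    proof (intro C_k_sum C_k_scaleR)
      fix i assume "i \<in> {..<m}"
      show "C_k k n U (\<lambda>x. Poly_Mapping.lookup (Der U f x v) i)"
        by (intro C_k_bounded_linear[OF bounded_linear_lookup]) (use f v in blast)
      show "C_k k n U (\<lambda>x. Der W g (f x) (unit_vec i))"
        using \<open>i \<in> {..<m}\<close> g C_k_SucD[OF Suc.prems(1)] by (intro Suc.IH) auto
    qed
    then show ?thesis
    proof (rule C_k_cong)
      fix x assume x: "x \<in> U"
      have "Der U f x v \<in> euclid m"
        using Der_euclid[OF assms(1) x v fm] f x by blast
      moreover have "linear (Der W g (f x))"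
        using g x assms(3) has_derivative_linear by blast
      ultimately show "(\<Sum>i<m. Poly_Mapping.lookup (Der U f x v) i *\<^sub>R Der W g (f x) (unit_vec i))
          = Der W g (f x) (Der U f x v)"
        by (simp add: linear_euclid_expand[symmetric])
    qed
  qed
  ultimately show ?case
    unfolding C_k.simps by (intro exI[of _ "\<lambda>x v. Der W g (f x) (Der U f x v)"]) blast
qed

section \<open>C^infinity maps and their differentials\<close>

lemma C_infI: "(\<And>k. C_k k n U f) \<Longrightarrow> C_inf n U f"
  by (simp add: C_inf_def)

lemma C_infD: "C_inf n U f \<Longrightarrow> C_k k n U f"
  by (simp add: C_inf_def)

lemma C_inf_cong: "C_inf n U f \<Longrightarrow> (\<And>x. x \<in> U \<Longrightarrow> f x = g x) \<Longrightarrow> C_inf n U g"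
  unfolding C_inf_def using C_k_cong by blast

lemma C_inf_restrict: "C_inf n U f \<Longrightarrow> V \<subseteq> U \<Longrightarrow> C_inf n V f"
  unfolding C_inf_def using C_k_restrict by blast

lemma C_inf_local:
  assumes "eopen n U" "\<And>r. r \<in> U \<Longrightarrow> \<exists>V. eopen n V \<and> r \<in> V \<and> V \<subseteq> U \<and> C_inf n V f"
  shows "C_inf n U f"
  by (rule C_infI, rule C_k_local[OF assms(1)]) (meson C_infD assms(2))

lemma C_inf_id: "C_inf n U (\<lambda>x. x)"
  by (simp add: C_inf_def C_k_id)

lemma C_inf_sum: "(\<And>i. i \<in> I \<Longrightarrow> C_inf n U (f i)) \<Longrightarrow> C_inf n U (\<lambda>x. \<Sum>i\<in>I. f i x)"
  unfolding C_inf_def by (auto intro: C_k_sum)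

lemma C_inf_bounded_linear: "bounded_linear L \<Longrightarrow> C_inf n U f \<Longrightarrow> C_inf n U (\<lambda>x. L (f x))"
  unfolding C_inf_def by (auto intro: C_k_bounded_linear)

lemma C_inf_scaleR:
  fixes a :: "rvec \<Rightarrow> real"
  shows "C_inf n U a \<Longrightarrow> C_inf n U g \<Longrightarrow> C_inf n U (\<lambda>x. a x *\<^sub>R g x)"
  unfolding C_inf_def by (auto intro: C_k_scaleR)

lemma C_inf_compose:
  assumes "eopen n U" "eopen m W" "C_inf n U f" "f ` U \<subseteq> W" "C_inf m W g"
  shows "C_inf n U (\<lambda>x. g (f x))"
  by (rule C_infI, rule C_k_compose[OF assms(1,2,4) C_infD[OF assms(3)] C_infD[OF assms(5)]])

lemma C_inf_continuous_on: "C_inf n U f \<Longrightarrow> continuous_on U f"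
  using C_infD C_k_continuous_on by blast

lemma C_inf_has_derivative:
  assumes "C_inf n U f" "r \<in> U"
  shows "(f has_derivative Der U f r) (at r within U)"
proof -
  obtain f' where "(f has_derivative f') (at r within U)"
    using C_infD[OF assms(1), of "Suc 0"] assms(2) by auto
  then show ?thesis by (rule has_derivative_Der)
qed

lemma C_inf_Der:
  assumes "eopen n U" "C_inf n U f" "v \<in> euclid n"
  shows "C_inf n U (\<lambda>x. Der U f x v)"
  using C_infD[OF assms(2), of "Suc _"] assms(3) unfolding C_k_Suc[OF assms(1)]
  by (intro C_infI) blast

lemma C_inf_Der_euclid:
  assumes "eopen n U" "C_inf n U f" "f ` U \<subseteq> euclid m" "r \<in> U" "v \<in> euclid n"
  shows "Der U f r v \<in> euclid m"
  by (rule Der_euclid[OF assms(1,4,5,3) C_inf_has_derivative[OF assms(2,4)]])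

lemma linear_Der: "C_inf n U f \<Longrightarrow> r \<in> U \<Longrightarrow> linear (Der U f r)"
  using C_inf_has_derivative has_derivative_linear by blast

lemma Der_id: "eopen n U \<Longrightarrow> r \<in> U \<Longrightarrow> v \<in> euclid n \<Longrightarrow> Der U (\<lambda>x. x) r v = v"
  by (rule Der_eq[OF _ _ _ has_derivative_ident])

section \<open>Linear endomorphisms of \<open>R^n\<close>\<close>

lemma independent_unit_vec: "independent (unit_vec ` {..<n})"
proof (induction n)
  case (Suc n)
  have "span (unit_vec ` {..<n}) \<subseteq> euclid n"
    by (rule span_minimal[OF _ subspace_euclid]) auto
  moreover have "unit_vec n \<notin> euclid n"
    by (auto simp: euclid_iff)
  ultimately have "unit_vec n \<notin> span (unit_vec ` {..<n})" by blast
  then have "independent (insert (unit_vec n) (unit_vec ` {..<n}))"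
    using Suc unfolding independent_insert by simp
  then show ?case
    unfolding lessThan_Suc image_insert .
qed (simp add: independent_empty)

lemma span_unit_vec: "span (unit_vec ` {..<n}) = euclid n"
proof
  show "span (unit_vec ` {..<n}) \<subseteq> euclid n"
    by (rule span_minimal[OF _ subspace_euclid]) auto
  show "euclid n \<subseteq> span (unit_vec ` {..<n})"
  proof
    fix x assume "x \<in> euclid n"
    then have "x = trunc n x" by (simp add: trunc_id)
    also have "\<dots> \<in> span (unit_vec ` {..<n})"
      unfolding trunc_def by (intro span_sum span_scale span_base) auto
    finally show "x \<in> span (unit_vec ` {..<n})" .
  qed
qed

lemma card_unit_vec: "card (unit_vec ` {..<n}) = n"
proof -
  have "inj_on unit_vec {..<n}"
    by (rule inj_onI) (metis lookup_single_eq lookup_single_not_eq zero_neq_one)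
  then show ?thesis by (simp add: card_image)
qed

text \<open>A dimension count: the images of the n unit vectors are independent, and a vector
  outside their span would give n + 1 independent vectors in the span of n.\<close>

lemma inj_imp_surj_euclid:
  assumes L: "linear L" "L ` euclid n \<subseteq> euclid n"
    and inj: "\<And>v. v \<in> euclid n \<Longrightarrow> L v = 0 \<Longrightarrow> v = 0"
  shows "L ` euclid n = euclid n"
proof
  let ?B = "L ` unit_vec ` {..<n}"
  have "inj_on L (euclid n)"
  proof (rule inj_onI)
    fix x y assume xy: "x \<in> euclid n" "y \<in> euclid n" "L x = L y"
    then have "L (x - y) = 0" by (simp add: linear_diff[OF L(1)])
    then show "x = y" using inj[of "x - y"] xy by (simp add: euclid_diff)
  qed
  then have "inj_on L (span (unit_vec ` {..<n}))" by (simp add: span_unit_vec)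
  then have ind: "independent ?B"
    by (rule linear_independent_injective_image[OF L(1) independent_unit_vec])
  have card: "card ?B = n"
    using \<open>inj_on L (euclid n)\<close> card_unit_vec
    by (metis card_image inj_on_subset span_superset span_unit_vec)
  have "euclid n \<subseteq> span ?B"
  proof
    fix x assume x: "x \<in> euclid n"
    show "x \<in> span ?B"
    proof (rule ccontr)
      assume "x \<notin> span ?B"
      then have "x \<notin> ?B" using span_base[of x ?B] by blast
      then have "independent (insert x ?B)"
        unfolding independent_insert using ind \<open>x \<notin> span ?B\<close> by simp
      moreover have "insert x ?B \<subseteq> span (unit_vec ` {..<n})"
        using x L(2) by (auto simp: span_unit_vec)
      ultimately have "card (insert x ?B) \<le> card (unit_vec ` {..<n})"
        using independent_span_bound[of "unit_vec ` {..<n}" "insert x ?B"] by blast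
      then show False
        using \<open>x \<notin> ?B\<close> card by (simp add: card_unit_vec)
    qed
  qed
  also have "span ?B = L ` euclid n"
    by (simp add: linear_span_image[OF L(1)] span_unit_vec)
  finally show "euclid n \<subseteq> L ` euclid n" .
qed (fact L(2))

text \<open>Choosing preimages of the unit vectors gives a right inverse \<open>A\<close>, bounded
  everywhere because it is defined by coordinates. As \<open>A\<close> is injective on R^n it is
  onto, which makes it a left inverse too.\<close>

lemma surj_inverse_euclid:
  assumes L: "linear L" "L ` euclid n = euclid n"
  obtains A where "bounded_linear A" "A ` euclid n \<subseteq> euclid n"
    "\<And>v. v \<in> euclid n \<Longrightarrow> L (A v) = v" "\<And>v. v \<in> euclid n \<Longrightarrow> A (L v) = v"
proof -
  have "\<forall>i\<in>{..<n}. \<exists>b\<in>euclid n. L b = unit_vec i"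
    using L(2) unit_vec_euclid by (metis imageE lessThan_iff)
  then obtain b where b: "\<And>i. i < n \<Longrightarrow> b i \<in> euclid n" "\<And>i. i < n \<Longrightarrow> L (b i) = unit_vec i"
    by (metis lessThan_iff)
  define A where "A v = (\<Sum>i<n. Poly_Mapping.lookup v i *\<^sub>R b i)" for v
  have A: "bounded_linear A"
    unfolding A_def[abs_def]
    by (intro bounded_linear_sum bounded_linear_compose[OF bounded_linear_scaleR_left]
        bounded_linear_lookup)
  have An: "A ` euclid n \<subseteq> euclid n"
    unfolding A_def by (auto intro!: euclid_sum euclid_scaleR b)
  have LA: "L (A v) = v" if "v \<in> euclid n" for v
  proof -
    have "L (A v) = trunc n v"
      unfolding A_def trunc_def using b(2) by (simp add: linear_sum[OF L(1)] linear_scale[OF L(1)])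
    then show ?thesis using that by (simp add: trunc_id)
  qed
  have "A ` euclid n = euclid n"
  proof (rule inj_imp_surj_euclid[OF bounded_linear.linear[OF A] An])
    fix v assume "v \<in> euclid n" "A v = 0"
    then show "v = 0" using LA[of v] linear_0[OF L(1)] by simp
  qed
  then have "A (L v) = v" if "v \<in> euclid n" for v
    using that LA by (metis imageE)
  then show thesis using that A An LA by blast
qed

section \<open>Smoothness of the inverse of a family of linear isomorphisms\<close>

text \<open>Where the scalar factor vanishes, the product rule needs only continuity of the vector
  factor. This breaks the circle in differentiating a family of inverses, for which only continuity
  is known at that stage.\<close>

lemma has_derivative_scaleR_vanishing:
  fixes a :: "'a::real_normed_vector \<Rightarrow> real" and g :: "'a \<Rightarrow> 'b::real_normed_vector"
  assumes a: "(a has_derivative a') (at y within V)" "a y = 0"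
    and g: "(g \<longlongrightarrow> g y) (at y within V)"
  shows "((\<lambda>z. a z *\<^sub>R g z) has_derivative (\<lambda>h. a' h *\<^sub>R g y)) (at y within V)"
  unfolding has_derivative_at_within
proof
  interpret a': bounded_linear a' using has_derivative_bounded_linear[OF a(1)] .
  show "bounded_linear (\<lambda>h. a' h *\<^sub>R g y)"
    by (rule bounded_linear_compose[OF bounded_linear_scaleR_left a'.bounded_linear_axioms])
  obtain K where K: "\<And>h. \<bar>a' h\<bar> \<le> norm h * K"
    using a'.bounded by auto
  have 1: "((\<lambda>z. ((a z - a y - a' (z - y)) /\<^sub>R norm (z - y)) *\<^sub>R g z) \<longlongrightarrow> 0 *\<^sub>R g y) (at y within V)"
    using a(1) unfolding has_derivative_at_within by (intro tendsto_scaleR g) blast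
  have 2: "((\<lambda>z. (a' (z - y) / norm (z - y)) *\<^sub>R (g z - g y)) \<longlongrightarrow> 0) (at y within V)"
  proof (rule Lim_null_comparison)
    show "((\<lambda>z. K * norm (g z - g y)) \<longlongrightarrow> 0) (at y within V)"
      using g by (auto intro!: tendsto_mult_right_zero simp: tendsto_norm_zero_iff LIM_zero_iff)
    have "\<bar>a' (z - y)\<bar> / norm (z - y) \<le> K" if "z \<noteq> y" for z
      using K[of "z - y"] that by (simp add: divide_le_eq mult.commute)
    then show "\<forall>\<^sub>F z in at y within V.
        norm ((a' (z - y) / norm (z - y)) *\<^sub>R (g z - g y)) \<le> K * norm (g z - g y)"
      unfolding eventually_at_filter norm_scaleR real_norm_def abs_divide abs_norm_cancel
      by (intro always_eventually allI impI mult_right_mono norm_ge_zero)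
  qed
  have "(a z *\<^sub>R g z - a y *\<^sub>R g y - a' (z - y) *\<^sub>R g y) /\<^sub>R norm (z - y) =
      ((a z - a y - a' (z - y)) /\<^sub>R norm (z - y)) *\<^sub>R g z +
      (a' (z - y) / norm (z - y)) *\<^sub>R (g z - g y)" for z
    by (simp add: a(2) algebra_simps divide_inverse_commute)
  then show "((\<lambda>z. (a z *\<^sub>R g z - a y *\<^sub>R g y - a' (z - y) *\<^sub>R g y) /\<^sub>R norm (z - y))
      \<longlongrightarrow> 0) (at y within V)"
    using tendsto_add[OF 1 2] by simp
qed

lemma eventually_mem_at_within: "\<forall>\<^sub>F z in at y within V. z \<in> V"
  by (simp add: eventually_at_filter)

text \<open>The regularity of the inverses \<open>N\<close> is to be deduced from that of
  \<open>M\<close>. The application takes for \<open>M\<close> the differentials of a map at the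
  values of its local inverse.\<close>

locale linear_iso_family =
  fixes n m :: nat and V :: "rvec set" and M N :: "rvec \<Rightarrow> rvec \<Rightarrow> rvec"
  assumes V: "eopen n V"
    and linear_M: "\<And>y. y \<in> V \<Longrightarrow> linear (M y)"
    and linear_N: "\<And>y. y \<in> V \<Longrightarrow> linear (N y)"
    and M_euclid: "\<And>y v. y \<in> V \<Longrightarrow> v \<in> euclid m \<Longrightarrow> M y v \<in> euclid m"
    and N_euclid: "\<And>y v. y \<in> V \<Longrightarrow> v \<in> euclid m \<Longrightarrow> N y v \<in> euclid m"
    and MN: "\<And>y v. y \<in> V \<Longrightarrow> v \<in> euclid m \<Longrightarrow> M y (N y v) = v"
    and NM: "\<And>y v. y \<in> V \<Longrightarrow> v \<in> euclid m \<Longrightarrow> N y (M y v) = v"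
begin

lemma inverse_locally_bounded:
  assumes cont: "\<And>v. v \<in> euclid m \<Longrightarrow> continuous_on V (\<lambda>y. M y v)" and y: "y \<in> V"
  obtains K where "\<forall>\<^sub>F z in at y within V. \<forall>w\<in>euclid m. norm (N z w) \<le> K * norm w"
proof -
  \<comment> \<open>A bound for \<open>N y\<close> on R^m; adding 1 keeps it positive even for m =
    0.\<close>
  define K where "K = (\<Sum>i<m. norm (N y (unit_vec i))) + 1"
  have K: "K > 0"
    unfolding K_def by (intro add_nonneg_pos sum_nonneg) auto
  have NK: "norm (N y w) \<le> K * norm w" if "w \<in> euclid m" for w
  proof (rule norm_linear_euclid_le[OF linear_N[OF y] that])
    fix i assume "i < m"
    then have "norm (N y (unit_vec i)) \<le> (\<Sum>i<m. norm (N y (unit_vec i)))"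
      by (intro member_le_sum) auto
    then show "norm (N y (unit_vec i)) \<le> K" by (simp add: K_def)
  qed
  \<comment> \<open>This closeness yields \<open>norm x \<le> K * norm w + norm x / 2\<close> for
    \<open>x = N z w\<close>, and the last term can be absorbed on the left.\<close>
  have ev: "\<forall>\<^sub>F z in at y within V. \<forall>i\<in>{..<m}. norm (M z (unit_vec i) - M y (unit_vec i)) < 1 / (2 * K)"
  proof (rule eventually_ball_finite)
    show "\<forall>i\<in>{..<m}. \<forall>\<^sub>F z in at y within V. norm (M z (unit_vec i) - M y (unit_vec i)) < 1 / (2 * K)"
    proof
      fix i assume "i \<in> {..<m}"
      then have "((\<lambda>z. M z (unit_vec i)) \<longlongrightarrow> M y (unit_vec i)) (at y within V)"
        using cont[of "unit_vec i"] y by (simp add: continuous_on)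
      then show "\<forall>\<^sub>F z in at y within V. norm (M z (unit_vec i) - M y (unit_vec i)) < 1 / (2 * K)"
        using K by (auto simp: tendsto_iff dist_norm)
    qed
  qed simp
  have "\<forall>\<^sub>F z in at y within V. \<forall>w\<in>euclid m. norm (N z w) \<le> 2 * K * norm w"
    using ev eventually_mem_at_within[of V y]
  proof eventually_elim
    case (elim z)
    show ?case
    proof
      fix w assume w: "w \<in> euclid m"
      define x where "x = N z w"
      have x: "x \<in> euclid m" "M z x = w"
        using N_euclid MN elim(2) w by (auto simp: x_def)
      have "linear (\<lambda>v. M z v - M y v)"
        using linear_M elim(2) y by (intro linear_compose_sub) auto
      then have d: "norm (M z x - M y x) \<le> 1 / (2 * K) * norm x"
        using x(1) elim(1) by (intro norm_linear_euclid_le) (auto intro: less_imp_le)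
      have "norm x = norm (N y (M y x))"
        using NM[OF y x(1)] by simp
      also have "\<dots> \<le> K * norm (M y x)"
        by (rule NK[OF M_euclid[OF y x(1)]])
      also have "\<dots> \<le> K * (norm (M z x) + norm (M z x - M y x))"
        using K by (intro mult_left_mono)
          (auto, metis add.commute norm_minus_commute norm_triangle_sub)
      also have "\<dots> \<le> K * (norm w + 1 / (2 * K) * norm x)"
        using K d x(2) by (intro mult_left_mono add_mono) auto
      also have "\<dots> = K * norm w + norm x / 2"
        using K by (simp add: field_simps)
      finally show "norm (N z w) \<le> 2 * K * norm w"
        by (simp add: x_def)
    qed
  qed
  then show thesis by (rule that)
qed

text \<open>With \<open>u = N y v\<close> one has \<open>N z v - u = N z (M y u - M z u)\<close>,
  and the local bound on \<open>N z\<close> reduces the claim to continuity of \<open>M\<close> at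
  the fixed vector \<open>u\<close>.\<close>

lemma inverse_tendsto:
  assumes cont: "\<And>v. v \<in> euclid m \<Longrightarrow> continuous_on V (\<lambda>y. M y v)"
    and y: "y \<in> V" and v: "v \<in> euclid m"
  shows "((\<lambda>z. N z v) \<longlongrightarrow> N y v) (at y within V)"
proof -
  obtain K where K: "\<forall>\<^sub>F z in at y within V. \<forall>w\<in>euclid m. norm (N z w) \<le> K * norm w"
    using inverse_locally_bounded[OF cont y] by blast
  let ?u = "N y v"
  have u: "?u \<in> euclid m" using N_euclid y v .
  have "((\<lambda>z. N z v - ?u) \<longlongrightarrow> 0) (at y within V)"
  proof (rule Lim_null_comparison)
    have "((\<lambda>z. M z ?u) \<longlongrightarrow> M y ?u) (at y within V)"
      using cont[OF u] y by (simp add: continuous_on)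
    then show "((\<lambda>z. K * norm (M z ?u - M y ?u)) \<longlongrightarrow> 0) (at y within V)"
      by (auto intro!: tendsto_mult_right_zero simp: tendsto_norm_zero_iff LIM_zero_iff)
    show "\<forall>\<^sub>F z in at y within V. norm (N z v - ?u) \<le> K * norm (M z ?u - M y ?u)"
      using K eventually_mem_at_within[of V y]
    proof eventually_elim
      case (elim z)
      have "N z v - ?u = N z (M y ?u - M z ?u)"
        using MN[OF y v] NM[OF elim(2) u] by (simp add: linear_diff[OF linear_N[OF elim(2)]])
      moreover have "M y ?u - M z ?u \<in> euclid m"
        using u y elim(2) by (intro euclid_diff M_euclid)
      ultimately show ?case
        using elim(1) by (metis norm_minus_commute)
    qed
  qed
  then show ?thesis by (simp add: LIM_zero_iff)
qed

text \<open>
  From \<open>N z v - N y v = - N z (M z u - M y u)\<close> with \<open>u = N y v\<close> one reads off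
  \<open>D (N v) = - N (D M) (N v)\<close>, here written in coordinates.
\<close>

lemma has_derivative_inverse_family:
  assumes cont: "\<And>v. v \<in> euclid m \<Longrightarrow> continuous_on V (\<lambda>y. M y v)"
    and D: "\<And>j. j < m \<Longrightarrow> ((\<lambda>z. M z (unit_vec j)) has_derivative D j) (at y within V)"
    and y: "y \<in> V" and v: "v \<in> euclid m"
  shows "((\<lambda>z. N z v) has_derivative
    (\<lambda>h. - (\<Sum>i<m. (\<Sum>j<m. Poly_Mapping.lookup (N y v) j * Poly_Mapping.lookup (D j h) i)
             *\<^sub>R N y (unit_vec i)))) (at y within V)"
proof -
  let ?u = "N y v"
  have u: "?u \<in> euclid m" using N_euclid y v .
  \<comment> \<open>The i-th coordinate of \<open>M z u - M y u\<close>, expanded over the unit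
    vectors, on which derivatives of \<open>M\<close> are given. It vanishes at
    \<open>z = y\<close>, as the special product rule requires.\<close>
  define a where "a i z = (\<Sum>j<m. Poly_Mapping.lookup ?u j *
      (Poly_Mapping.lookup (M z (unit_vec j)) i - Poly_Mapping.lookup (M y (unit_vec j)) i))" for i z
  have a: "(a i has_derivative
      (\<lambda>h. \<Sum>j<m. Poly_Mapping.lookup ?u j * Poly_Mapping.lookup (D j h) i)) (at y within V)" for i
  proof -
    have "(a i has_derivative (\<lambda>h. \<Sum>j<m. Poly_Mapping.lookup ?u j *
        (Poly_Mapping.lookup (D j h) i - 0))) (at y within V)"
      unfolding a_def[abs_def]
      by (intro has_derivative_sum has_derivative_mult_right has_derivative_diff
          has_derivative_const bounded_linear.has_derivative[OF bounded_linear_lookup] D) simp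
    then show ?thesis by simp
  qed
  have "((\<lambda>z. ?u - (\<Sum>i<m. a i z *\<^sub>R N z (unit_vec i))) has_derivative
      (\<lambda>h. 0 - (\<Sum>i<m. (\<Sum>j<m. Poly_Mapping.lookup ?u j * Poly_Mapping.lookup (D j h) i)
             *\<^sub>R N y (unit_vec i)))) (at y within V)"
    by (intro has_derivative_diff has_derivative_const has_derivative_sum
        has_derivative_scaleR_vanishing a inverse_tendsto[OF cont y]) (auto simp: a_def)
  then have "((\<lambda>z. N z v) has_derivative
      (\<lambda>h. 0 - (\<Sum>i<m. (\<Sum>j<m. Poly_Mapping.lookup ?u j * Poly_Mapping.lookup (D j h) i)
             *\<^sub>R N y (unit_vec i)))) (at y within V)"
  proof (rule has_derivative_transform[OF y, rotated])
    fix z assume z: "z \<in> V"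
    let ?w = "M z ?u - M y ?u"
    have w: "?w \<in> euclid m"
      using u y z by (intro euclid_diff M_euclid)
    have "Poly_Mapping.lookup ?w i = a i z" for i
      unfolding a_def linear_euclid_expand[OF linear_M[OF y] u] linear_euclid_expand[OF linear_M[OF z] u]
      by (simp add: lookup_minus lookup_sum lookup_scaleR right_diff_distrib sum_subtractf)
    then have "(\<Sum>i<m. a i z *\<^sub>R N z (unit_vec i)) = N z ?w"
      unfolding linear_euclid_expand[OF linear_N[OF z] w] by simp
    also have "\<dots> = ?u - N z v"
      using MN[OF y v] NM[OF z u] by (simp add: linear_diff[OF linear_N[OF z]])
    finally show "N z v = ?u - (\<Sum>i<m. a i z *\<^sub>R N z (unit_vec i))" by simp
  qed
  then show ?thesis by simp
qed

lemma C_k_inverse: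
  "(\<And>v. v \<in> euclid m \<Longrightarrow> C_k k n V (\<lambda>y. M y v)) \<Longrightarrow> v \<in> euclid m \<Longrightarrow> C_k k n V (\<lambda>y. N y v)"
proof (induction k arbitrary: v)
  case 0
  then show ?case
    by (auto simp: continuous_on intro: inverse_tendsto)
next
  case (Suc k)
  have M: "C_k k n V (\<lambda>y. M y v)" if "v \<in> euclid m" for v
    by (rule C_k_SucD[OF Suc.prems(1)[OF that]])
  have N: "C_k k n V (\<lambda>y. N y v)" if "v \<in> euclid m" for v
    by (rule Suc.IH[OF M that])
  let ?D = "\<lambda>j y h. Der V (\<lambda>z. M z (unit_vec j)) y h"
  have D: "((\<lambda>z. M z (unit_vec j)) has_derivative ?D j y) (at y within V)"
      "h \<in> euclid n \<Longrightarrow> C_k k n V (\<lambda>y. ?D j y h)" if "j < m" "y \<in> V" for j y h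
    using Suc.prems(1)[of "unit_vec j"] that unfolding C_k_Suc[OF V] by auto
  let ?N' = "\<lambda>y h. - (\<Sum>i<m. (\<Sum>j<m. Poly_Mapping.lookup (N y v) j * Poly_Mapping.lookup (?D j y h) i)
             *\<^sub>R N y (unit_vec i))"
  have "((\<lambda>z. N z v) has_derivative ?N' y) (at y within V)" if y: "y \<in> V" for y
    by (rule has_derivative_inverse_family[OF C_k_continuous_on[OF M] D(1) y Suc.prems(2)]) (use y in auto)
  moreover have "C_k k n V (\<lambda>y. ?N' y h)" if h: "h \<in> euclid n" for h
  \<comment> \<open>The regularity of the derivatives of \<open>M\<close> was extracted at a point
    of \<open>V\<close>, so a point has to be supplied and the empty domain treated
    separately.\<close>
  proof (cases "V = {}")
    case False
    then obtain y0 where y0: "y0 \<in> V" by blast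
    have c: "C_k k n V (\<lambda>y. \<Sum>j<m. Poly_Mapping.lookup (N y v) j * Poly_Mapping.lookup (?D j y h) i)" for i
      unfolding real_scaleR_def[symmetric]
      by (intro C_k_sum C_k_scaleR C_k_bounded_linear[OF bounded_linear_lookup]
          N[OF Suc.prems(2)] D(2)[OF _ y0 h]) simp
    show ?thesis
      by (rule C_k_bounded_linear[OF bounded_linear_minus[OF bounded_linear_ident]],
          rule C_k_sum, rule C_k_scaleR[OF c N[OF unit_vec_euclid]]) simp
  next
    case True
    show ?thesis
      by (rule C_k_cong[OF C_k_const[of k n V 0]]) (simp add: True)
  qed
  ultimately show ?case
    unfolding C_k.simps by (intro exI[of _ ?N']) blast
qed

end

section \<open>The inverse function theorem\<close>

text \<open>The mean value inequality needs an operator norm on the whole space, while estimates are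
  available on R^n only. Precomposing the derivative with \<open>trunc n\<close> reconciles the
  two.\<close>

lemma has_derivative_trunc:
  assumes "(f has_derivative f') (at x within S)" "S \<subseteq> euclid n" "x \<in> S"
  shows "(f has_derivative (\<lambda>v. f' (trunc n v))) (at x within S)"
  unfolding has_derivative_within_alt
proof (intro conjI allI impI)
  show "bounded_linear (\<lambda>v. f' (trunc n v))"
    by (rule bounded_linear_comp_trunc[OF has_derivative_linear[OF assms(1)]])
  fix e :: real assume "e > 0"
  then obtain d where "d > 0"
      "\<And>y. y \<in> S \<Longrightarrow> norm (y - x) < d \<Longrightarrow> norm (f y - f x - f' (y - x)) \<le> e * norm (y - x)"
    using assms(1) unfolding has_derivative_within_alt by blast
  moreover have "trunc n (y - x) = y - x" if "y \<in> S" for y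
    using that assms(2,3) by (intro trunc_id euclid_diff) auto
  ultimately show "\<exists>d>0. \<forall>y\<in>S. norm (y - x) < d \<longrightarrow>
      norm (f y - f x - f' (trunc n (y - x))) \<le> e * norm (y - x)"
    by (intro exI[of _ d]) auto
qed

text \<open>
  As usual, the local inverse is found from the contraction \<open>x \<mapsto> x + A (y - f x)\<close>, where
  \<open>A\<close> is the inverse of the differential at \<open>r\<close>.
\<close>

theorem inverse_function_C_inf:
  assumes U: "eopen n U" and f: "C_inf n U f" and fn: "f ` U \<subseteq> euclid n" and r: "r \<in> U"
    and surj: "Der U f r ` euclid n = euclid n"
  obtains U' V g where "eopen n U'" "r \<in> U'" "U' \<subseteq> U" "eopen n V" "f ` U' = V"
    "\<And>x. x \<in> U' \<Longrightarrow> g (f x) = x" "C_inf n V g"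
proof -
  let ?D = "Der U f"
  have Dn: "?D x ` euclid n \<subseteq> euclid n" if "x \<in> U" for x
    using C_inf_Der_euclid[OF U f fn that] by blast
  obtain A where A: "bounded_linear A" "A ` euclid n \<subseteq> euclid n"
      "\<And>v. v \<in> euclid n \<Longrightarrow> ?D r (A v) = v" "\<And>v. v \<in> euclid n \<Longrightarrow> A (?D r v) = v"
    by (rule surj_inverse_euclid[OF linear_Der[OF f r] surj]) (rule that)
  interpret A: bounded_linear A by fact
  obtain K where K: "K > 0" "\<And>v. norm (A v) \<le> K * norm v"
    using A.pos_bounded by (metis mult.commute)
  have A0: "v = 0" if "v \<in> euclid n" "A v = 0" for v
    using A(3)[OF that(1)] that(2) linear_0[OF linear_Der[OF f r]] by simp
  let ?h = "\<lambda>x. \<Sum>i<n. norm (unit_vec i - A (?D x (unit_vec i)))"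
  \<comment> \<open>Here \<open>A\<close> composed with the differential differs from the identity
    by at most 1/2 in operator norm. Summing over the columns gives an upper bound for that norm
    that is visibly continuous.\<close>
  define U1 where "U1 = {x \<in> U. ?h x \<in> {..<1/2}}"
  have "continuous_on U (\<lambda>x. A (?D x (unit_vec i)))" if "i < n" for i
    by (intro A.continuous_on C_inf_continuous_on[OF C_inf_Der[OF U f]] unit_vec_euclid that)
  then have "eopen n U1"
    unfolding U1_def by (intro eopen_preimage_open[OF U] continuous_intros) auto
  moreover have "r \<in> U1"
    using r A(4) by (simp add: U1_def)
  ultimately obtain e where e: "e > 0" "euclid n \<inter> ball r e \<subseteq> U1"
    by (rule eopen_ball)
  have half: "norm (v - A (?D x v)) \<le> 1/2 * norm v" if x: "x \<in> U1" and v: "v \<in> euclid n" for x v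
  proof (rule norm_linear_euclid_le[OF _ v])
    show "linear (\<lambda>v. v - A (?D x v))"
      using linear_compose[OF linear_Der[OF f] A.linear_axioms, of x] x
      by (intro linear_compose_sub linear_id[unfolded id_def]) (simp add: o_def U1_def)
    fix i assume "i < n"
    then have "norm (unit_vec i - A (?D x (unit_vec i))) \<le> ?h x"
      by (intro member_le_sum[of i]) auto
    then show "norm (unit_vec i - A (?D x (unit_vec i))) \<le> 1/2"
      using x by (simp add: U1_def)
  qed
  \<comment> \<open>Half the radius, so that a closed ball, which is complete within R^n, still fits
    into the open ball of radius \<open>e\<close>.\<close>
  define \<delta> where "\<delta> = e / 2"
  define S where "S = euclid n \<inter> cball r \<delta>"
  have \<delta>: "\<delta> > 0" using e by (simp add: \<delta>_def)
  have S1: "S \<subseteq> U1" and SU: "S \<subseteq> U"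
    using e unfolding S_def \<delta>_def U1_def by (auto simp: subset_eq)
  have rS: "r \<in> S"
    using r U eopen_subset \<delta> by (auto simp: S_def)
  \<comment> \<open>The part of the map \<open>x + A (y - f x)\<close> that does not depend on
    \<open>y\<close>, so one contraction estimate serves all \<open>y\<close>.\<close>
  define F where "F x = x - A (f x)" for x
  have contr: "norm (F x - F y) \<le> 1/2 * norm (x - y)" if "x \<in> S" "y \<in> S" for x y
  proof (rule differentiable_bound[OF _ _ _ that])
    show "convex S"
      unfolding S_def by (intro convex_Int subspace_imp_convex subspace_euclid convex_cball)
    fix x assume x: "x \<in> S"
    have "(F has_derivative (\<lambda>v. v - A (?D x v))) (at x within S)"
      unfolding F_def[abs_def] using x SU
      by (intro has_derivative_diff has_derivative_ident A.has_derivative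
          has_derivative_subset[OF C_inf_has_derivative[OF f]]) auto
    then show "(F has_derivative (\<lambda>v. trunc n v - A (?D x (trunc n v)))) (at x within S)"
      by (rule has_derivative_trunc) (use x in \<open>auto simp: S_def\<close>)
    show "onorm (\<lambda>v. trunc n v - A (?D x (trunc n v))) \<le> 1/2"
    proof (rule onorm_bound)
      fix v
      have "norm (trunc n v - A (?D x (trunc n v))) \<le> 1/2 * norm (trunc n v)"
        using x S1 by (intro half) auto
      also have "\<dots> \<le> 1/2 * norm v" by (simp add: norm_trunc_le)
      finally show "norm (trunc n v - A (?D x (trunc n v))) \<le> 1/2 * norm v" .
    qed simp
  qed
  \<comment> \<open>The budget for the self-map of \<open>S\<close>: contraction leaves at most
    \<delta>/2, and the displacement \<open>A (y - f r)\<close> adds strictly less than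
    \<delta>/2.\<close>
  define V where "V = euclid n \<inter> {y. norm (A (y - f r)) < \<delta> / 2}"
  define U' where "U' = {x \<in> U \<inter> ball r \<delta>. f x \<in> V}"
  have V: "eopen n V"
    unfolding V_def by (intro eopen_Int_open open_Collect_less continuous_intros A.continuous_on) auto
  have U': "eopen n U'"
    unfolding U'_def using fn V
    by (intro eopen_preimage[where m = n] eopen_Int_open U
        continuous_on_subset[OF C_inf_continuous_on[OF f]]) auto
  have U'S: "U' \<subseteq> S"
    using eopen_subset[OF U] by (auto simp: U'_def S_def)
  have rU': "r \<in> U'"
    using r fn \<delta> by (auto simp: U'_def V_def A.zero)
  have "f ` U' = V"
  proof
    show "V \<subseteq> f ` U'"
    proof
      fix y assume "y \<in> V"
      then have y: "y \<in> euclid n" "norm (A (y - f r)) < \<delta> / 2" by (auto simp: V_def)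
      \<comment> \<open>The value lies in the open ball, so the fixed point found in the closed one
        belongs to \<open>U'\<close>.\<close>
      have T: "x + A (y - f x) \<in> euclid n \<inter> ball r \<delta>" if "x \<in> S" for x
      proof -
        have "y - f x \<in> euclid n"
          using that SU fn y(1) by (intro euclid_diff) auto
        then have "x + A (y - f x) \<in> euclid n"
          using that A(2) by (intro euclid_add) (auto simp: S_def)
        moreover have "norm (x + A (y - f x) - r) < \<delta>"
        proof -
          have "x + A (y - f x) - r = (F x - F r) + A (y - f r)"
            by (simp add: F_def A.diff)
          then have "norm (x + A (y - f x) - r) \<le> norm (F x - F r) + norm (A (y - f r))"
            by (simp add: norm_triangle_ineq)
          also have "norm (F x - F r) \<le> 1/2 * norm (x - r)"
            using that rS by (rule contr)
          also have "\<dots> \<le> \<delta> / 2"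
            using that by (simp add: S_def dist_norm norm_minus_commute)
          finally show ?thesis using y(2) by simp
        qed
        ultimately show ?thesis by (simp add: dist_norm norm_minus_commute)
      qed
      have "\<exists>!x\<in>S. x + A (y - f x) = x"
      proof (rule Banach_fix)
        show "complete S"
          unfolding S_def by (rule complete_Int_closed[OF complete_euclid closed_cball])
        show "S \<noteq> {}" using rS by blast
        show "(\<lambda>x. x + A (y - f x)) ` S \<subseteq> S"
          using T by (fastforce simp: S_def)
        fix x x' assume "x \<in> S" "x' \<in> S"
        moreover have "x + A (y - f x) - (x' + A (y - f x')) = F x - F x'"
          by (simp add: F_def A.diff)
        ultimately show "dist (x + A (y - f x)) (x' + A (y - f x')) \<le> 1/2 * dist x x'"
          using contr by (simp only: dist_norm)
      qed auto
      then obtain x where x: "x \<in> S" "A (y - f x) = 0" by auto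
      have "f x \<in> euclid n" using fn SU x(1) by blast
      from A0[OF euclid_diff[OF y(1) this] x(2)] have "y - f x = 0" .
      moreover have "x \<in> ball r \<delta>" using T[OF x(1)] x(2) by simp
      ultimately have "x \<in> U'"
        using x(1) SU \<open>y \<in> V\<close> by (auto simp: U'_def)
      moreover have "y = f x" using \<open>y - f x = 0\<close> by simp
      ultimately show "y \<in> f ` U'" by blast
    qed
  qed (auto simp: U'_def)
  \<comment> \<open>Half of \<open>norm (x - x')\<close> is absorbed on the left, leaving the factor
    \<open>2 * K\<close>. The estimate yields injectivity of \<open>f\<close> and the Lipschitz
    bound for \<open>g\<close>.\<close>
  have lip: "norm (x - x') \<le> 2 * K * norm (f x - f x')" if "x \<in> U'" "x' \<in> U'" for x x'
  proof -
    have "x - x' = (F x - F x') + A (f x - f x')"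
      by (simp add: F_def A.diff)
    then have "norm (x - x') \<le> norm (F x - F x') + norm (A (f x - f x'))"
      by (metis norm_triangle_ineq)
    also have "norm (F x - F x') \<le> 1/2 * norm (x - x')"
      using that U'S by (intro contr) auto
    also have "norm (A (f x - f x')) \<le> K * norm (f x - f x')"
      by (rule K(2))
    finally show ?thesis by simp
  qed
  have "inj_on f U'"
    by (rule inj_onI) (use lip in fastforce)
  define g where "g = inv_into U' f"
  have gf: "g (f x) = x" if "x \<in> U'" for x
    using \<open>inj_on f U'\<close> that by (simp add: g_def)
  have fg: "g y \<in> U'" "f (g y) = y" if "y \<in> V" for y
    using that \<open>f ` U' = V\<close> by (auto simp: g_def inv_into_into f_inv_into_f)
  \<comment> \<open>If the differential kills v, the estimate on \<open>U1\<close> reads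
    \<open>norm v \<le> 1/2 * norm v\<close>. So it is injective at each point of \<open>U'\<close>,
    hence bijective on R^n.\<close>
  have "\<exists>B. bounded_linear B \<and> B ` euclid n \<subseteq> euclid n \<and>
      (\<forall>v\<in>euclid n. ?D x (B v) = v \<and> B (?D x v) = v)" if "x \<in> U'" for x
  proof -
    have x: "x \<in> U" "x \<in> U1" using that U'S SU S1 by auto
    have "v = 0" if "v \<in> euclid n" "?D x v = 0" for v
      using half[OF x(2) that(1)] that(2) by (simp add: A.zero)
    from inj_imp_surj_euclid[OF linear_Der[OF f x(1)] Dn[OF x(1)] this]
    have "?D x ` euclid n = euclid n" .
    from surj_inverse_euclid[OF linear_Der[OF f x(1)] this] show ?thesis by metis
  qed
  then obtain B where "\<forall>x\<in>U'. bounded_linear (B x) \<and> B x ` euclid n \<subseteq> euclid n \<and>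
      (\<forall>v\<in>euclid n. ?D x (B x v) = v \<and> B x (?D x v) = v)"
    using bchoice[of U' "\<lambda>x B. bounded_linear B \<and> B ` euclid n \<subseteq> euclid n \<and>
      (\<forall>v\<in>euclid n. ?D x (B v) = v \<and> B (?D x v) = v)"] by blast
  then have B: "\<And>x. x \<in> U' \<Longrightarrow> bounded_linear (B x)"
      "\<And>x v. x \<in> U' \<Longrightarrow> v \<in> euclid n \<Longrightarrow> B x v \<in> euclid n"
      "\<And>x v. x \<in> U' \<Longrightarrow> v \<in> euclid n \<Longrightarrow> ?D x (B x v) = v"
      "\<And>x v. x \<in> U' \<Longrightarrow> v \<in> euclid n \<Longrightarrow> B x (?D x v) = v"
    by blast+
  have g': "(g has_derivative B (g y)) (at y within V)" if y: "y \<in> V" for y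
    unfolding has_derivative_within_alt
  proof (intro conjI allI impI)
    let ?x = "g y"
    note x = fg(1)[OF y]
    have xU: "?x \<in> U" using x U'S SU by auto
    interpret B: bounded_linear "B ?x" by (rule B(1)[OF x])
    show "bounded_linear (B ?x)" by (rule B(1)[OF x])
    obtain C where C: "C > 0" "\<And>v. norm (B ?x v) \<le> C * norm v"
      using B.pos_bounded by (metis mult.commute)
    fix \<epsilon> :: real assume "\<epsilon> > 0"
    \<comment> \<open>\<open>C\<close> bounds the inverse differential and \<open>2 * K\<close> is
      the Lipschitz constant of \<open>g\<close>; dividing by both converts the error of
      \<open>f\<close> at \<open>g y\<close> into one of \<open>g\<close> at
      \<open>y\<close>.\<close>
    then have "\<epsilon> / (C * (2 * K)) > 0" using C K by simp
    then obtain d where d: "d > 0" "\<And>z. z \<in> U \<Longrightarrow> norm (z - ?x) < d \<Longrightarrow>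
        norm (f z - f ?x - ?D ?x (z - ?x)) \<le> \<epsilon> / (C * (2 * K)) * norm (z - ?x)"
      using C_inf_has_derivative[OF f xU] unfolding has_derivative_within_alt by blast
    show "\<exists>d>0. \<forall>z\<in>V. norm (z - y) < d \<longrightarrow> norm (g z - g y - B ?x (z - y)) \<le> \<epsilon> * norm (z - y)"
    proof (intro exI[of _ "d / (2 * K)"] conjI ballI impI)
      show "d / (2 * K) > 0" using d K by simp
      fix z assume z: "z \<in> V" "norm (z - y) < d / (2 * K)"
      let ?x' = "g z"
      note x' = fg(1)[OF z(1)]
      have xx: "norm (?x' - ?x) \<le> 2 * K * norm (z - y)"
        using lip[OF x' x] fg(2) y z(1) by simp
      also have "\<dots> < d" using z(2) K by (simp add: field_simps)
      finally have "norm (f ?x' - f ?x - ?D ?x (?x' - ?x)) \<le> \<epsilon> / (C * (2 * K)) * norm (?x' - ?x)"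
        using x' U'S SU by (intro d(2)) auto
      then have *: "norm (z - y - ?D ?x (?x' - ?x)) \<le> \<epsilon> / (C * (2 * K)) * norm (?x' - ?x)"
        using fg(2) y z(1) by simp
      have "?x' - ?x \<in> euclid n"
        using x x' U'S by (intro euclid_diff) (auto simp: S_def)
      then have "g z - g y - B ?x (z - y) = - B ?x (z - y - ?D ?x (?x' - ?x))"
        by (simp add: B.diff B(4)[OF x])
      then have "norm (g z - g y - B ?x (z - y)) \<le> C * norm (z - y - ?D ?x (?x' - ?x))"
        using C(2) by simp
      also have "\<dots> \<le> C * (\<epsilon> / (C * (2 * K)) * (2 * K * norm (z - y)))"
        using C K xx \<open>\<epsilon> > 0\<close> by (intro mult_left_mono order_trans[OF *]) auto
      also have "\<dots> = \<epsilon> * norm (z - y)"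
        using C K by (simp add: field_simps)
      finally show "norm (g z - g y - B ?x (z - y)) \<le> \<epsilon> * norm (z - y)" .
    qed
  qed
  have gU: "g y \<in> U" if "y \<in> V" for y
    using that fg U'S SU by auto
  interpret fam: linear_iso_family n n V "\<lambda>y. ?D (g y)" "\<lambda>y. B (g y)"
  proof (rule linear_iso_family.intro)
    fix y assume y: "y \<in> V"
    show "linear (?D (g y))" by (rule linear_Der[OF f gU[OF y]])
    show "linear (B (g y))" using B(1)[OF fg(1)[OF y]] bounded_linear.linear by blast
  next
    fix y v assume "y \<in> V" "v \<in> euclid n"
    then show "?D (g y) v \<in> euclid n" using Dn[OF gU] by blast
  qed (use V B fg in auto)
  \<comment> \<open>Bootstrapping: if \<open>g\<close> is C^k, so is the differential of
    \<open>f\<close> along \<open>g\<close>, hence so is its inverse. That inverse is the derivative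
    of \<open>g\<close>, which gains one order.\<close>
  have "C_k k n V g" for k
  proof (induction k)
    case 0
    show ?case
      using g' by (auto simp: continuous_on_eq_continuous_within intro: has_derivative_continuous)
  next
    case (Suc k)
    have "C_k k n V (\<lambda>y. ?D (g y) v)" if "v \<in> euclid n" for v
      by (rule C_k_compose[OF V U' _ Suc.IH C_k_restrict[OF C_infD[OF C_inf_Der[OF U f that]]]])
        (use fg U'S SU in auto)
    then have "C_k k n V (\<lambda>y. B (g y) v)" if "v \<in> euclid n" for v
      using that by (rule fam.C_k_inverse)
    then show ?case
      using g' unfolding C_k.simps by (intro exI[of _ "\<lambda>y. B (g y)"]) blast
  qed
  then have "C_inf n V g" by (rule C_infI)
  then show thesis
    using that[OF U' rU' _ V \<open>f ` U' = V\<close> gf] U'S SU by blast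
qed

section \<open>Subspaces, products and quotients of diffeological spaces\<close>

lemma dsmooth_point: "dsmooth X Y f \<Longrightarrow> x \<in> points X \<Longrightarrow> f x \<in> points Y"
  by (auto simp: dsmooth_def)

lemma dsmooth_plot: "dsmooth X Y f \<Longrightarrow> (n, U, p) \<in> plots X \<Longrightarrow> (n, U, f \<circ> p) \<in> plots Y"
  by (auto simp: dsmooth_def)

lemma dsmoothI:
  assumes "\<And>x. x \<in> points X \<Longrightarrow> f x \<in> points Y"
    and "\<And>n U p. (n, U, p) \<in> plots X \<Longrightarrow> (n, U, f \<circ> p) \<in> plots Y"
  shows "dsmooth X Y f"
  using assms by (auto simp: dsmooth_def)

lemma dsmooth_compose: "dsmooth X Y f \<Longrightarrow> dsmooth Y Z g \<Longrightarrow> dsmooth X Z (g \<circ> f)"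
  by (rule dsmoothI) (auto simp: comp_assoc intro: dsmooth_point dsmooth_plot)

lemma plots_sub_dspace:
  "(n, U, p) \<in> plots (sub_dspace X A) \<longleftrightarrow> (n, U, p) \<in> plots X \<and> p ` U \<subseteq> A"
  by (simp add: sub_dspace_def)

lemma points_sub_dspace: "points (sub_dspace X A) = points X \<inter> A"
  by (simp add: sub_dspace_def)

lemma plots_product:
  "(n, U, p) \<in> plots (product X Y) \<longleftrightarrow> (n, U, fst \<circ> p) \<in> plots X \<and> (n, U, snd \<circ> p) \<in> plots Y"
  by (simp add: product_def)

lemma points_product: "points (product X Y) = points X \<times> points Y"
  by (simp add: product_def)

lemma dsmooth_sub_dspace: "dsmooth X Y f \<Longrightarrow> dsmooth (sub_dspace X A) Y f"
  by (rule dsmoothI) (auto simp: plots_sub_dspace points_sub_dspace intro: dsmooth_point dsmooth_plot)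

lemma plot_const:
  assumes "diffeological X" "eopen n U" "x \<in> points X"
  shows "(n, U, \<lambda>_. x) \<in> plots X"
  using assms(1)[unfolded diffeological_def, THEN conjunct2, THEN conjunct2, THEN conjunct1,
      rule_format, of n U x] assms(2,3) by iprover

lemma diffeologicalI:
  assumes "\<And>n U p. (n, U, p) \<in> plots X \<Longrightarrow> eopen n U \<and> p ` U \<subseteq> points X"
    and "\<And>n U p p'. (n, U, p) \<in> plots X \<Longrightarrow> (\<And>r. r \<in> U \<Longrightarrow> p' r = p r) \<Longrightarrow> (n, U, p') \<in> plots X"
    and "\<And>n U x. eopen n U \<Longrightarrow> x \<in> points X \<Longrightarrow> (n, U, \<lambda>_. x) \<in> plots X"
    and "\<And>n U p m W f. (n, U, p) \<in> plots X \<Longrightarrow> eopen m W \<Longrightarrow> C_inf m W f \<Longrightarrow> f ` W \<subseteq> U \<Longrightarrow>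
        (m, W, p \<circ> f) \<in> plots X"
    and "\<And>n U p. eopen n U \<Longrightarrow>
        (\<And>r. r \<in> U \<Longrightarrow> \<exists>V. eopen n V \<and> r \<in> V \<and> V \<subseteq> U \<and> (n, V, p) \<in> plots X) \<Longrightarrow>
        (n, U, p) \<in> plots X"
  shows "diffeological X"
  unfolding diffeological_def
proof (intro conjI allI impI)
  fix n U p assume "(n, U, p) \<in> plots X"
  then show "eopen n U" "p ` U \<subseteq> points X" using assms(1) by blast+
next
  fix n U p p' assume "(n, U, p) \<in> plots X \<and> (\<forall>r\<in>U. p' r = p r)"
  then show "(n, U, p') \<in> plots X" using assms(2)[of n U p p'] by simp
next
  fix n U x assume "eopen n U \<and> x \<in> points X"
  then show "(n, U, \<lambda>_. x) \<in> plots X" using assms(3) by simp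
next
  fix n U p m W f assume "(n, U, p) \<in> plots X \<and> eopen m W \<and> C_inf m W f \<and> f ` W \<subseteq> U"
  then show "(m, W, p \<circ> f) \<in> plots X" using assms(4)[of n U p m W f] by simp
next
  fix n U p
  assume "eopen n U \<and> (\<forall>r\<in>U. \<exists>V. eopen n V \<and> r \<in> V \<and> V \<subseteq> U \<and> (n, V, p) \<in> plots X)"
  then show "(n, U, p) \<in> plots X" using assms(5)[of n U p] by simp
qed

lemma diffeological_sub_dspace:
  assumes X: "diffeological X"
  shows "diffeological (sub_dspace X A)"
proof (rule diffeologicalI, unfold plots_sub_dspace points_sub_dspace)
  fix n U p assume p: "(n, U, p) \<in> plots X \<and> p ` U \<subseteq> A"
  then show "eopen n U \<and> p ` U \<subseteq> points X \<inter> A"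
    using plot_domain[OF X] by blast
  show "(n, U, p') \<in> plots X \<and> p' ` U \<subseteq> A" if "\<And>r. r \<in> U \<Longrightarrow> p' r = p r" for p'
    using p plot_cong[OF X, of n U p p'] that by auto
  show "(m, W, p \<circ> f) \<in> plots X \<and> (p \<circ> f) ` W \<subseteq> A"
    if "eopen m W" "C_inf m W f" "f ` W \<subseteq> U" for m W f
    using p plot_compose[OF X _ that] that(3) by (auto simp: image_subset_iff)
next
  fix n U p
  assume "eopen n U"
    and *: "\<And>r. r \<in> U \<Longrightarrow> \<exists>V. eopen n V \<and> r \<in> V \<and> V \<subseteq> U \<and> (n, V, p) \<in> plots X \<and> p ` V \<subseteq> A"
  then have "(n, U, p) \<in> plots X"
    by (intro plot_local[OF X]) blast+
  then show "(n, U, p) \<in> plots X \<and> p ` U \<subseteq> A"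
    using * by blast
qed (auto intro: plot_const[OF X])

lemma diffeological_product:
  assumes X: "diffeological X" and Y: "diffeological Y"
  shows "diffeological (product X Y)"
proof (rule diffeologicalI, unfold plots_product points_product)
  fix n U p assume p: "(n, U, fst \<circ> p) \<in> plots X \<and> (n, U, snd \<circ> p) \<in> plots Y"
  then show "eopen n U \<and> p ` U \<subseteq> points X \<times> points Y"
    using plot_domain[OF X, of n U "fst \<circ> p"] plot_domain[OF Y, of n U "snd \<circ> p"]
    by (auto simp: image_subset_iff mem_Times_iff)
  show "(n, U, fst \<circ> p') \<in> plots X \<and> (n, U, snd \<circ> p') \<in> plots Y"
    if "\<And>r. r \<in> U \<Longrightarrow> p' r = p r" for p'
    using p that by (auto intro: plot_cong[OF X, of n U "fst \<circ> p"] plot_cong[OF Y, of n U "snd \<circ> p"])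
  show "(m, W, fst \<circ> (p \<circ> f)) \<in> plots X \<and> (m, W, snd \<circ> (p \<circ> f)) \<in> plots Y"
    if "eopen m W" "C_inf m W f" "f ` W \<subseteq> U" for m W f
    unfolding comp_assoc[symmetric]
    using plot_compose[OF X p[THEN conjunct1] that] plot_compose[OF Y p[THEN conjunct2] that]
    by (rule conjI)
next
  fix n U p
  assume "eopen n U"
    and "\<And>r. r \<in> U \<Longrightarrow> \<exists>V. eopen n V \<and> r \<in> V \<and> V \<subseteq> U \<and>
      (n, V, fst \<circ> p) \<in> plots X \<and> (n, V, snd \<circ> p) \<in> plots Y"
  then show "(n, U, fst \<circ> p) \<in> plots X \<and> (n, U, snd \<circ> p) \<in> plots Y"
    by (intro conjI plot_local[OF X] plot_local[OF Y]) blast+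
qed (auto simp: comp_def intro: plot_const[OF X] plot_const[OF Y])

lemma plots_quotient_by:
  "(n, U, p) \<in> plots (quotient_by X f) \<longleftrightarrow> eopen n U \<and>
    (\<forall>r\<in>U. \<exists>V q. eopen n V \<and> r \<in> V \<and> V \<subseteq> U \<and> (n, V, q) \<in> plots X \<and> (\<forall>z\<in>V. p z = f (q z)))"
  by (simp add: quotient_by_def)

lemma points_quotient_by: "points (quotient_by X f) = f ` points X"
  by (simp add: quotient_by_def)

lemma diffeological_quotient_by:
  assumes X: "diffeological X"
  shows "diffeological (quotient_by X f)"
proof (rule diffeologicalI, unfold plots_quotient_by points_quotient_by)
  fix n U p
  assume p: "eopen n U \<and>
    (\<forall>r\<in>U. \<exists>V q. eopen n V \<and> r \<in> V \<and> V \<subseteq> U \<and> (n, V, q) \<in> plots X \<and> (\<forall>z\<in>V. p z = f (q z)))"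
  show "eopen n U \<and> p ` U \<subseteq> f ` points X"
    using p plot_domain(2)[OF X] by (fastforce simp: image_subset_iff)
  show "eopen n U \<and>
      (\<forall>r\<in>U. \<exists>V q. eopen n V \<and> r \<in> V \<and> V \<subseteq> U \<and> (n, V, q) \<in> plots X \<and> (\<forall>z\<in>V. p' z = f (q z)))"
    if "\<And>r. r \<in> U \<Longrightarrow> p' r = p r" for p'
    using p that by (metis subsetD)
  show "eopen m W \<and>
      (\<forall>r\<in>W. \<exists>V q. eopen m V \<and> r \<in> V \<and> V \<subseteq> W \<and> (m, V, q) \<in> plots X \<and> (\<forall>z\<in>V. (p \<circ> h) z = f (q z)))"
    if h: "eopen m W" "C_inf m W h" "h ` W \<subseteq> U" for m W h
  proof (intro conjI ballI h(1))
    fix r assume r: "r \<in> W"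
    then obtain V q where V: "eopen n V" "h r \<in> V" "V \<subseteq> U" "(n, V, q) \<in> plots X" "\<forall>z\<in>V. p z = f (q z)"
      using p h(3) by blast
    let ?V = "{z \<in> W. h z \<in> V}"
    have "eopen m ?V"
      using p h(3) eopen_subset by (intro eopen_preimage[OF h(1) C_inf_continuous_on[OF h(2)] _ V(1)]) blast
    moreover from this have "(m, ?V, q \<circ> h) \<in> plots X"
      by (intro plot_compose[OF X V(4)] C_inf_restrict[OF h(2)]) auto
    ultimately show "\<exists>V q. eopen m V \<and> r \<in> V \<and> V \<subseteq> W \<and> (m, V, q) \<in> plots X \<and> (\<forall>z\<in>V. (p \<circ> h) z = f (q z))"
      using r V by (intro exI[of _ ?V] exI[of _ "q \<circ> h"]) auto
  qed
next
  fix n U x assume "eopen n U" "x \<in> f ` points X"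
  then show "eopen n U \<and>
      (\<forall>r\<in>U. \<exists>V q. eopen n V \<and> r \<in> V \<and> V \<subseteq> U \<and> (n, V, q) \<in> plots X \<and> (\<forall>z\<in>V. x = f (q z)))"
    using plot_const[OF X] by (metis (no_types, lifting) imageE order_refl)
next
  fix n U p
  assume "eopen n U"
    and *: "\<And>r. r \<in> U \<Longrightarrow> \<exists>V. eopen n V \<and> r \<in> V \<and> V \<subseteq> U \<and> eopen n V \<and>
      (\<forall>r\<in>V. \<exists>V' q. eopen n V' \<and> r \<in> V' \<and> V' \<subseteq> V \<and> (n, V', q) \<in> plots X \<and> (\<forall>z\<in>V'. p z = f (q z)))"
  show "eopen n U \<and>
      (\<forall>r\<in>U. \<exists>V q. eopen n V \<and> r \<in> V \<and> V \<subseteq> U \<and> (n, V, q) \<in> plots X \<and> (\<forall>z\<in>V. p z = f (q z)))"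
  proof (intro conjI ballI \<open>eopen n U\<close>)
    fix r assume "r \<in> U"
    from *[OF this] obtain V where V: "r \<in> V" "V \<subseteq> U"
      "\<forall>r\<in>V. \<exists>V' q. eopen n V' \<and> r \<in> V' \<and> V' \<subseteq> V \<and> (n, V', q) \<in> plots X \<and> (\<forall>z\<in>V'. p z = f (q z))"
      by blast
    from V(3)[rule_format, OF V(1)] V(2)
    show "\<exists>V q. eopen n V \<and> r \<in> V \<and> V \<subseteq> U \<and> (n, V, q) \<in> plots X \<and> (\<forall>z\<in>V. p z = f (q z))"
      by (meson order_trans)
  qed
qed

lemma dsmooth_quotient_by:
  assumes "diffeological X"
  shows "dsmooth X (quotient_by X f) f"
proof (rule dsmoothI, unfold plots_quotient_by points_quotient_by)
  fix n U p assume p: "(n, U, p) \<in> plots X"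
  then show "eopen n U \<and>
      (\<forall>r\<in>U. \<exists>V q. eopen n V \<and> r \<in> V \<and> V \<subseteq> U \<and> (n, V, q) \<in> plots X \<and> (\<forall>z\<in>V. (f \<circ> p) z = f (q z)))"
    using plot_domain(1)[OF assms p] by (metis comp_apply order_refl)
qed blast

section \<open>Sets open in the D-topology\<close>

lemma dopen_subset: "dopen X A \<Longrightarrow> A \<subseteq> points X"
  by (simp add: dopen_def)

lemma dopen_plot: "dopen X A \<Longrightarrow> (n, U, p) \<in> plots X \<Longrightarrow> eopen n {r \<in> U. p r \<in> A}"
  by (auto simp: dopen_def)

lemma dopenI:
  "A \<subseteq> points X \<Longrightarrow> (\<And>n U p. (n, U, p) \<in> plots X \<Longrightarrow> eopen n {r \<in> U. p r \<in> A}) \<Longrightarrow> dopen X A"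
  by (auto simp: dopen_def)

lemma dopen_preimage:
  assumes X: "diffeological X" and f: "dsmooth X Y f" and A: "dopen Y A"
  shows "dopen X {x \<in> points X. f x \<in> A}"
proof (rule dopenI)
  fix n U p assume p: "(n, U, p) \<in> plots X"
  have "{r \<in> U. p r \<in> {x \<in> points X. f x \<in> A}} = {r \<in> U. (f \<circ> p) r \<in> A}"
    using plot_domain(2)[OF X p] by auto
  then show "eopen n {r \<in> U. p r \<in> {x \<in> points X. f x \<in> A}}"
    using dopen_plot[OF A dsmooth_plot[OF f p]] by simp
qed auto

lemma plot_restrict_dopen:
  assumes X: "diffeological X" and A: "dopen X A" and p: "(n, U, p) \<in> plots X"
  shows "(n, {r \<in> U. p r \<in> A}, p) \<in> plots (sub_dspace X A)"
  unfolding plots_sub_dspace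
  using plot_restrict[OF X p dopen_plot[OF A p]] by auto

section \<open>Charts and local diffeomorphisms\<close>

lemma chartD:
  assumes "chart n X V \<phi>"
  shows "(n, V, \<phi>) \<in> plots X" "inj_on \<phi> V" "dopen X (\<phi> ` V)"
    "(m, W, p) \<in> plots X \<Longrightarrow> p ` W \<subseteq> \<phi> ` V \<Longrightarrow> C_inf m W (inv_into V \<phi> \<circ> p)"
  using assms by (auto simp: chart_def)

lemma chartI:
  assumes "(n, V, \<phi>) \<in> plots X" "inj_on \<phi> V" "dopen X (\<phi> ` V)"
    and "\<And>m W p. (m, W, p) \<in> plots X \<Longrightarrow> p ` W \<subseteq> \<phi> ` V \<Longrightarrow> C_inf m W (inv_into V \<phi> \<circ> p)"
  shows "chart n X V \<phi>"
  using assms by (auto simp: chart_def)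

text \<open>Openness of the smaller image is tested on plots, where in chart coordinates it becomes
  the preimage of \<open>V'\<close> under a continuous map.\<close>

lemma chart_restrict:
  assumes X: "diffeological X" and c: "chart n X V \<phi>" and V': "eopen n V'" "V' \<subseteq> V"
  shows "chart n X V' \<phi>"
proof (rule chartI)
  note V = plot_domain[OF X chartD(1)[OF c]]
  show "(n, V', \<phi>) \<in> plots X"
    by (rule plot_restrict[OF X chartD(1)[OF c] V'])
  show "inj_on \<phi> V'" using chartD(2)[OF c] V'(2) by (rule inj_on_subset)
  have inv: "inv_into V' \<phi> x = inv_into V \<phi> x" if x: "x \<in> \<phi> ` V'" for x
    using x \<open>inj_on \<phi> V'\<close> chartD(2)[OF c] V'(2) by (auto simp: inv_into_f_f subset_eq)
  show "dopen X (\<phi> ` V')"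
  proof (rule dopenI)
    show "\<phi> ` V' \<subseteq> points X" using V V'(2) by blast
    fix m U p assume p: "(m, U, p) \<in> plots X"
    let ?U = "{r \<in> U. p r \<in> \<phi> ` V}"
    have "{r \<in> U. p r \<in> \<phi> ` V'} = {r \<in> ?U. (inv_into V \<phi> \<circ> p) r \<in> V'}"
      using V'(2) chartD(2)[OF c] by (auto simp: inv_into_f_f subset_eq)
    moreover have "eopen m {r \<in> ?U. (inv_into V \<phi> \<circ> p) r \<in> V'}"
    proof (rule eopen_preimage[OF chart_preimage(1)[OF X c p]
          C_inf_continuous_on[OF chart_preimage(2)[OF X c p]] _ V'(1)])
      show "(inv_into V \<phi> \<circ> p) ` ?U \<subseteq> euclid n"
        using eopen_subset[OF V(1)] by (auto intro!: subsetD[OF _ inv_into_into])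
    qed
    ultimately show "eopen m {r \<in> U. p r \<in> \<phi> ` V'}" by simp
  qed
  fix m W p assume p: "(m, W, p) \<in> plots X" "p ` W \<subseteq> \<phi> ` V'"
  then have "C_inf m W (inv_into V \<phi> \<circ> p)"
    using V'(2) by (intro chartD(4)[OF c]) auto
  then show "C_inf m W (inv_into V' \<phi> \<circ> p)"
    by (rule C_inf_cong) (use p(2) inv in \<open>auto simp: image_subset_iff\<close>)
qed

text \<open>The inverse is an explicit argument: it serves as a local section of the source map, and
  the roles of the two spaces can be exchanged.\<close>

definition open_diffeo ::
  "'a dspace \<Rightarrow> 'b dspace \<Rightarrow> 'a set \<Rightarrow> 'b set \<Rightarrow> ('a \<Rightarrow> 'b) \<Rightarrow> ('b \<Rightarrow> 'a) \<Rightarrow> bool" where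
  "open_diffeo X Y B A f \<sigma> \<longleftrightarrow>
     dopen X B \<and> dopen Y A \<and> dsmooth (sub_dspace X B) Y f \<and> dsmooth (sub_dspace Y A) X \<sigma> \<and>
     f ` B \<subseteq> A \<and> \<sigma> ` A \<subseteq> B \<and> (\<forall>x\<in>B. \<sigma> (f x) = x) \<and> (\<forall>y\<in>A. f (\<sigma> y) = y)"

lemma open_diffeo_sym: "open_diffeo X Y B A f \<sigma> \<Longrightarrow> open_diffeo Y X A B \<sigma> f"
  by (auto simp: open_diffeo_def)

text \<open>A plot of \<open>Y\<close> is tested against \<open>f \<circ> \<phi>\<close> by moving
  it back with \<sigma> and testing it against \<phi>.\<close>

lemma chart_open_diffeo:
  assumes Y: "diffeological Y" and d: "open_diffeo X Y B A f \<sigma>"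
    and c: "chart n X V \<phi>" "\<phi> ` V \<subseteq> B"
  shows "chart n Y V (f \<circ> \<phi>)"
proof (rule chartI)
  have d': "dopen Y A" "dsmooth (sub_dspace X B) Y f" "dsmooth (sub_dspace Y A) X \<sigma>"
    "f ` B \<subseteq> A" "\<And>x. x \<in> B \<Longrightarrow> \<sigma> (f x) = x" "\<And>y. y \<in> A \<Longrightarrow> f (\<sigma> y) = y"
    using d by (auto simp: open_diffeo_def)
  show "(n, V, f \<circ> \<phi>) \<in> plots Y"
    using chartD(1)[OF c(1)] c(2) by (intro dsmooth_plot[OF d'(2)]) (simp add: plots_sub_dspace)
  show "inj_on (f \<circ> \<phi>) V"
    using chartD(2)[OF c(1)] c(2) d'(5) by (auto simp: inj_on_def) (metis image_subset_iff)
  have img: "(f \<circ> \<phi>) ` V \<subseteq> A" using c(2) d'(4) by auto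
  show "dopen Y ((f \<circ> \<phi>) ` V)"
  proof (rule dopenI)
    show "(f \<circ> \<phi>) ` V \<subseteq> points Y" using img dopen_subset[OF d'(1)] by blast
    fix m U p assume p: "(m, U, p) \<in> plots Y"
    let ?U = "{r \<in> U. p r \<in> A}"
    have "{r \<in> U. p r \<in> (f \<circ> \<phi>) ` V} = {r \<in> ?U. (\<sigma> \<circ> p) r \<in> \<phi> ` V}"
    proof (intro set_eqI iffI)
      fix r assume "r \<in> {r \<in> U. p r \<in> (f \<circ> \<phi>) ` V}"
      then show "r \<in> {r \<in> ?U. (\<sigma> \<circ> p) r \<in> \<phi> ` V}"
        using img d'(5) c(2) by auto
    next
      fix r assume "r \<in> {r \<in> ?U. (\<sigma> \<circ> p) r \<in> \<phi> ` V}"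
      then have r: "r \<in> U" "p r \<in> A" "\<sigma> (p r) \<in> \<phi> ` V" by auto
      then obtain z where "z \<in> V" "\<sigma> (p r) = \<phi> z" by blast
      then have "p r = (f \<circ> \<phi>) z" using d'(6)[OF r(2)] by simp
      then show "r \<in> {r \<in> U. p r \<in> (f \<circ> \<phi>) ` V}" using \<open>z \<in> V\<close> r by blast
    qed
    then show "eopen m {r \<in> U. p r \<in> (f \<circ> \<phi>) ` V}"
      using dopen_plot[OF chartD(3)[OF c(1)]
          dsmooth_plot[OF d'(3) plot_restrict_dopen[OF Y d'(1) p]]] by simp
  qed
  fix m W p assume p: "(m, W, p) \<in> plots Y" "p ` W \<subseteq> (f \<circ> \<phi>) ` V"
  have inv: "\<sigma> (p r) \<in> \<phi> ` V \<and> inv_into V \<phi> (\<sigma> (p r)) = inv_into V (f \<circ> \<phi>) (p r)" if "r \<in> W" for r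
  proof -
    have "p r \<in> (f \<circ> \<phi>) ` V" using p(2) that by (rule subsetD[OF _ imageI])
    then obtain z where z: "z \<in> V" "p r = (f \<circ> \<phi>) z" by (rule imageE)
    then have "\<sigma> (p r) = \<phi> z" using d'(5) c(2) by auto
    then show ?thesis
      using z chartD(2)[OF c(1)] inv_into_f_f[OF \<open>inj_on (f \<circ> \<phi>) V\<close> z(1)] by auto
  qed
  have "(m, W, \<sigma> \<circ> p) \<in> plots X"
    using p img by (intro dsmooth_plot[OF d'(3)]) (auto simp: plots_sub_dspace)
  then have "C_inf m W (inv_into V \<phi> \<circ> (\<sigma> \<circ> p))"
    using inv by (intro chartD(4)[OF c(1)]) auto
  then show "C_inf m W (inv_into V (f \<circ> \<phi>) \<circ> p)"
    by (rule C_inf_cong) (simp add: inv)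
qed

definition local_diffeo :: "'a dspace \<Rightarrow> 'b dspace \<Rightarrow> ('a \<Rightarrow> 'b) \<Rightarrow> bool" where
  "local_diffeo X Y f \<longleftrightarrow>
     dsmooth X Y f \<and> (\<forall>x\<in>points X. \<exists>B A \<sigma>. x \<in> B \<and> open_diffeo X Y B A f \<sigma>)"

lemma local_diffeoE:
  assumes "local_diffeo X Y f" "x \<in> points X"
  obtains B A \<sigma> where "x \<in> B" "open_diffeo X Y B A f \<sigma>"
  using assms by (auto simp: local_diffeo_def)

text \<open>Charts of \<open>Y\<close>, cut down to the domains of local inverses, are carried to
  \<open>X\<close> by these inverses. This gives \<open>composable G\<close> its manifold
  structure.\<close>

lemma manifold_local_diffeo:
  assumes X: "diffeological X" and Y: "manifold n Y" and f: "local_diffeo X Y f"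
  shows "manifold n X"
  unfolding manifold_def
proof (intro conjI X ballI)
  fix x assume x: "x \<in> points X"
  obtain B A \<sigma> where d: "x \<in> B" "open_diffeo X Y B A f \<sigma>"
    by (rule local_diffeoE[OF f x])
  have Yd: "diffeological Y" using Y by (simp add: manifold_def)
  have "f x \<in> A" "dopen Y A" "\<sigma> (f x) = x" using d by (auto simp: open_diffeo_def)
  then have "f x \<in> points Y" using dopen_subset by blast
  then obtain V \<psi> where c: "chart n Y V \<psi>" "f x \<in> \<psi> ` V"
    using Y unfolding manifold_def by blast
  let ?V = "{z \<in> V. \<psi> z \<in> A}"
  have "chart n Y ?V \<psi>"
    by (rule chart_restrict[OF Yd c(1) dopen_plot[OF \<open>dopen Y A\<close> chartD(1)[OF c(1)]]]) auto
  then have "chart n X ?V (\<sigma> \<circ> \<psi>)"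
    by (rule chart_open_diffeo[OF X open_diffeo_sym[OF d(2)]]) auto
  moreover have "x \<in> (\<sigma> \<circ> \<psi>) ` ?V"
    using c(2) \<open>f x \<in> A\<close> \<open>\<sigma> (f x) = x\<close> by force
  ultimately show "\<exists>V \<phi>. chart n X V \<phi> \<and> x \<in> \<phi> ` V" by blast
qed

text \<open>Between equal dimensions a surjective differential is bijective, so the inverse function
  theorem applies to the coordinate expression \<open>u\<close> of \<open>f\<close>.\<close>

lemma submersion_local_diffeo:
  assumes X: "manifold n X" and Y: "manifold n Y" and f: "submersion n X n Y f"
  shows "local_diffeo X Y f"
  unfolding local_diffeo_def
proof (intro conjI ballI)
  have Xd: "diffeological X" and Yd: "diffeological Y" using X Y by (auto simp: manifold_def)
  show fs: "dsmooth X Y f" using f by (simp add: submersion_def)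
  fix x assume x: "x \<in> points X"
  then obtain V \<phi> where c: "chart n X V \<phi>" "x \<in> \<phi> ` V"
    using X unfolding manifold_def by blast
  then obtain r where r: "r \<in> V" "x = \<phi> r" by blast
  obtain W \<psi> where e: "chart n Y W \<psi>" "f x \<in> \<psi> ` W"
    using Y dsmooth_point[OF fs x] unfolding manifold_def by blast
  note p = dsmooth_plot[OF fs chartD(1)[OF c(1)]]
  define V0 where "V0 = {z \<in> V. f (\<phi> z) \<in> \<psi> ` W}"
  define u where "u = inv_into W \<psi> \<circ> f \<circ> \<phi>"
  have V0: "eopen n V0" "C_inf n V0 u"
    using chart_preimage[OF Yd e(1) p] by (simp_all add: V0_def u_def comp_assoc)
  have uW: "u z \<in> W" "\<psi> (u z) = f (\<phi> z)" if "z \<in> V0" for z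
    using that by (auto simp: V0_def u_def inv_into_into f_inv_into_f)
  have "u ` V0 \<subseteq> euclid n"
    using uW(1) eopen_subset[OF plot_domain(1)[OF Yd chartD(1)[OF e(1)]]] by blast
  moreover have "r \<in> V0" using r e by (simp add: V0_def)
  moreover have "Der V0 u r ` euclid n = euclid n"
    using f c(1) e r unfolding submersion_def V0_def u_def by blast
  ultimately obtain U' V1 g where g: "eopen n U'" "r \<in> U'" "U' \<subseteq> V0" "eopen n V1" "u ` U' = V1"
      "\<And>x. x \<in> U' \<Longrightarrow> g (u x) = x" "C_inf n V1 g"
    using inverse_function_C_inf[OF V0] by metis
  have "V1 \<subseteq> W" using g(3,5) uW(1) by blast
  have U'V: "U' \<subseteq> V" using g(3) by (auto simp: V0_def)
  have c': "chart n X U' \<phi>" by (rule chart_restrict[OF Xd c(1) g(1) U'V])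
  have e': "chart n Y V1 \<psi>" by (rule chart_restrict[OF Yd e(1) g(4) \<open>V1 \<subseteq> W\<close>])
  define \<sigma> where "\<sigma> = \<phi> \<circ> (g \<circ> inv_into V1 \<psi>)"
  have inv: "inv_into V1 \<psi> (\<psi> (u z)) = u z" if "z \<in> U'" for z
    using that g(5) by (intro inv_into_f_f[OF chartD(2)[OF e']]) blast
  have \<sigma>: "\<sigma> (f (\<phi> z)) = \<phi> z" if z: "z \<in> U'" for z
  proof -
    have "f (\<phi> z) = \<psi> (u z)" using uW z g(3) by auto
    then show ?thesis using inv[OF z] g(6)[OF z] by (simp add: \<sigma>_def)
  qed
  have img: "f ` \<phi> ` U' = \<psi> ` V1"
    using g(3,5) uW(2) by (auto simp: image_iff) (metis subsetD)+
  show "\<exists>B A \<sigma>. x \<in> B \<and> open_diffeo X Y B A f \<sigma>"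
  proof (intro exI conjI)
    show "x \<in> \<phi> ` U'" using r g(2) by blast
    show "open_diffeo X Y (\<phi> ` U') (\<psi> ` V1) f \<sigma>"
      unfolding open_diffeo_def
    proof (intro conjI ballI)
      show "dsmooth (sub_dspace Y (\<psi> ` V1)) X \<sigma>"
      proof (rule dsmoothI)
        fix y assume "y \<in> points (sub_dspace Y (\<psi> ` V1))"
        then show "\<sigma> y \<in> points X"
          using \<sigma> img dopen_subset[OF chartD(3)[OF c']] by (force simp: points_sub_dspace)
      next
        fix m U p assume "(m, U, p) \<in> plots (sub_dspace Y (\<psi> ` V1))"
        then have p: "(m, U, p) \<in> plots Y" "p ` U \<subseteq> \<psi> ` V1" by (auto simp: plots_sub_dspace)
        have "C_inf m U (inv_into V1 \<psi> \<circ> p)" by (rule chartD(4)[OF e' p])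
        moreover have V1: "(inv_into V1 \<psi> \<circ> p) ` U \<subseteq> V1"
          using p(2) by (auto intro!: inv_into_into)
        ultimately have "C_inf m U (\<lambda>z. g ((inv_into V1 \<psi> \<circ> p) z))"
          by (rule C_inf_compose[OF plot_domain(1)[OF Yd p(1)] g(4) _ _ g(7)])
        moreover have "(\<lambda>z. g ((inv_into V1 \<psi> \<circ> p) z)) ` U \<subseteq> U'"
          using V1 g(5,6) by auto
        ultimately have "(m, U, \<phi> \<circ> (\<lambda>z. g ((inv_into V1 \<psi> \<circ> p) z))) \<in> plots X"
          by (rule plot_compose[OF Xd chartD(1)[OF c'] plot_domain(1)[OF Yd p(1)]])
        then show "(m, U, \<sigma> \<circ> p) \<in> plots X" by (simp add: \<sigma>_def comp_def)
      qed
      show "\<sigma> ` \<psi> ` V1 \<subseteq> \<phi> ` U'"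
        unfolding img[symmetric] using \<sigma> by auto
      fix y assume "y \<in> \<psi> ` V1"
      then obtain z where "z \<in> U'" "y = f (\<phi> z)" unfolding img[symmetric] by blast
      then show "f (\<sigma> y) = y" using \<sigma> by simp
    qed (use chartD(3)[OF c'] chartD(3)[OF e'] dsmooth_sub_dspace[OF fs] img \<sigma> in auto)
  qed
qed

section \<open>The functor \<open>T\<^sub>2\<close> on plots\<close>

lemma T2_class_compose:
  assumes "(n, U, p) \<in> plots X" "(m, W, q) \<in> plots X" "C_inf n U f" "f ` U \<subseteq> W"
    and "\<And>z. z \<in> U \<Longrightarrow> q (f z) = p z" "r \<in> U" "v \<in> euclid n" "w \<in> euclid n"
  shows "T2_class X (n, U, p) r v w = T2_class X (m, W, q) (f r) (Der U f r v) (Der U f r w)"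
  unfolding T2_class_eq_iff by (rule r_into_equivclp, rule T2_step.intros) (use assms in auto)

text \<open>The inclusion of domains is an admissible reparametrisation whose differential is the
  identity on R^n.\<close>

lemma T2_class_restrict:
  assumes X: "diffeological X" and p: "(n, U, p) \<in> plots X"
    and V: "eopen n V" "V \<subseteq> U" "r \<in> V" and vw: "v \<in> euclid n" "w \<in> euclid n"
  shows "T2_class X (n, V, p) r v w = T2_class X (n, U, p) r v w"
  using T2_class_compose[OF plot_restrict[OF X p V(1,2)] p C_inf_id _ _ V(3) vw] V(2)
  by (simp add: Der_id[OF V(1,3)] vw)

text \<open>Elements of \<open>T2 X\<close> see only the germ of a plot at the base point; this is
  how germ uniqueness of lifts becomes equality in \<open>T2\<close>.\<close>

lemma T2_class_cong:
  assumes X: "diffeological X" and p: "(n, U, p) \<in> plots X" and q: "(n, W, q) \<in> plots X"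
    and V: "eopen n V" "V \<subseteq> U" "V \<subseteq> W" "r \<in> V" and vw: "v \<in> euclid n" "w \<in> euclid n"
    and eq: "\<And>z. z \<in> V \<Longrightarrow> p z = q z"
  shows "T2_class X (n, U, p) r v w = T2_class X (n, W, q) r v w"
proof -
  have "T2_class X (n, V, p) r v w = T2_class X (n, W, q) r v w"
    using T2_class_compose[OF plot_restrict[OF X p V(1,2)] q C_inf_id _ _ V(4) vw] V(3) eq
    by (simp add: Der_id[OF V(1,4)] vw)
  then show ?thesis using T2_class_restrict[OF X p V(1,2,4) vw] by simp
qed

lemma points_T2:
  "points (T2 X) = {T2_class X (n, U, p) r v w | n U p r v w.
     (n, U, p) \<in> plots X \<and> r \<in> U \<and> v \<in> euclid n \<and> w \<in> euclid n}"
  unfolding T2_def points_quotient_by T2_coproduct_def by (auto simp: image_iff) blast+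

lemma T2_pointE:
  assumes "c \<in> points (T2 X)"
  obtains n U p r v w where "(n, U, p) \<in> plots X" "r \<in> U" "v \<in> euclid n" "w \<in> euclid n"
    "c = T2_class X (n, U, p) r v w"
  using assms unfolding points_T2 by blast

lemma T2_pointI:
  "(n, U, p) \<in> plots X \<Longrightarrow> r \<in> U \<Longrightarrow> v \<in> euclid n \<Longrightarrow> w \<in> euclid n \<Longrightarrow>
    T2_class X (n, U, p) r v w \<in> points (T2 X)"
  unfolding points_T2 by blast

lemma T2_map_point:
  assumes "dsmooth X Y h" "c \<in> points (T2 X)"
  shows "T2_map Y h c \<in> points (T2 Y)"
proof -
  obtain n U p r v w where c: "(n, U, p) \<in> plots X" "r \<in> U" "v \<in> euclid n" "w \<in> euclid n"
      "c = T2_class X (n, U, p) r v w"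
    using assms(2) by (rule T2_pointE)
  show ?thesis
    unfolding c(5) T2_map_class[OF assms(1)]
    by (intro T2_pointI dsmooth_plot[OF assms(1)] c)
qed

lemma T2_map_compose:
  assumes f: "dsmooth X Y f" and g: "dsmooth Y Z g" and "c \<in> points (T2 X)"
  shows "T2_map Z g (T2_map Y f c) = T2_map Z (g \<circ> f) c"
proof -
  obtain n U p r v w where c: "c = T2_class X (n, U, p) r v w"
    using assms(3) by (rule T2_pointE)
  show ?thesis
    unfolding c T2_map_class[OF f] T2_map_class[OF g] T2_map_class[OF dsmooth_compose[OF f g]]
    by (simp add: comp_assoc)
qed

lemma T2_map_cong:
  assumes X: "diffeological X" and Y: "diffeological Y" and f: "dsmooth X Y f" and g: "dsmooth X Y g"
    and eq: "\<And>x. x \<in> points X \<Longrightarrow> f x = g x" and "c \<in> points (T2 X)"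
  shows "T2_map Y f c = T2_map Y g c"
proof -
  obtain n U p r v w where c: "(n, U, p) \<in> plots X" "r \<in> U" "v \<in> euclid n" "w \<in> euclid n"
      "c = T2_class X (n, U, p) r v w"
    using assms(6) by (rule T2_pointE)
  show ?thesis
    unfolding c(5) T2_map_class[OF f] T2_map_class[OF g]
    by (rule T2_class_cong[OF Y dsmooth_plot[OF f c(1)] dsmooth_plot[OF g c(1)]
          plot_domain(1)[OF X c(1)]]) (use c plot_domain(2)[OF X c(1)] eq in auto)
qed

section \<open>Tensors\<close>

lemma tensor2_linear:
  assumes "tensor2 n U \<tau>" "r \<in> U" "u \<in> euclid n" "v \<in> euclid n" "w \<in> euclid n"
  shows "\<tau> r (a *\<^sub>R u + b *\<^sub>R v) w = a * \<tau> r u w + b * \<tau> r v w"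
    "\<tau> r w (a *\<^sub>R u + b *\<^sub>R v) = a * \<tau> r w u + b * \<tau> r w v"
  using assms unfolding tensor2_def by blast+

lemma tensor2_expand:
  assumes t: "tensor2 n U \<tau>" and r: "r \<in> U" and v: "v \<in> euclid n" and w: "w \<in> euclid n"
  shows "\<tau> r v w = (\<Sum>i<n. \<Sum>j<n. Poly_Mapping.lookup v i *
    (Poly_Mapping.lookup w j * \<tau> r (unit_vec i) (unit_vec j)))"
proof -
  interpret T: linear "trunc n" using bounded_linear_trunc bounded_linear.linear by blast
  \<comment> \<open>Bilinearity is known on R^n only; inserting \<open>trunc\<close> gives maps that
    are linear on the whole space, as the coordinate expansion demands.\<close>
  have l: "linear (\<lambda>v. \<tau> r (trunc n v) w)" if "w \<in> euclid n" for w
    using tensor2_linear(1)[OF t r trunc_euclid trunc_euclid that, of 1 _ 1]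
      tensor2_linear(1)[OF t r trunc_euclid trunc_euclid that, of _ _ 0]
    by (intro linearI) (simp_all add: T.add T.scale)
  have r: "linear (\<lambda>w. \<tau> r v (trunc n w))" if "v \<in> euclid n" for v
    using tensor2_linear(2)[OF t r trunc_euclid trunc_euclid that, of 1 _ 1]
      tensor2_linear(2)[OF t r trunc_euclid trunc_euclid that, of _ _ 0]
    by (intro linearI) (simp_all add: T.add T.scale)
  have "\<tau> r v w = (\<Sum>i<n. Poly_Mapping.lookup v i * \<tau> r (unit_vec i) w)"
    using linear_euclid_expand[OF l[OF w] v] v by (simp add: trunc_id)
  also have "\<dots> = (\<Sum>i<n. Poly_Mapping.lookup v i *
      (\<Sum>j<n. Poly_Mapping.lookup w j * \<tau> r (unit_vec i) (unit_vec j)))"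
    by (intro sum.cong refl arg_cong2[where f = "(*)"])
      (use linear_euclid_expand[OF r w] w in \<open>simp add: trunc_id\<close>)
  finally show ?thesis by (simp add: sum_distrib_left)
qed

lemma C_inf_tensor2:
  assumes t: "tensor2 n U \<tau>" and U: "eopen n U" and W: "eopen k W"
    and f: "C_inf k W f" "f ` W \<subseteq> U" and a: "C_inf k W a" "a ` W \<subseteq> euclid n"
    and b: "C_inf k W b" "b ` W \<subseteq> euclid n"
  shows "C_inf k W (\<lambda>z. \<tau> (f z) (a z) (b z))"
proof -
  have "C_inf n U (\<lambda>r. \<tau> r (unit_vec i) (unit_vec j))" if "i < n" "j < n" for i j
    using t that unfolding tensor2_def by simp
  then have c: "C_inf k W (\<lambda>z. \<tau> (f z) (unit_vec i) (unit_vec j))" if "i < n" "j < n" for i j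
    using that by (intro C_inf_compose[OF W U f])
  have "C_inf k W (\<lambda>z. \<Sum>i<n. \<Sum>j<n. Poly_Mapping.lookup (a z) i *
      (Poly_Mapping.lookup (b z) j * \<tau> (f z) (unit_vec i) (unit_vec j)))"
    unfolding real_scaleR_def[symmetric]
    by (intro C_inf_sum C_inf_scaleR C_inf_bounded_linear[OF bounded_linear_lookup] a(1) b(1) c) auto
  then show ?thesis
    by (rule C_inf_cong) (use f a b in \<open>auto intro!: tensor2_expand[OF t, symmetric]\<close>)
qed

lemma tensor2_cong:
  assumes "eopen n U" "tensor2 n U \<tau>"
    and "\<And>r v w. r \<in> U \<Longrightarrow> v \<in> euclid n \<Longrightarrow> w \<in> euclid n \<Longrightarrow> \<tau>' r v w = \<tau> r v w"
  shows "tensor2 n U \<tau>'"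
  unfolding tensor2_def
proof (intro conjI ballI allI)
  fix r u v w a b assume *: "r \<in> U" "u \<in> euclid n" "v \<in> euclid n" "w \<in> euclid n"
  then have "a *\<^sub>R u + b *\<^sub>R v \<in> euclid n" by (intro euclid_add euclid_scaleR)
  then show "\<tau>' r (a *\<^sub>R u + b *\<^sub>R v) w = a * \<tau>' r u w + b * \<tau>' r v w"
    "\<tau>' r w (a *\<^sub>R u + b *\<^sub>R v) = a * \<tau>' r w u + b * \<tau>' r w v"
    using * assms(3) tensor2_linear[OF assms(2)] by simp_all
next
  fix v w assume "v \<in> euclid n" "w \<in> euclid n"
  then have "C_inf n U (\<lambda>r. \<tau> r v w)"
    using assms(2) unfolding tensor2_def by blast
  then show "C_inf n U (\<lambda>r. \<tau>' r v w)"
    by (rule C_inf_cong) (simp add: assms(3) \<open>v \<in> euclid n\<close> \<open>w \<in> euclid n\<close>)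
qed

lemma tensor2_local:
  assumes U: "eopen n U"
    and loc: "\<And>r. r \<in> U \<Longrightarrow> \<exists>V. eopen n V \<and> r \<in> V \<and> V \<subseteq> U \<and> tensor2 n V \<tau>"
  shows "tensor2 n U \<tau>"
  unfolding tensor2_def
proof (intro conjI ballI allI)
  fix r u v w a b assume *: "r \<in> U" "u \<in> euclid n" "v \<in> euclid n" "w \<in> euclid n"
  then obtain V where "r \<in> V" "tensor2 n V \<tau>" using loc by blast
  from tensor2_linear[OF this(2,1) *(2-4)]
  show "\<tau> r (a *\<^sub>R u + b *\<^sub>R v) w = a * \<tau> r u w + b * \<tau> r v w"
    "\<tau> r w (a *\<^sub>R u + b *\<^sub>R v) = a * \<tau> r w u + b * \<tau> r w v" .
next
  fix v w assume vw: "v \<in> euclid n" "w \<in> euclid n"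
  show "C_inf n U (\<lambda>r. \<tau> r v w)"
  proof (rule C_inf_local[OF U])
    fix r assume "r \<in> U"
    from loc[OF this] obtain V where V: "eopen n V" "r \<in> V" "V \<subseteq> U" "tensor2 n V \<tau>"
      by blast
    then have "C_inf n V (\<lambda>r. \<tau> r v w)"
      using vw unfolding tensor2_def by blast
    then show "\<exists>V. eopen n V \<and> r \<in> V \<and> V \<subseteq> U \<and> C_inf n V (\<lambda>r. \<tau> r v w)"
      using V(1-3) by blast
  qed
qed

lemma tensor2_pullback:
  assumes t: "tensor2 m W \<tau>" and W: "eopen m W" and U: "eopen n U"
    and u: "C_inf n U u" "u ` U \<subseteq> W"
  shows "tensor2 n U (\<lambda>r v w. \<tau> (u r) (Der U u r v) (Der U u r w))"
  unfolding tensor2_def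
proof (intro conjI ballI allI)
  have um: "u ` U \<subseteq> euclid m" using u(2) eopen_subset[OF W] by blast
  fix r x v w a b assume *: "r \<in> U" "x \<in> euclid n" "v \<in> euclid n" "w \<in> euclid n"
  have "Der U u r (a *\<^sub>R x + b *\<^sub>R v) = a *\<^sub>R Der U u r x + b *\<^sub>R Der U u r v"
    using linear_Der[OF u(1) *(1)] by (simp add: linear_add linear_scale)
  moreover have "u r \<in> W" using u(2) * by blast
  ultimately show "\<tau> (u r) (Der U u r (a *\<^sub>R x + b *\<^sub>R v)) (Der U u r w) =
      a * \<tau> (u r) (Der U u r x) (Der U u r w) + b * \<tau> (u r) (Der U u r v) (Der U u r w)"
    "\<tau> (u r) (Der U u r w) (Der U u r (a *\<^sub>R x + b *\<^sub>R v)) =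
      a * \<tau> (u r) (Der U u r w) (Der U u r x) + b * \<tau> (u r) (Der U u r w) (Der U u r v)"
    using * by (simp_all add: tensor2_linear[OF t] C_inf_Der_euclid[OF U u(1) um])
next
  fix v w assume *: "v \<in> euclid n" "w \<in> euclid n"
  have um: "u ` U \<subseteq> euclid m" using u(2) eopen_subset[OF W] by blast
  show "C_inf n U (\<lambda>r. \<tau> (u r) (Der U u r v) (Der U u r w))"
    by (rule C_inf_tensor2[OF t W U u C_inf_Der[OF U u(1) *(1)] _ C_inf_Der[OF U u(1) *(2)]])
      (use C_inf_Der_euclid[OF U u(1) um] * in auto)
qed

text \<open>The condition imposed by \<open>weak_metric\<close> on each plot, bundled so that gluing
  and pull-back are proved once.\<close>

definition psd_tensor :: "nat \<Rightarrow> rvec set \<Rightarrow> (rvec \<Rightarrow> rvec \<Rightarrow> rvec \<Rightarrow> real) \<Rightarrow> bool" where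
  "psd_tensor n U \<tau> \<longleftrightarrow> symmetric_tensor n U \<tau> \<and> positive_tensor n U \<tau>"

text \<open>The local models may differ from \<tau> off R^n and may vary with the point: they come
  from different lifts or charts.\<close>

lemma psd_tensor_local:
  assumes U: "eopen n U"
    and loc: "\<And>r. r \<in> U \<Longrightarrow> \<exists>V \<tau>'. eopen n V \<and> r \<in> V \<and> V \<subseteq> U \<and> psd_tensor n V \<tau>' \<and>
      (\<forall>z\<in>V. \<forall>v\<in>euclid n. \<forall>w\<in>euclid n. \<tau> z v w = \<tau>' z v w)"
  shows "psd_tensor n U \<tau>"
proof -
  have "tensor2 n U \<tau>"
  proof (rule tensor2_local[OF U])
    fix r assume "r \<in> U"
    from loc[OF this] obtain V \<tau>' where V: "eopen n V" "r \<in> V" "V \<subseteq> U" "psd_tensor n V \<tau>'"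
        "\<forall>z\<in>V. \<forall>v\<in>euclid n. \<forall>w\<in>euclid n. \<tau> z v w = \<tau>' z v w"
      by blast
    have "tensor2 n V \<tau>'" using V(4) by (simp add: psd_tensor_def symmetric_tensor_def)
    then have "tensor2 n V \<tau>" by (rule tensor2_cong[OF V(1)]) (simp add: V(5))
    then show "\<exists>V. eopen n V \<and> r \<in> V \<and> V \<subseteq> U \<and> tensor2 n V \<tau>"
      using V(1-3) by blast
  qed
  moreover have "\<tau> r v w = \<tau> r w v" "\<tau> r v v \<ge> 0"
    if "r \<in> U" "v \<in> euclid n" "w \<in> euclid n" for r v w
    using loc[OF that(1)] that(2,3)
    unfolding psd_tensor_def symmetric_tensor_def positive_tensor_def by metis+
  ultimately show ?thesis
    unfolding psd_tensor_def symmetric_tensor_def positive_tensor_def by blast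
qed

lemma psd_tensor_pullback:
  assumes t: "psd_tensor m W \<tau>" and W: "eopen m W" and U: "eopen n U"
    and u: "C_inf n U u" "u ` U \<subseteq> W"
  shows "psd_tensor n U (\<lambda>r v w. \<tau> (u r) (Der U u r v) (Der U u r w))"
proof -
  have um: "u ` U \<subseteq> euclid m" using u(2) eopen_subset[OF W] by blast
  show ?thesis
    using t tensor2_pullback[OF _ W U u, of \<tau>] C_inf_Der_euclid[OF U u(1) um] u(2)
    unfolding psd_tensor_def symmetric_tensor_def positive_tensor_def
    by (auto simp: image_subset_iff)
qed

lemma riemannian_on_psd: "riemannian_on n U \<tau> \<Longrightarrow> psd_tensor n U \<tau>"
  unfolding riemannian_on_def psd_tensor_def positive_tensor_def
proof (intro conjI ballI)
  fix r v assume *: "symmetric_tensor n U \<tau> \<and> (\<forall>r\<in>U. \<forall>v\<in>euclid n. v \<noteq> 0 \<longrightarrow> 0 < \<tau> r v v)"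
    "r \<in> U" "v \<in> euclid n"
  \<comment> \<open>Definiteness says nothing about \<open>v = 0\<close>; there the value is 0 by
    linearity.\<close>
  then have "\<tau> r (0 *\<^sub>R v + 0 *\<^sub>R v) v = 0 * \<tau> r v v + 0 * \<tau> r v v"
    unfolding symmetric_tensor_def by (intro tensor2_linear(1)) auto
  then have "\<tau> r 0 v = 0" by simp
  then show "\<tau> r v v \<ge> 0" using * by (cases "v = 0") (auto intro: less_imp_le)
qed blast

section \<open>Metrics on diffeological spaces and manifolds\<close>

lemma plots_T2_coproductD:
  assumes "(m, W, c) \<in> plots (T2_coproduct X)" "z \<in> W"
  shows "\<exists>W' n U p f a b. eopen m W' \<and> z \<in> W' \<and> W' \<subseteq> W \<and> (n, U, p) \<in> plots X \<and>
     C_inf m W' f \<and> C_inf m W' a \<and> C_inf m W' b \<and>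
     f ` W' \<subseteq> U \<and> a ` W' \<subseteq> euclid n \<and> b ` W' \<subseteq> euclid n \<and>
     (\<forall>y\<in>W'. c y = ((n, U, p), f y, a y, b y))"
  using assms by (simp add: T2_coproduct_def)

text \<open>A plot of \<open>T2 X\<close> lifts locally to the coproduct, where it is a fixed plot p
  with smooth base point and vectors. Along it \<open>g\<close> is the tensor p^*g evaluated at
  smooth arguments, hence smooth.\<close>

lemma weak_metricI:
  assumes X: "diffeological X"
    and psd: "\<And>n U p. (n, U, p) \<in> plots X \<Longrightarrow> psd_tensor n U (pull_plot X (n, U, p) g)"
  shows "weak_metric X g"
  unfolding weak_metric_def
proof (intro conjI)
  show "\<forall>(n, U, p)\<in>plots X. symmetric_tensor n U (pull_plot X (n, U, p) g) \<and>
      positive_tensor n U (pull_plot X (n, U, p) g)"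
    using psd by (auto simp: psd_tensor_def)
  show "dsmooth (T2 X) real_line g"
  proof (rule dsmoothI)
    fix k W c assume c: "(k, W, c) \<in> plots (T2 X)"
    then have W: "eopen k W" by (simp add: T2_def plots_quotient_by)
    have "C_inf k W (g \<circ> c)"
    proof (rule C_inf_local[OF W])
      fix z assume "z \<in> W"
      then obtain V q where V: "eopen k V" "z \<in> V" "V \<subseteq> W" "(k, V, q) \<in> plots (T2_coproduct X)"
          "\<forall>y\<in>V. c y = (case q y of (P, r, v, w) \<Rightarrow> T2_class X P r v w)"
        using c unfolding T2_def plots_quotient_by by blast
      then obtain W' n U p f a b where *: "eopen k W'" "z \<in> W'" "W' \<subseteq> V" "(n, U, p) \<in> plots X"
          "C_inf k W' f" "C_inf k W' a" "C_inf k W' b"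
          "f ` W' \<subseteq> U" "a ` W' \<subseteq> euclid n" "b ` W' \<subseteq> euclid n"
          "\<forall>y\<in>W'. q y = ((n, U, p), f y, a y, b y)"
        using plots_T2_coproductD[OF V(4,2)] by (elim exE conjE) (rule that)
      have "tensor2 n U (pull_plot X (n, U, p) g)"
        using psd[OF *(4)] by (simp add: psd_tensor_def symmetric_tensor_def)
      then have "C_inf k W' (\<lambda>y. pull_plot X (n, U, p) g (f y) (a y) (b y))"
        by (rule C_inf_tensor2[OF _ plot_domain(1)[OF X *(4)] *(1,5,8,6,9,7,10)])
      then have "C_inf k W' (g \<circ> c)"
        by (rule C_inf_cong) (use V(5) *(3,11) in \<open>auto simp: pull_plot_def subset_eq\<close>)
      then show "\<exists>V. eopen k V \<and> z \<in> V \<and> V \<subseteq> W \<and> C_inf k V (g \<circ> c)"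
        using *(1-3) V(3) by blast
    qed
    then show "(k, W, g \<circ> c) \<in> plots real_line"
      using W by (simp add: real_line_def)
  qed (simp add: real_line_def)
qed

section \<open>Pull-backs of Riemannian metrics\<close>

lemma pull_plot_restrict:
  assumes "diffeological X" "(n, U, p) \<in> plots X" "eopen n V" "V \<subseteq> U" "r \<in> V"
    "v \<in> euclid n" "w \<in> euclid n"
  shows "pull_plot X (n, V, p) g r v w = pull_plot X (n, U, p) g r v w"
  unfolding pull_plot_def using T2_class_restrict[OF assms] by simp

lemma pull_plot_pull_map:
  assumes "dsmooth X Y f"
  shows "pull_plot X (n, U, p) (pull_map Y f g) = pull_plot Y (n, U, f \<circ> p) g"
  by (intro ext) (simp add: pull_plot_def pull_map_def T2_map_class[OF assms])

text \<open>A plot locally factors through a chart by some smooth \<open>u\<close>, so its tensor is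
  a pull-back by \<open>u\<close> of the chart tensor. As \<open>u\<close> may have a kernel, only
  semi-definiteness survives.\<close>

lemma riemannian_manifold_psd:
  assumes g: "riemannian_manifold X g" and p: "(n, U, p) \<in> plots X"
  shows "psd_tensor n U (pull_plot X (n, U, p) g)"
proof -
  obtain m where X: "manifold m X" using g by (auto simp: riemannian_manifold_def)
  then have Xd: "diffeological X" by (simp add: manifold_def)
  have U: "eopen n U" using plot_domain(1)[OF Xd p] .
  show ?thesis
  proof (rule psd_tensor_local[OF U])
    fix r assume "r \<in> U"
    then obtain U' V \<phi> u where *: "eopen n U'" "r \<in> U'" "U' \<subseteq> U" "chart m X V \<phi>"
        "C_inf n U' u" "u ` U' \<subseteq> V" "\<forall>z\<in>U'. p z = \<phi> (u z)"
      using manifold_plots[OF X U, of p] p by blast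
    let ?\<tau> = "pull_plot X (m, V, \<phi>) g"
    have V: "eopen m V" using plot_domain(1)[OF Xd chartD(1)[OF *(4)]] .
    have "riemannian_on m V ?\<tau>"
      using g *(4) by (auto simp: riemannian_manifold_def)
    then have "psd_tensor n U' (\<lambda>r v w. ?\<tau> (u r) (Der U' u r v) (Der U' u r w))"
      by (rule psd_tensor_pullback[OF riemannian_on_psd V *(1,5,6)])
    moreover have "pull_plot X (n, U, p) g z v w = ?\<tau> (u z) (Der U' u z v) (Der U' u z w)"
      if "z \<in> U'" "v \<in> euclid n" "w \<in> euclid n" for z v w
      using T2_class_compose[OF plot_restrict[OF Xd p *(1,3)] chartD(1)[OF *(4)] *(5,6) _ that] *(7)
        T2_class_restrict[OF Xd p *(1,3) that]
      by (simp add: pull_plot_def)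
    ultimately show "\<exists>V \<tau>'. eopen n V \<and> r \<in> V \<and> V \<subseteq> U \<and> psd_tensor n V \<tau>' \<and>
        (\<forall>z\<in>V. \<forall>v\<in>euclid n. \<forall>w\<in>euclid n. pull_plot X (n, U, p) g z v w = \<tau>' z v w)"
      using *(1-3) by blast
  qed
qed

text \<open>
  Restricted to small domains, a chart of \<open>X\<close> followed by the local diffeomorphism is a chart
  of \<open>Y\<close>, so definiteness needs no computation with differentials.
\<close>

lemma riemannian_manifold_local_diffeo:
  assumes X: "diffeological X" and f: "local_diffeo X Y f" and g: "riemannian_manifold Y g"
  shows "riemannian_manifold X (pull_map Y f g)"
  unfolding riemannian_manifold_def
proof (intro conjI allI impI)
  obtain m where Y: "manifold m Y" using g by (auto simp: riemannian_manifold_def)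
  then have Yd: "diffeological Y" by (simp add: manifold_def)
  show "\<exists>n. manifold n X" using manifold_local_diffeo[OF X Y f] ..
  have fs: "dsmooth X Y f" using f by (simp add: local_diffeo_def)
  fix n V \<phi> assume c: "chart n X V \<phi>"
  note p = chartD(1)[OF c]
  note pY = dsmooth_plot[OF fs p]
  let ?\<tau> = "pull_plot Y (n, V, f \<circ> \<phi>) g"
  \<comment> \<open>On all of \<open>V\<close> the map \<open>f \<circ> \<phi>\<close> may fail to
    be injective, so it is a chart of \<open>Y\<close> only on pieces that \<phi> maps into the
    domain of a local inverse.\<close>
  have "\<exists>V'. eopen n V' \<and> r \<in> V' \<and> V' \<subseteq> V \<and> riemannian_on n V' (pull_plot Y (n, V', f \<circ> \<phi>) g)"
    if r: "r \<in> V" for r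
  proof -
    have "\<phi> r \<in> points X" using plot_domain(2)[OF X p] r by blast
    then obtain B A \<sigma> where d: "\<phi> r \<in> B" "open_diffeo X Y B A f \<sigma>"
      by (rule local_diffeoE[OF f])
    then have B: "dopen X B" by (simp add: open_diffeo_def)
    let ?V = "{z \<in> V. \<phi> z \<in> B}"
    have "chart n X ?V \<phi>"
      by (rule chart_restrict[OF X c dopen_plot[OF B p]]) auto
    then have "chart n Y ?V (f \<circ> \<phi>)"
      by (rule chart_open_diffeo[OF Yd d(2)]) auto
    then have "riemannian_on n ?V (pull_plot Y (n, ?V, f \<circ> \<phi>) g)"
      using g by (auto simp: riemannian_manifold_def)
    then show ?thesis using dopen_plot[OF B p] r d(1) by blast
  qed
  then have loc: "\<exists>V'. eopen n V' \<and> r \<in> V' \<and> V' \<subseteq> V \<and> riemannian_on n V' (pull_plot Y (n, V', f \<circ> \<phi>) g) \<and>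
      (\<forall>z\<in>V'. \<forall>v\<in>euclid n. \<forall>w\<in>euclid n. ?\<tau> z v w = pull_plot Y (n, V', f \<circ> \<phi>) g z v w)" if "r \<in> V" for r
    using that pull_plot_restrict[OF Yd pY] by metis
  have "psd_tensor n V ?\<tau>"
    by (rule riemannian_manifold_psd[OF g pY])
  moreover have "?\<tau> r v v > 0" if "r \<in> V" "v \<in> euclid n" "v \<noteq> 0" for r v
    using loc[OF that(1)] that(2,3) unfolding riemannian_on_def by metis
  ultimately show "riemannian_on n V (pull_plot X (n, V, \<phi>) (pull_map Y f g))"
    unfolding pull_plot_pull_map[OF fs] riemannian_on_def psd_tensor_def by blast
qed

section \<open>Etale Lie groupoids\<close>

lemma dsmooth_pair:
  "dsmooth X Y f \<Longrightarrow> dsmooth X Z g \<Longrightarrow> dsmooth X (product Y Z) (\<lambda>x. (f x, g x))"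
  by (rule dsmoothI)
    (auto simp: points_product plots_product comp_def intro: dsmooth_point dsmooth_plot[unfolded comp_def])

lemma dsmooth_into_sub_dspace:
  assumes X: "diffeological X" and f: "dsmooth X Y f" "\<And>x. x \<in> points X \<Longrightarrow> f x \<in> A"
  shows "dsmooth X (sub_dspace Y A) f"
proof (rule dsmoothI)
  fix n U p assume p: "(n, U, p) \<in> plots X"
  then show "(n, U, f \<circ> p) \<in> plots (sub_dspace Y A)"
    using dsmooth_plot[OF f(1) p] plot_domain(2)[OF X p] f(2) by (auto simp: plots_sub_dspace)
qed (auto simp: points_sub_dspace f(2) dsmooth_point[OF f(1)])

locale etale_lie_groupoid =
  fixes G :: "('g, 'm) groupoid" and m :: nat
  assumes lie: "lie_groupoid m m G"
begin

lemma manifold_base: "manifold m (base G)"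
  and manifold_arrows: "manifold m (arrows G)"
  and dsmooth_idn: "dsmooth (base G) (arrows G) (idn G)"
  and dsmooth_ginv: "dsmooth (arrows G) (arrows G) (ginv G)"
  and dsmooth_gmult: "dsmooth (composable G) (arrows G) (\<lambda>(h, k). gmult G h k)"
  using lie unfolding lie_groupoid_def by blast+

lemma diffeological_base: "diffeological (base G)"
  and diffeological_arrows: "diffeological (arrows G)"
  using manifold_base manifold_arrows by (simp_all add: manifold_def)

lemma local_diffeo_src: "local_diffeo (arrows G) (base G) (src G)"
  and local_diffeo_tgt: "local_diffeo (arrows G) (base G) (tgt G)"
  using lie unfolding lie_groupoid_def
  by (blast intro: submersion_local_diffeo[OF manifold_arrows manifold_base])+

lemma dsmooth_src: "dsmooth (arrows G) (base G) (src G)"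
  and dsmooth_tgt: "dsmooth (arrows G) (base G) (tgt G)"
  using local_diffeo_src local_diffeo_tgt by (simp_all add: local_diffeo_def)

lemma laws: "groupoid_laws G"
  using lie by (simp add: lie_groupoid_def)

section \<open>Groupoid laws, orbits and local sections\<close>

lemma points_composable:
  "(h, k) \<in> points (composable G) \<longleftrightarrow>
     h \<in> points (arrows G) \<and> k \<in> points (arrows G) \<and> src G h = tgt G k"
  by (auto simp: composable_def points_sub_dspace points_product)

lemma idn_laws:
  assumes "x \<in> points (base G)"
  shows "idn G x \<in> points (arrows G)" "src G (idn G x) = x" "tgt G (idn G x) = x"
  using laws assms unfolding groupoid_laws_def by blast+

lemma ginv_laws:
  assumes "h \<in> points (arrows G)"
  shows "ginv G h \<in> points (arrows G)" "src G (ginv G h) = tgt G h" "tgt G (ginv G h) = src G h"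
  using laws assms unfolding groupoid_laws_def by blast+

lemma gmult_laws:
  assumes "h \<in> points (arrows G)" "k \<in> points (arrows G)" "src G h = tgt G k"
  shows "gmult G h k \<in> points (arrows G)" "src G (gmult G h k) = src G k"
    "tgt G (gmult G h k) = tgt G h"
proof -
  have "(h, k) \<in> points (composable G)" using assms by (simp add: points_composable)
  then show "gmult G h k \<in> points (arrows G)" "src G (gmult G h k) = src G k"
    "tgt G (gmult G h k) = tgt G h"
    using laws unfolding groupoid_laws_def by blast+
qed

text \<open>Composition with \<open>h\<close> and with its inverse exchanges the arrows that leave
  the two ends of \<open>h\<close>.\<close>

lemma orbit_map_src_tgt:
  assumes h: "h \<in> points (arrows G)"
  shows "orbit_map G (src G h) = orbit_map G (tgt G h)"
proof
  show "orbit_map G (src G h) \<subseteq> orbit_map G (tgt G h)"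
  proof
    fix y assume "y \<in> orbit_map G (src G h)"
    then obtain k where k: "k \<in> points (arrows G)" "src G k = src G h" "y = tgt G k"
      by (auto simp: orbit_map_def)
    have *: "src G k = tgt G (ginv G h)" using k(2) ginv_laws[OF h] by simp
    show "y \<in> orbit_map G (tgt G h)"
      unfolding orbit_map_def
      using gmult_laws[OF k(1) ginv_laws(1)[OF h] *] ginv_laws(2)[OF h] k(3)
      by (intro image_eqI[of _ _ "gmult G k (ginv G h)"]) auto
  qed
  show "orbit_map G (tgt G h) \<subseteq> orbit_map G (src G h)"
  proof
    fix y assume "y \<in> orbit_map G (tgt G h)"
    then obtain k where k: "k \<in> points (arrows G)" "src G k = tgt G h" "y = tgt G k"
      by (auto simp: orbit_map_def)
    show "y \<in> orbit_map G (src G h)"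
      unfolding orbit_map_def using gmult_laws[OF k(1) h k(2)] k(3)
      by (intro image_eqI[of _ _ "gmult G k h"]) auto
  qed
qed

lemma orbit_map_eqD:
  assumes "y \<in> points (base G)" "orbit_map G x = orbit_map G y"
  obtains h where "h \<in> points (arrows G)" "src G h = x" "tgt G h = y"
proof -
  have "y \<in> orbit_map G y"
    unfolding orbit_map_def using idn_laws[OF assms(1)]
    by (intro image_eqI[of _ _ "idn G y"]) auto
  then have "y \<in> orbit_map G x" using assms(2) by simp
  then show thesis using that unfolding orbit_map_def by blast
qed

lemma diffeological_orbit_space: "diffeological (orbit_space G)"
  unfolding orbit_space_def by (rule diffeological_quotient_by[OF diffeological_base])

lemma dsmooth_orbit_map: "dsmooth (base G) (orbit_space G) (orbit_map G)"
  unfolding orbit_space_def by (rule dsmooth_quotient_by[OF diffeological_base])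

lemma local_section_exists:
  assumes "h \<in> points (arrows G)"
  obtains A \<sigma> where "local_section G h A \<sigma>"
proof -
  obtain B A \<sigma> where "h \<in> B" "open_diffeo (arrows G) (base G) B A (src G) \<sigma>"
    by (rule local_diffeoE[OF local_diffeo_src assms])
  then have "local_section G h A \<sigma>"
    by (auto simp: open_diffeo_def local_section_def)
  then show thesis by (rule that)
qed

text \<open>Each point moves along an arrow and stays in its orbit, so the pushed plot is another
  lift of the same plot of the orbit space.\<close>

lemma section_plot:
  assumes "local_section G h A \<sigma>" and p: "(n, U, p) \<in> plots (sub_dspace (base G) A)"
  shows "(n, U, tgt G \<circ> \<sigma> \<circ> p) \<in> plots (base G)"
    and "z \<in> U \<Longrightarrow> orbit_map G (tgt G (\<sigma> (p z))) = orbit_map G (p z)"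
proof -
  have "dsmooth (sub_dspace (base G) A) (arrows G) \<sigma>" and src: "\<And>x. x \<in> A \<Longrightarrow> src G (\<sigma> x) = x"
    using assms(1) by (auto simp: local_section_def)
  then have \<sigma>p: "(n, U, \<sigma> \<circ> p) \<in> plots (arrows G)"
    using p by (blast intro: dsmooth_plot)
  then show "(n, U, tgt G \<circ> \<sigma> \<circ> p) \<in> plots (base G)"
    unfolding comp_assoc by (rule dsmooth_plot[OF dsmooth_tgt])
  assume z: "z \<in> U"
  then have "\<sigma> (p z) \<in> points (arrows G)"
    using plot_domain(2)[OF diffeological_arrows \<sigma>p] by auto
  moreover have "p z \<in> A" using p z by (auto simp: plots_sub_dspace)
  ultimately show "orbit_map G (tgt G (\<sigma> (p z))) = orbit_map G (p z)"
    using orbit_map_src_tgt[of "\<sigma> (p z)"] src by simp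
qed

section \<open>Descent of 0-metrics\<close>

text \<open>The starting point \<open>q r\<close> is left free within the orbit. Two lifts at
  \<open>r\<close> need not share a germ until an arrow has moved one starting point to the
  other.\<close>

definition orbit_lift :: "nat \<Rightarrow> rvec set \<Rightarrow> (rvec \<Rightarrow> 'm set) \<Rightarrow> rvec \<Rightarrow> rvec set \<Rightarrow> (rvec \<Rightarrow> 'm) \<Rightarrow> bool"
  where "orbit_lift n U p r V q \<longleftrightarrow> eopen n V \<and> r \<in> V \<and> V \<subseteq> U \<and> (n, V, q) \<in> plots (base G) \<and>
    (\<forall>z\<in>V. orbit_map G (q z) = p z)"

lemma orbit_lift_exists:
  assumes "(n, U, p) \<in> plots (orbit_space G)" "r \<in> U"
  obtains V q where "orbit_lift n U p r V q"
proof -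
  from assms(1)[unfolded orbit_space_def plots_quotient_by, THEN conjunct2, rule_format, OF assms(2)]
  obtain V q where V: "eopen n V" "r \<in> V" "V \<subseteq> U" "(n, V, q) \<in> plots (base G)"
      and pq: "\<forall>z\<in>V. p z = orbit_map G (q z)"
    by (elim exE conjE) (rule that)
  have "orbit_lift n U p r V q"
    unfolding orbit_lift_def using V pq by simp
  then show thesis by (rule that)
qed

lemma orbit_lift_germ:
  assumes et: "diff_etale (base G) (orbit_space G) (orbit_map G)"
    and p: "(n, U, p) \<in> plots (orbit_space G)"
    and q: "orbit_lift n U p r V q" and q': "orbit_lift n U p r V' q'" and eq: "q r = q' r"
  obtains W where "eopen n W" "r \<in> W" "W \<subseteq> V" "W \<subseteq> V'" "\<And>z. z \<in> W \<Longrightarrow> q z = q' z"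
proof -
  have r: "(n, U, p) \<in> plots (orbit_space G) \<and> r \<in> U \<and> q r \<in> points (base G) \<and> p r = orbit_map G (q r)"
    using p q plot_domain(2)[OF diffeological_base, of n V q] by (auto simp: orbit_lift_def)
  have "\<exists>W. eopen n W \<and> r \<in> W \<and> W \<subseteq> V \<inter> V' \<and> (\<forall>z\<in>W. q z = q' z)"
    by (rule et[unfolded diff_etale_def Let_def, THEN conjunct2, THEN spec, THEN spec, THEN spec,
          THEN spec, THEN spec, THEN mp, OF r, THEN conjunct2, THEN spec, THEN spec, THEN spec,
          THEN spec, THEN mp])
      (use q q' eq in \<open>auto simp only: orbit_lift_def\<close>)
  then show thesis using that by blast
qed

lemma zero_metric_lift_unique:
  assumes et: "diff_etale (base G) (orbit_space G) (orbit_map G)" and \<eta>: "zero_metric G \<eta>"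
    and p: "(n, U, p) \<in> plots (orbit_space G)"
    and q: "orbit_lift n U p r V q" and q': "orbit_lift n U p r V' q'"
    and vw: "v \<in> euclid n" "w \<in> euclid n"
  shows "\<eta> (T2_class (base G) (n, V, q) r v w) = \<eta> (T2_class (base G) (n, V', q') r v w)"
proof -
  note X = diffeological_base
  have qD: "eopen n V" "r \<in> V" "V \<subseteq> U" "(n, V, q) \<in> plots (base G)"
      "\<And>z. z \<in> V \<Longrightarrow> orbit_map G (q z) = p z"
    using q by (auto simp: orbit_lift_def)
  have q'D: "eopen n V'" "r \<in> V'" "V' \<subseteq> U" "(n, V', q') \<in> plots (base G)"
      "\<And>z. z \<in> V' \<Longrightarrow> orbit_map G (q' z) = p z"
    using q' by (auto simp: orbit_lift_def)
  have "q' r \<in> points (base G)" using plot_domain(2)[OF X q'D(4)] q'D(2) by blast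
  moreover have "orbit_map G (q r) = orbit_map G (q' r)" using qD(2,5) q'D(2,5) by simp
  ultimately obtain h where h: "h \<in> points (arrows G)" "src G h = q r" "tgt G h = q' r"
    by (rule orbit_map_eqD)
  obtain A \<sigma> where s: "local_section G h A \<sigma>" by (rule local_section_exists[OF h(1)])
  then have A: "dopen (base G) A" "src G h \<in> A" "\<sigma> (src G h) = h"
    by (auto simp: local_section_def)
  \<comment> \<open>The section exists on \<open>A\<close> only, so the lift is cut down to the part
    that it maps into \<open>A\<close>.\<close>
  let ?V = "{z \<in> V. q z \<in> A}" and ?q = "tgt G \<circ> \<sigma> \<circ> q"
  have V: "eopen n ?V" "r \<in> ?V" using dopen_plot[OF A(1) qD(4)] qD(2) A(2) h(2) by auto
  have qA: "(n, ?V, q) \<in> plots (sub_dspace (base G) A)"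
    by (rule plot_restrict_dopen[OF X A(1) qD(4)])
  note q1 = section_plot[OF s qA]
  have lift: "orbit_lift n U p r ?V ?q"
    using V q1 qD(3,5) by (auto simp: orbit_lift_def)
  have "?q r = q' r" using A(3) h by simp
  then obtain W where W: "eopen n W" "r \<in> W" "W \<subseteq> ?V" "W \<subseteq> V'" "\<And>z. z \<in> W \<Longrightarrow> ?q z = q' z"
    by (rule orbit_lift_germ[OF et p lift q']) (rule that)
  have act: "arrow_act G h (T2_class (base G) (n, ?V, q) r v w) (T2_class (base G) (n, ?V, ?q) r v w)"
    by (rule arrow_act.intros[OF h(1) s qA V(2) h(2)[symmetric] vw])
  have "\<eta> (T2_class (base G) (n, V, q) r v w) = \<eta> (T2_class (base G) (n, ?V, q) r v w)"
    using T2_class_restrict[OF X qD(4) V(1) _ V(2) vw] by auto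
  also have "\<dots> = \<eta> (T2_class (base G) (n, ?V, ?q) r v w)"
    using \<eta>[unfolded zero_metric_def, THEN conjunct2, rule_format, OF act] by (rule sym)
  also have "T2_class (base G) (n, ?V, ?q) r v w = T2_class (base G) (n, V', q') r v w"
    by (rule T2_class_cong[OF X q1(1) q'D(4) W(1,3,4,2) vw W(5)])
  finally show ?thesis .
qed

text \<open>A relation, because the value might still depend on the lift. Dependence on the lift and
  dependence on the representative of a class in \<open>T2\<close> are thereby removed
  separately.\<close>

definition lift_value :: "('m T2pre set \<Rightarrow> real) \<Rightarrow> 'm set T2pre \<Rightarrow> real \<Rightarrow> bool" where
  "lift_value \<eta> e y \<longleftrightarrow> (\<exists>n U p r v w V q. e = ((n, U, p), r, v, w) \<and> orbit_lift n U p r V q \<and>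
     y = \<eta> (T2_class (base G) (n, V, q) r v w))"

definition the_lift_value :: "('m T2pre set \<Rightarrow> real) \<Rightarrow> 'm set T2pre \<Rightarrow> real" where
  "the_lift_value \<eta> e = (THE y. lift_value \<eta> e y)"

definition descend :: "('m T2pre set \<Rightarrow> real) \<Rightarrow> 'm set T2pre set \<Rightarrow> real" where
  "descend \<eta> c = the_lift_value \<eta> (SOME e. e \<in> c)"

context
  fixes \<eta>
  assumes et: "diff_etale (base G) (orbit_space G) (orbit_map G)" and \<eta>: "zero_metric G \<eta>"
begin

lemma the_lift_value_eq:
  assumes "(n, U, p) \<in> plots (orbit_space G)" "v \<in> euclid n" "w \<in> euclid n"
    and "orbit_lift n U p r V q"
  shows "the_lift_value \<eta> ((n, U, p), r, v, w) = \<eta> (T2_class (base G) (n, V, q) r v w)"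
  unfolding the_lift_value_def
proof (rule the_equality)
  show "lift_value \<eta> ((n, U, p), r, v, w) (\<eta> (T2_class (base G) (n, V, q) r v w))"
    unfolding lift_value_def using assms(4) by blast
  fix y assume "lift_value \<eta> ((n, U, p), r, v, w) y"
  then obtain V' q' where "orbit_lift n U p r V' q'" "y = \<eta> (T2_class (base G) (n, V', q') r v w)"
    unfolding lift_value_def by blast
  then show "y = \<eta> (T2_class (base G) (n, V, q) r v w)"
    using zero_metric_lift_unique[OF et \<eta> assms(1) _ assms(4,2,3)] by simp
qed

text \<open>If \<open>l\<close> lifts \<open>q\<close> near \<open>f r\<close>, then
  \<open>l \<circ> f\<close> lifts \<open>p\<close> near \<open>r\<close>, and the two classes in
  \<open>T2 (base G)\<close> are identified by the same \<open>f\<close>. Independence of the lift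
  permits computing with this pair.\<close>

lemma the_lift_value_step:
  assumes "T2_step (orbit_space G) a b"
  shows "the_lift_value \<eta> a = the_lift_value \<eta> b"
  using assms
proof cases
  case (1 n U p k W q f r v w)
  note X = diffeological_base
  have U: "eopen n U" and W: "eopen k W"
    using plot_domain(1)[OF diffeological_orbit_space] 1 by blast+
  have "f r \<in> W" using 1 by blast
  then obtain V l where l: "orbit_lift k W q (f r) V l"
    by (rule orbit_lift_exists[OF 1(4)])
  then have lD: "eopen k V" "f r \<in> V" "V \<subseteq> W" "(k, V, l) \<in> plots (base G)"
      "\<And>z. z \<in> V \<Longrightarrow> orbit_map G (l z) = q z"
    by (auto simp: orbit_lift_def)
  have fk: "f ` U \<subseteq> euclid k" using 1(6) eopen_subset[OF W] by blast
  let ?V = "{z \<in> U. f z \<in> V}"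
  have V: "eopen n ?V" by (rule eopen_preimage[OF U C_inf_continuous_on[OF 1(5)] fk lD(1)])
  have r: "r \<in> ?V" using 1 lD(2) by simp
  have f: "C_inf n ?V f" "f ` ?V \<subseteq> V" using C_inf_restrict[OF 1(5), of ?V] by auto
  have lf: "(n, ?V, l \<circ> f) \<in> plots (base G)"
    by (rule plot_compose[OF X lD(4) V f])
  have "orbit_lift n U p r ?V (l \<circ> f)"
    using V r lf lD(5) 1(7) by (auto simp: orbit_lift_def)
  then have "the_lift_value \<eta> a = \<eta> (T2_class (base G) (n, ?V, l \<circ> f) r v w)"
    unfolding 1(1) by (rule the_lift_value_eq[OF 1(3,9,10)])
  also have "T2_class (base G) (n, ?V, l \<circ> f) r v w =
      T2_class (base G) (k, V, l) (f r) (Der ?V f r v) (Der ?V f r w)"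
    by (rule T2_class_compose[OF lf lD(4) f _ r 1(9,10)]) simp
  also have "Der ?V f r = Der U f r"
    by (rule Der_restrict[OF U V _ r]) auto
  also have "\<eta> (T2_class (base G) (k, V, l) (f r) (Der U f r v) (Der U f r w)) = the_lift_value \<eta> b"
    unfolding 1(2) using C_inf_Der_euclid[OF U 1(5) fk 1(8)] 1(9,10)
    by (intro the_lift_value_eq[OF 1(4) _ _ l, symmetric])
  finally show ?thesis .
qed

lemma descend_T2_class:
  assumes p: "(n, U, p) \<in> plots (orbit_space G)" and vw: "v \<in> euclid n" "w \<in> euclid n"
    and q: "orbit_lift n U p r V q"
  shows "descend \<eta> (T2_class (orbit_space G) (n, U, p) r v w) = \<eta> (T2_class (base G) (n, V, q) r v w)"
proof -
  let ?e = "((n, U, p), r, v, w)" and ?c = "T2_class (orbit_space G) (n, U, p) r v w"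
  have "the_lift_value \<eta> ?e = the_lift_value \<eta> e" if "equivclp (T2_step (orbit_space G)) ?e e" for e
    using that
  proof (induction rule: equivclp_induct)
    case (step y z)
    then show ?case using the_lift_value_step by metis
  qed simp
  moreover have "(SOME e. e \<in> ?c) \<in> ?c"
    by (rule someI[of _ ?e]) (simp add: T2_class_def)
  ultimately have "descend \<eta> ?c = the_lift_value \<eta> ?e"
    unfolding descend_def by (simp add: T2_class_def)
  then show ?thesis using the_lift_value_eq[OF p vw q] by simp
qed

section \<open>The descended metric: weak, inducing and definite\<close>

lemma riemannian_zero_metric: "riemannian_manifold (base G) \<eta>"
  using \<eta> by (simp add: zero_metric_def)

lemma weak_metric_descend: "weak_metric (orbit_space G) (descend \<eta>)"
proof (rule weak_metricI[OF diffeological_orbit_space])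
  fix n U p assume p: "(n, U, p) \<in> plots (orbit_space G)"
  show "psd_tensor n U (pull_plot (orbit_space G) (n, U, p) (descend \<eta>))"
  proof (rule psd_tensor_local[OF plot_domain(1)[OF diffeological_orbit_space p]])
    fix r assume "r \<in> U"
    then obtain V q where q: "orbit_lift n U p r V q" by (rule orbit_lift_exists[OF p])
    then have V: "eopen n V" "r \<in> V" "V \<subseteq> U" "(n, V, q) \<in> plots (base G)"
      by (auto simp: orbit_lift_def)
    \<comment> \<open>A lift chosen at \<open>r\<close> is also a lift at every point of its domain,
      so near \<open>r\<close> the whole tensor is the pull-back of \<eta> by the single plot
      \<open>q\<close>.\<close>
    have "orbit_lift n U p z V q" if "z \<in> V" for z
      using q that by (simp add: orbit_lift_def)
    then have "\<forall>z\<in>V. \<forall>v\<in>euclid n. \<forall>w\<in>euclid n.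
        pull_plot (orbit_space G) (n, U, p) (descend \<eta>) z v w = pull_plot (base G) (n, V, q) \<eta> z v w"
      using descend_T2_class[OF p] by (simp add: pull_plot_def)
    then show "\<exists>V \<tau>'. eopen n V \<and> r \<in> V \<and> V \<subseteq> U \<and> psd_tensor n V \<tau>' \<and>
        (\<forall>z\<in>V. \<forall>v\<in>euclid n. \<forall>w\<in>euclid n.
          pull_plot (orbit_space G) (n, U, p) (descend \<eta>) z v w = \<tau>' z v w)"
      using V riemannian_manifold_psd[OF riemannian_zero_metric V(4)] by blast
  qed
qed

lemma descend_orbit_map:
  assumes p: "(n, U, p) \<in> plots (base G)" "r \<in> U" and vw: "v \<in> euclid n" "w \<in> euclid n"
  shows "descend \<eta> (T2_class (orbit_space G) (n, U, orbit_map G \<circ> p) r v w) =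
    \<eta> (T2_class (base G) (n, U, p) r v w)"
proof (rule descend_T2_class[OF dsmooth_plot[OF dsmooth_orbit_map p(1)] vw])
  show "orbit_lift n U (orbit_map G \<circ> p) r U p"
    using p plot_domain(1)[OF diffeological_base p(1)] by (simp add: orbit_lift_def)
qed

lemma induces_descend: "induces G \<eta> (descend \<eta>)"
  unfolding induces_def
proof (intro conjI weak_metric_descend ballI)
  fix c assume "c \<in> points (T2 (base G))"
  then obtain n U p r v w where c: "(n, U, p) \<in> plots (base G)" "r \<in> U" "v \<in> euclid n" "w \<in> euclid n"
      "c = T2_class (base G) (n, U, p) r v w"
    by (rule T2_pointE)
  then show "pull_map (orbit_space G) (orbit_map G) (descend \<eta>) c = \<eta> c"
    by (simp add: pull_map_def T2_map_class[OF dsmooth_orbit_map] descend_orbit_map)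
qed

lemma definite_descend: "definite (orbit_space G) (descend \<eta>)"
  unfolding definite_def
proof (intro exI conjI)
  \<comment> \<open>The charts of M followed by the orbit map. The tensor on such a plot is \<eta>
    in that chart, hence Riemannian; the family generates because plots lift locally to M and the
    lifts factor through charts.\<close>
  let ?F = "{(n, V, orbit_map G \<circ> \<phi>) | n V \<phi>. chart n (base G) V \<phi>}"
  show "\<forall>(n, U, p)\<in>?F. riemannian_on n U (pull_plot (orbit_space G) (n, U, p) (descend \<eta>))"
  proof (clarify)
    fix n V \<phi> assume c: "chart n (base G) V \<phi>"
    note p = dsmooth_plot[OF dsmooth_orbit_map chartD(1)[OF c]]
    have "riemannian_on n V (pull_plot (base G) (n, V, \<phi>) \<eta>)"
      using riemannian_zero_metric c by (auto simp: riemannian_manifold_def)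
    moreover have "symmetric_tensor n V (pull_plot (orbit_space G) (n, V, orbit_map G \<circ> \<phi>) (descend \<eta>))"
      using weak_metric_descend p by (auto simp: weak_metric_def)
    ultimately show "riemannian_on n V (pull_plot (orbit_space G) (n, V, orbit_map G \<circ> \<phi>) (descend \<eta>))"
      using descend_orbit_map[OF chartD(1)[OF c]] by (simp add: riemannian_on_def pull_plot_def)
  qed
  show "generating (orbit_space G) ?F"
    unfolding generating_def
  proof (intro conjI)
    show "?F \<subseteq> plots (orbit_space G)"
      using dsmooth_plot[OF dsmooth_orbit_map chartD(1)] by blast
    show "\<forall>x\<in>points (orbit_space G). \<exists>(n, U, p)\<in>?F. x \<in> p ` U"
    proof
      fix x assume "x \<in> points (orbit_space G)"
      then obtain y where y: "y \<in> points (base G)" "x = orbit_map G y"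
        by (auto simp: orbit_space_def points_quotient_by)
      then obtain V \<phi> where c: "chart m (base G) V \<phi>" "y \<in> \<phi> ` V"
        using manifold_base unfolding manifold_def by blast
      then have "(m, V, orbit_map G \<circ> \<phi>) \<in> ?F" "x \<in> (orbit_map G \<circ> \<phi>) ` V"
        using y(2) by auto
      then show "\<exists>(n, U, p)\<in>?F. x \<in> p ` U" by blast
    qed
    show "\<forall>(n, U, p)\<in>plots (orbit_space G). \<forall>r\<in>U. \<exists>V. eopen n V \<and> r \<in> V \<and> V \<subseteq> U \<and>
        (\<exists>(k, W, q)\<in>?F. \<exists>f. C_inf n V f \<and> f ` V \<subseteq> W \<and> (\<forall>z\<in>V. p z = q (f z)))"
    proof (clarify)
      fix n U p r assume p: "(n, U, p) \<in> plots (orbit_space G)" "r \<in> U"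
      then obtain V q where "orbit_lift n U p r V q" by (rule orbit_lift_exists)
      then have q: "eopen n V" "r \<in> V" "V \<subseteq> U" "(n, V, q) \<in> plots (base G)"
          "\<And>z. z \<in> V \<Longrightarrow> orbit_map G (q z) = p z"
        by (auto simp: orbit_lift_def)
      then obtain V' W \<phi> f where f: "eopen n V'" "r \<in> V'" "V' \<subseteq> V" "chart m (base G) W \<phi>"
          "C_inf n V' f" "f ` V' \<subseteq> W" "\<forall>z\<in>V'. q z = \<phi> (f z)"
        using manifold_plots[OF manifold_base q(1), of q] by blast
      have "(m, W, orbit_map G \<circ> \<phi>) \<in> ?F" using f(4) by blast
      moreover have "\<forall>z\<in>V'. p z = (orbit_map G \<circ> \<phi>) (f z)"
        using q(5) f(3,7) by fastforce
      ultimately have "\<exists>(k, W, q)\<in>?F. \<exists>f. C_inf n V' f \<and> f ` V' \<subseteq> W \<and> (\<forall>z\<in>V'. p z = q (f z))"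
        using f(5,6) by (intro bexI[of _ "(m, W, orbit_map G \<circ> \<phi>)"]) auto
      then show "\<exists>V. eopen n V \<and> r \<in> V \<and> V \<subseteq> U \<and>
          (\<exists>(k, W, q)\<in>?F. \<exists>f. C_inf n V f \<and> f ` V \<subseteq> W \<and> (\<forall>z\<in>V. p z = q (f z)))"
        using f(1-3) q(3) by blast
    qed
  qed
qed

end

section \<open>The manifold of composable arrows\<close>

lemma diffeological_composable: "diffeological (composable G)"
  unfolding composable_def
  by (intro diffeological_sub_dspace diffeological_product diffeological_arrows)

lemma dsmooth_fst: "dsmooth (composable G) (arrows G) fst"
  and dsmooth_snd: "dsmooth (composable G) (arrows G) snd"
  by (rule dsmoothI; auto simp: composable_def plots_sub_dspace points_sub_dspace
      plots_product points_product)+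

lemma dsmooth_composable:
  assumes X: "diffeological X" and f: "dsmooth X (arrows G) f" and g: "dsmooth X (arrows G) g"
    and "\<And>x. x \<in> points X \<Longrightarrow> src G (f x) = tgt G (g x)"
  shows "dsmooth X (composable G) (\<lambda>x. (f x, g x))"
  unfolding composable_def
  by (rule dsmooth_into_sub_dspace[OF X dsmooth_pair[OF f g]]) (simp add: assms(4))

text \<open>Near (h, k) the second arrow is recovered from the first: a local inverse \<sigma> of
  the target map at k gives the inverse \<open>h \<mapsto> (h, \<sigma> (src G h))\<close>.\<close>

lemma local_diffeo_fst: "local_diffeo (composable G) (arrows G) fst"
  unfolding local_diffeo_def
proof (intro conjI dsmooth_fst ballI)
  fix hk assume "hk \<in> points (composable G)"
  then obtain h k where hk: "hk = (h, k)" "(h, k) \<in> points (composable G)"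
    by (cases hk) auto
  then have k: "k \<in> points (arrows G)" by (simp add: points_composable)
  obtain B A \<sigma> where k: "k \<in> B" and d: "open_diffeo (arrows G) (base G) B A (tgt G) \<sigma>"
    by (rule local_diffeoE[OF local_diffeo_tgt k])
  then have d': "dopen (arrows G) B" "dopen (base G) A" "dsmooth (sub_dspace (base G) A) (arrows G) \<sigma>"
      "tgt G ` B \<subseteq> A" "\<sigma> ` A \<subseteq> B" "\<And>x. x \<in> B \<Longrightarrow> \<sigma> (tgt G x) = x" "\<And>y. y \<in> A \<Longrightarrow> tgt G (\<sigma> y) = y"
    by (auto simp: open_diffeo_def)
  let ?B = "{hk \<in> points (composable G). snd hk \<in> B}"
  let ?A = "{h \<in> points (arrows G). src G h \<in> A}"
  let ?\<sigma> = "\<lambda>h. (h, \<sigma> (src G h))"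
  have B: "dopen (composable G) ?B"
    by (rule dopen_preimage[OF diffeological_composable dsmooth_snd d'(1)])
  have A: "dopen (arrows G) ?A"
    by (rule dopen_preimage[OF diffeological_arrows dsmooth_src d'(2)])
  have X: "diffeological (sub_dspace (arrows G) ?A)"
    by (rule diffeological_sub_dspace[OF diffeological_arrows])
  have "dsmooth (sub_dspace (arrows G) ?A) (sub_dspace (base G) A) (src G)"
    by (rule dsmooth_into_sub_dspace[OF X dsmooth_sub_dspace[OF dsmooth_src]])
      (simp add: points_sub_dspace)
  then have "dsmooth (sub_dspace (arrows G) ?A) (arrows G) (\<sigma> \<circ> src G)"
    using d'(3) by (rule dsmooth_compose)
  moreover have "dsmooth (sub_dspace (arrows G) ?A) (arrows G) (\<lambda>h. h)"
    by (rule dsmoothI) (auto simp: plots_sub_dspace points_sub_dspace comp_def)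
  ultimately have \<sigma>: "dsmooth (sub_dspace (arrows G) ?A) (composable G) ?\<sigma>"
    unfolding comp_def by (intro dsmooth_composable[OF X]) (simp_all add: points_sub_dspace d'(7))
  have \<sigma>B: "?\<sigma> h \<in> ?B" if "h \<in> ?A" for h
    using dsmooth_point[OF \<sigma>, of h] that d'(5) by (auto simp: points_sub_dspace)
  show "\<exists>B A \<sigma>. hk \<in> B \<and> open_diffeo (composable G) (arrows G) B A fst \<sigma>"
  proof (intro exI conjI)
    show "hk \<in> ?B" using hk k by simp
    show "open_diffeo (composable G) (arrows G) ?B ?A fst ?\<sigma>"
      unfolding open_diffeo_def
    proof (intro conjI B A \<sigma> dsmooth_sub_dspace[OF dsmooth_fst])
      show "fst ` ?B \<subseteq> ?A" using d'(4) by (auto simp: points_composable)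
      show "?\<sigma> ` ?A \<subseteq> ?B" using \<sigma>B by blast
      show "\<forall>x\<in>?B. ?\<sigma> (fst x) = x" using d'(6) by (auto simp: points_composable)
    qed simp
  qed
qed

text \<open>All legs end at the vertex \<open>tgt h\<close>, which makes the inverse of one leg
  composable with any other.\<close>

lemma leg_laws:
  assumes "hk \<in> points (composable G)"
  shows "leg G hk i \<in> points (arrows G)" "tgt G (leg G hk i) = tgt G (fst hk)"
proof -
  obtain h k where "hk = (h, k)" "h \<in> points (arrows G)" "k \<in> points (arrows G)" "src G h = tgt G k"
    using assms by (cases hk) (auto simp: points_composable)
  then show "leg G hk i \<in> points (arrows G)" "tgt G (leg G hk i) = tgt G (fst hk)"
    using idn_laws[of "tgt G h"] dsmooth_point[OF dsmooth_tgt] gmult_laws[of h k]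
    by (auto simp: leg_def)
qed

lemma dsmooth_leg: "dsmooth (composable G) (arrows G) (\<lambda>hk. leg G hk i)"
proof -
  have "dsmooth (composable G) (arrows G) (idn G \<circ> (tgt G \<circ> fst))"
    by (intro dsmooth_compose[OF dsmooth_compose[OF dsmooth_fst dsmooth_tgt] dsmooth_idn])
  then show ?thesis
    using dsmooth_fst dsmooth_gmult
    by (cases "i = 0"; cases "i = 1") (simp_all add: leg_def comp_def case_prod_unfold)
qed

lemma triangle_arrow_laws:
  assumes "hk \<in> points (composable G)"
  shows "triangle_arrow G hk i j \<in> points (arrows G)"
    "src G (triangle_arrow G hk i j) = src G (leg G hk j)"
    "tgt G (triangle_arrow G hk i j) = src G (leg G hk i)"
  using gmult_laws[of "ginv G (leg G hk i)" "leg G hk j"] ginv_laws[of "leg G hk i"]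
    leg_laws[OF assms] by (simp_all add: triangle_arrow_def)

lemma dsmooth_triangle_arrow: "dsmooth (composable G) (arrows G) (\<lambda>hk. triangle_arrow G hk i j)"
proof -
  have "dsmooth (composable G) (composable G) (\<lambda>hk. ((ginv G \<circ> (\<lambda>hk. leg G hk i)) hk, leg G hk j))"
    by (rule dsmooth_composable[OF diffeological_composable
          dsmooth_compose[OF dsmooth_leg dsmooth_ginv] dsmooth_leg])
      (simp add: leg_laws ginv_laws)
  from dsmooth_compose[OF this dsmooth_gmult] show ?thesis
    by (simp add: triangle_arrow_def comp_def)
qed

lemma dsmooth_S3_act: "dsmooth (composable G) (composable G) (S3_act G \<rho>)"
  unfolding S3_act_def[abs_def]
  by (rule dsmooth_composable[OF diffeological_composable dsmooth_triangle_arrow dsmooth_triangle_arrow])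
    (simp add: triangle_arrow_laws)

text \<open>The source of the new first arrow is the source of the leg with index
  \<open>\<rho> 1\<close>; every leg ends at \<open>tgt h\<close>, so all vertices share one
  orbit.\<close>

lemma orbit_map_S3_act:
  assumes "hk \<in> points (composable G)"
  shows "orbit_map G (src G (fst (S3_act G \<rho> hk))) = orbit_map G (src G (fst hk))"
proof -
  have "fst hk \<in> points (arrows G)" using assms by (cases hk) (simp add: points_composable)
  then show ?thesis
    using orbit_map_src_tgt[OF leg_laws(1)[OF assms, of "\<rho> 1"]] leg_laws(2)[OF assms, of "\<rho> 1"]
      orbit_map_src_tgt[of "fst hk"] triangle_arrow_laws[OF assms]
    by (simp add: S3_act_def)
qed

section \<open>The metric on the stack\<close>

text \<open>Moving a plot along a local section does not change its composite with the orbit map, so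
  both classes have the same image in \<open>T2 (orbit_space G)\<close>.\<close>

lemma zero_metric_pull_map:
  assumes "riemannian_manifold (base G) (pull_map (orbit_space G) (orbit_map G) g)"
  shows "zero_metric G (pull_map (orbit_space G) (orbit_map G) g)"
  unfolding zero_metric_def
proof (intro conjI assms allI impI)
  fix h c d assume "arrow_act G h c d"
  then show "pull_map (orbit_space G) (orbit_map G) g d = pull_map (orbit_space G) (orbit_map G) g c"
  proof cases
    case (1 A \<sigma> n U p r v w)
    note q = section_plot[OF 1(4,5)]
    have p: "(n, U, p) \<in> plots (base G)" using 1(5) by (simp add: plots_sub_dspace)
    have "T2_class (orbit_space G) (n, U, orbit_map G \<circ> (tgt G \<circ> \<sigma> \<circ> p)) r v w =
        T2_class (orbit_space G) (n, U, orbit_map G \<circ> p) r v w"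
      by (rule T2_class_cong[OF diffeological_orbit_space dsmooth_plot[OF dsmooth_orbit_map q(1)]
            dsmooth_plot[OF dsmooth_orbit_map p] plot_domain(1)[OF diffeological_base p] _ _ 1(6,8,9)])
        (simp_all add: q(2))
    then show ?thesis
      by (simp add: 1(1,2) pull_map_def T2_map_class[OF dsmooth_orbit_map])
  qed
qed

context
  fixes g
  assumes g: "definite_wrt (base G) (orbit_space G) (orbit_map G) g"
begin

text \<open>The index is the degree in the nerve of the groupoid: objects, arrows, composable
  pairs.\<close>

abbreviation "metric0 \<equiv> pull_map (orbit_space G) (orbit_map G) g"
abbreviation "metric1 \<equiv> pull_map (base G) (src G) metric0"
abbreviation "metric2 \<equiv> pull_map (arrows G) fst metric1"

lemma
  shows riemannian_metric0: "riemannian_manifold (base G) metric0"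
    and riemannian_metric1: "riemannian_manifold (arrows G) metric1"
    and riemannian_metric2: "riemannian_manifold (composable G) metric2"
proof -
  show 0: "riemannian_manifold (base G) metric0"
    using g by (simp add: definite_wrt_def)
  show 1: "riemannian_manifold (arrows G) metric1"
    by (rule riemannian_manifold_local_diffeo[OF diffeological_arrows local_diffeo_src 0])
  show "riemannian_manifold (composable G) metric2"
    by (rule riemannian_manifold_local_diffeo[OF diffeological_composable local_diffeo_fst 1])
qed

lemma metric2_S3_act:
  assumes c: "c \<in> points (T2 (composable G))"
  shows "pull_map (composable G) (S3_act G \<rho>) metric2 c = metric2 c"
proof -
  let ?P = "orbit_map G \<circ> (src G \<circ> fst)"
  have sf: "dsmooth (composable G) (base G) (src G \<circ> fst)"
    by (rule dsmooth_compose[OF dsmooth_fst dsmooth_src])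
  have P: "dsmooth (composable G) (orbit_space G) ?P"
    by (rule dsmooth_compose[OF sf dsmooth_orbit_map])
  have m2: "metric2 c = g (T2_map (orbit_space G) ?P c)" if "c \<in> points (T2 (composable G))" for c
    using T2_map_compose[OF dsmooth_fst dsmooth_src that] T2_map_compose[OF sf dsmooth_orbit_map that]
    by (simp add: pull_map_def)
  have "T2_map (orbit_space G) ?P (T2_map (composable G) (S3_act G \<rho>) c) =
      T2_map (orbit_space G) (?P \<circ> S3_act G \<rho>) c"
    by (rule T2_map_compose[OF dsmooth_S3_act P c])
  also have "\<dots> = T2_map (orbit_space G) ?P c"
    by (rule T2_map_cong[OF diffeological_composable diffeological_orbit_space
          dsmooth_compose[OF dsmooth_S3_act P] P _ c]) (simp add: orbit_map_S3_act)
  finally have "g (T2_map (orbit_space G) ?P (T2_map (composable G) (S3_act G \<rho>) c)) = metric2 c"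
    using m2[OF c] by simp
  then have "metric2 (T2_map (composable G) (S3_act G \<rho>) c) = metric2 c"
    using m2[OF T2_map_point[OF dsmooth_S3_act c]] by simp
  then show ?thesis by (subst pull_map_def) simp
qed

text \<open>Compatibility holds by construction, since \<open>metric2\<close> is a pull-back of
  \<open>metric1\<close>; the content is that \<open>metric1\<close> is Riemannian.\<close>

lemma pushes_forward_fst: "pushes_forward (composable G) (arrows G) fst metric2 metric1"
  using riemannian_metric1 by (simp add: pushes_forward_def pull_map_def)

lemma pushes_forward_src: "pushes_forward (arrows G) (base G) (src G) metric1 metric0"
  using riemannian_metric0 by (simp add: pushes_forward_def pull_map_def)

lemma two_metric_metric2: "two_metric G metric2"
  unfolding two_metric_def
  using riemannian_metric2 metric2_S3_act pushes_forward_fst by blast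

lemma induced_zero_metric_metric2: "induced_zero_metric G metric2 metric0"
  unfolding induced_zero_metric_def using pushes_forward_fst pushes_forward_src by blast

end

text \<open>
  The map \<open>x \<mapsto> (1\<^sub>x, 1\<^sub>x)\<close> is a smooth section of \<open>src \<circ> fst\<close>, so every point of \<open>T\<^sub>2M\<close> is
  the image of a point of \<open>T\<^sub>2G\<^sup>(\<^sup>2\<^sup>)\<close>.
\<close>

lemma induced_zero_metric_unique:
  assumes 1: "induced_zero_metric G \<eta>2 \<eta>" and 2: "induced_zero_metric G \<eta>2 \<eta>'"
    and c: "c \<in> points (T2 (base G))"
  shows "\<eta> c = \<eta>' c"
proof -
  let ?u = "\<lambda>x. (idn G x, idn G x)"
  have u: "dsmooth (base G) (composable G) ?u"
    by (rule dsmooth_composable[OF diffeological_base dsmooth_idn dsmooth_idn]) (simp add: idn_laws)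
  define c' where "c' = T2_map (composable G) ?u c"
  have c': "c' \<in> points (T2 (composable G))"
    unfolding c'_def by (rule T2_map_point[OF u c])
  have sf: "dsmooth (composable G) (base G) (src G \<circ> fst)"
    by (rule dsmooth_compose[OF dsmooth_fst dsmooth_src])
  have id: "dsmooth (base G) (base G) (\<lambda>x. x)"
    by (rule dsmoothI) (simp_all add: comp_def)
  have "T2_map (base G) (src G) (T2_map (arrows G) fst c') = T2_map (base G) (src G \<circ> fst) c'"
    by (rule T2_map_compose[OF dsmooth_fst dsmooth_src c'])
  also have "\<dots> = T2_map (base G) (src G \<circ> fst \<circ> ?u) c"
    unfolding c'_def by (rule T2_map_compose[OF u sf c])
  also have "\<dots> = T2_map (base G) (\<lambda>x. x) c"
    by (rule T2_map_cong[OF diffeological_base diffeological_base dsmooth_compose[OF u sf] id _ c])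
      (simp add: idn_laws)
  also have "\<dots> = c"
    using c by (rule T2_pointE) (simp add: T2_map_class[OF id] comp_def)
  finally have *: "T2_map (base G) (src G) (T2_map (arrows G) fst c') = c" .
  \<comment> \<open>The right-hand side does not mention \<zeta>: any induced 0-metric is read off
    from \<eta>2 at the lifted point \<open>c'\<close>.\<close>
  have eq: "\<zeta> c = \<eta>2 c'" if "induced_zero_metric G \<eta>2 \<zeta>" for \<zeta>
  proof -
    obtain \<eta>1 where "pushes_forward (composable G) (arrows G) fst \<eta>2 \<eta>1"
        "pushes_forward (arrows G) (base G) (src G) \<eta>1 \<zeta>"
      using \<open>induced_zero_metric G \<eta>2 \<zeta>\<close> by (auto simp: induced_zero_metric_def)
    then show ?thesis
      using * c' T2_map_point[OF dsmooth_fst c'] unfolding pushes_forward_def by metis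
  qed
  show ?thesis using eq[OF 1] eq[OF 2] by simp
qed

text \<open>Uniqueness of the induced 0-metric gives equality on \<open>T2 M\<close> only, so a
  transfer between functions that may differ elsewhere is needed.\<close>

lemma induced_zero_metric_cong:
  assumes "induced_zero_metric G \<eta>2 \<eta>" "riemannian_manifold (base G) \<eta>'"
    and "\<And>c. c \<in> points (T2 (base G)) \<Longrightarrow> \<eta>' c = \<eta> c"
  shows "induced_zero_metric G \<eta>2 \<eta>'"
  using assms T2_map_point[OF dsmooth_src]
  unfolding induced_zero_metric_def pushes_forward_def by fastforce

lemma stack_metric_of_pull_map:
  assumes g: "definite_wrt (base G) (orbit_space G) (orbit_map G) g"
  defines "\<eta> \<equiv> pull_map (orbit_space G) (orbit_map G) g"
  shows "stack_metric_of G \<eta> \<in> stack_metrics G"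
    and "stack_zero_metric G (stack_metric_of G \<eta>) \<eta>"
proof -
  show *: "stack_metric_of G \<eta> \<in> stack_metrics G"
    unfolding stack_metric_of_def stack_metrics_def \<eta>_def
    by (rule quotientI) (simp add: two_metric_metric2[OF g])
  have "induced_zero_metric G \<eta>2 \<eta>" if "\<eta>2 \<in> stack_metric_of G \<eta>" for \<eta>2
  proof -
    \<comment> \<open>Equivalence provides some common 0-metric \<zeta>; since \<eta> is also
      induced by the defining 2-metric, the two agree on \<open>T2 M\<close>.\<close>
    obtain \<zeta> where z: "induced_zero_metric G (pull_map (arrows G) fst (pull_map (base G) (src G) \<eta>)) \<zeta>"
        "induced_zero_metric G \<eta>2 \<zeta>"
      using \<open>\<eta>2 \<in> stack_metric_of G \<eta>\<close> by (auto simp: stack_metric_of_def two_metric_equiv_def)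
    show ?thesis
      using induced_zero_metric_unique[OF induced_zero_metric_metric2[OF g] z(1)[unfolded \<eta>_def]]
        riemannian_metric0[OF g]
      unfolding \<eta>_def by (intro induced_zero_metric_cong[OF z(2)]) auto
  qed
  with * show "stack_zero_metric G (stack_metric_of G \<eta>) \<eta>"
    by (simp add: stack_zero_metric_def)
qed

end

theorem proposition4p29:
  fixes G :: "('g, 'm) groupoid"
  assumes "etale_groupoid G"
    and "diff_etale (base G) (orbit_space G) (orbit_map G)"
  shows
    "(\<forall>\<eta>. zero_metric G \<eta> \<longrightarrow>
        (\<exists>g. induces G \<eta> g \<and> weak_metric (orbit_space G) g \<and> definite (orbit_space G) g)) \<and>
     (\<forall>g. weak_metric (orbit_space G) g \<and>
          definite_wrt (base G) (orbit_space G) (orbit_map G) g \<longrightarrow>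
        (let \<eta> = pull_map (orbit_space G) (orbit_map G) g in
           zero_metric G \<eta> \<and>
           stack_metric_of G \<eta> \<in> stack_metrics G \<and>
           stack_induces G (stack_metric_of G \<eta>) g))"
proof -
  obtain m where "lie_groupoid m m G"
    using assms(1) by (auto simp: etale_groupoid_def)
  then interpret etale_lie_groupoid G m by unfold_locales
  show ?thesis
  proof (intro conjI allI impI)
    fix \<eta> assume "zero_metric G \<eta>"
    then show "\<exists>g. induces G \<eta> g \<and> weak_metric (orbit_space G) g \<and> definite (orbit_space G) g"
      using induces_descend weak_metric_descend definite_descend assms(2) by blast
  next
    fix g assume *: "weak_metric (orbit_space G) g \<and>
      definite_wrt (base G) (orbit_space G) (orbit_map G) g"
    let ?\<eta> = "pull_map (orbit_space G) (orbit_map G) g"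
    have "zero_metric G ?\<eta>"
      using * by (intro zero_metric_pull_map) (simp add: definite_wrt_def)
    moreover have "induces G ?\<eta> g"
      using * by (simp add: induces_def)
    ultimately show "let \<eta> = ?\<eta> in zero_metric G \<eta> \<and> stack_metric_of G \<eta> \<in> stack_metrics G \<and>
        stack_induces G (stack_metric_of G \<eta>) g"
      using stack_metric_of_pull_map[of g] * unfolding Let_def stack_induces_def by blast
  qed
qed

end
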